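(* Let $G$ be an l.c.s.c. group, $A$ a discrete (countable) $G$-module and $p\geq 0$. Then every class in $\mathrm{H}^p_{\mathrm{m}}(G,A)$ has a representative $G$-equivariant measurable cocycle $\sigma:G^{p+1}\to A$ in the homogeneous bar resolution which is locally finite-valued (every point has a neighbourhood on which $\sigma$ takes finitely many values) and is locally constant on some dense open subset of $G^{p+1}$ of full Haar measure. Moreover, if $G$ is a closed algebraic subgroup of $\mathrm{GL}_n(\mathbb{R})$ for some $n$, then the representative $\sigma$ may be chosen to be locally finite-valued with each level set agreeing locally with a semi-algebraic subset of $G^{p+1}$ (viewing $G^{p+1}$ as a real algebraic variety in $M_{n\times n}(\mathbb{R})^{p+1}$), and locally constant on a neighbourhood of the identity $(e,\dots,e)$.
   Context: Measurable cohomology: for an l.c.s.c. group $G$ and a Polish $G$-module $A$, cochains are Haar-a.e. classes of measurable maps $G^{p+1}\to A$ with diagonal action $(g\cdot\phi)(g_1,\dots)=g\cdot\phi(g^{-1}g_1,\dots)$; $G$-equivariant means fixed by this action. The differential is $d\sigma(g_1,\dots,g_{p+1})=\sum_{i=1}^{p+1}(-1)^{p+1-i}\sigma(g_1,\dots,\widehat{g_i},\dots,g_{p+1})$, and $\mathrm{H}^p_{\mathrm{m}}(G,A)$ is the homology in degree $p$ (cochains on $G^{p+1}$) of the complex of $G$-equivariant cochains. "Level sets agree locally with semi-algebraic sets" means each point has a neighbourhood $U$ such that the intersection of each level set with $U$ equals the intersection of $U$ with a semi-algebraic set. *)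

theory Defs
  imports "HOL-Analysis.Analysis"
begin

text \<open>A group is given by a carrier set G inside a Hausdorff, second countable
  topological type, with explicit multiplication m, inverse i and unit e; it carries the
  subspace topology.  (Every l.c.s.c. group arises this way, e.g. with G = UNIV.)\<close>

definition lcsc_group ::
  "'g::{t2_space,second_countable_topology} set \<Rightarrow> ('g \<Rightarrow> 'g \<Rightarrow> 'g) \<Rightarrow> ('g \<Rightarrow> 'g) \<Rightarrow> 'g \<Rightarrow> bool"
  where "lcsc_group G m i e \<longleftrightarrow>
     e \<in> G \<and> (\<forall>x\<in>G. \<forall>y\<in>G. m x y \<in> G) \<and> (\<forall>x\<in>G. i x \<in> G)
   \<and> (\<forall>x\<in>G. \<forall>y\<in>G. \<forall>z\<in>G. m (m x y) z = m x (m y z))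
   \<and> (\<forall>x\<in>G. m e x = x \<and> m x e = x \<and> m (i x) x = e \<and> m x (i x) = e)
   \<and> continuous_on (G \<times> G) (\<lambda>z. m (fst z) (snd z))
   \<and> continuous_on G i
   \<and> locally_compact_space (top_of_set G)"

definition haar_measure :: "'g::topological_space set \<Rightarrow> ('g \<Rightarrow> 'g \<Rightarrow> 'g) \<Rightarrow> 'g measure \<Rightarrow> bool"
  where "haar_measure G m \<mu> \<longleftrightarrow>
     space \<mu> = G \<and> sets \<mu> = sets (restrict_space borel G)
   \<and> (\<forall>g\<in>G. \<forall>B\<in>sets \<mu>. emeasure \<mu> (m g ` B) = emeasure \<mu> B)
   \<and> (\<forall>K. compact K \<and> K \<subseteq> G \<longrightarrow> emeasure \<mu> K < \<infinity>)
   \<and> (\<forall>U. openin (top_of_set G) U \<and> U \<noteq> {} \<longrightarrow> emeasure \<mu> U > 0)"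

definition discrete_module ::
  "'g::topological_space set \<Rightarrow> ('g \<Rightarrow> 'g \<Rightarrow> 'g) \<Rightarrow> 'g \<Rightarrow> ('g \<Rightarrow> 'a::{ab_group_add,countable} \<Rightarrow> 'a) \<Rightarrow> bool"
  where "discrete_module G m e act \<longleftrightarrow>
     (\<forall>a. act e a = a)
   \<and> (\<forall>g\<in>G. \<forall>h\<in>G. \<forall>a. act (m g h) a = act g (act h a))
   \<and> (\<forall>g\<in>G. \<forall>a b. act g (a + b) = act g a + act g b)
   \<and> (\<forall>a b. openin (top_of_set G) {g\<in>G. act g a = b})"

definition tuples :: "'g set \<Rightarrow> nat \<Rightarrow> (nat \<Rightarrow> 'g) set"
  where "tuples G q = PiE {..<q} (\<lambda>_. G)"

definition tmeas :: "'g measure \<Rightarrow> nat \<Rightarrow> (nat \<Rightarrow> 'g) measure"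
  where "tmeas \<mu> q = PiM {..<q} (\<lambda>_. \<mu>)"

definition gshift :: "('g \<Rightarrow> 'g \<Rightarrow> 'g) \<Rightarrow> 'g \<Rightarrow> nat \<Rightarrow> (nat \<Rightarrow> 'g) \<Rightarrow> (nat \<Rightarrow> 'g)"
  where "gshift m g q x = restrict (\<lambda>k. m g (x k)) {..<q}"

definition face :: "nat \<Rightarrow> nat \<Rightarrow> (nat \<Rightarrow> 'g) \<Rightarrow> (nat \<Rightarrow> 'g)"
  where "face q i x = restrict (\<lambda>k. if k < i then x k else x (Suc k)) {..<q}"

text \<open>Differential: sigma a cochain on q-tuples, d sigma on (q+1)-tuples,
  d sigma(x_0..x_q) = sum_{i=0..q} (-1)^(q-i) sigma(x_0..omit x_i..x_q)
  (0-based form of the formula with indices 1..q+1).\<close>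
definition cobdry :: "nat \<Rightarrow> ((nat \<Rightarrow> 'g) \<Rightarrow> 'a::ab_group_add) \<Rightarrow> (nat \<Rightarrow> 'g) \<Rightarrow> 'a"
  where "cobdry q \<sigma> x = (\<Sum>i\<le>q. if even (q - i) then \<sigma> (face q i x) else - \<sigma> (face q i x))"

definition eq_cochain ::
  "('g \<Rightarrow> 'g \<Rightarrow> 'g) \<Rightarrow> ('g \<Rightarrow> 'g) \<Rightarrow> 'g set \<Rightarrow> ('g \<Rightarrow> 'a \<Rightarrow> 'a) \<Rightarrow> 'g measure \<Rightarrow> nat
     \<Rightarrow> ((nat \<Rightarrow> 'g) \<Rightarrow> 'a) \<Rightarrow> bool"
  where "eq_cochain m i G act \<mu> q f \<longleftrightarrow>
     f \<in> measurable (tmeas \<mu> q) (count_space UNIV)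
   \<and> (\<forall>g\<in>G. AE x in tmeas \<mu> q. act g (f (gshift m (i g) q x)) = f x)"

definition mcocycle ::
  "('g \<Rightarrow> 'g \<Rightarrow> 'g) \<Rightarrow> ('g \<Rightarrow> 'g) \<Rightarrow> 'g set \<Rightarrow> ('g \<Rightarrow> 'a::ab_group_add \<Rightarrow> 'a) \<Rightarrow> 'g measure \<Rightarrow> nat
     \<Rightarrow> ((nat \<Rightarrow> 'g) \<Rightarrow> 'a) \<Rightarrow> bool"
  where "mcocycle m i G act \<mu> p f \<longleftrightarrow>
     eq_cochain m i G act \<mu> (Suc p) f
   \<and> (AE x in tmeas \<mu> (Suc (Suc p)). cobdry (Suc p) f x = 0)"

text \<open>sigma and f define the same class in H^p_m(G,A).  In degree 0 there are no
  coboundaries, so the class is the a.e.-class itself.\<close>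
definition cohomologous ::
  "('g \<Rightarrow> 'g \<Rightarrow> 'g) \<Rightarrow> ('g \<Rightarrow> 'g) \<Rightarrow> 'g set \<Rightarrow> ('g \<Rightarrow> 'a::ab_group_add \<Rightarrow> 'a) \<Rightarrow> 'g measure \<Rightarrow> nat
     \<Rightarrow> ((nat \<Rightarrow> 'g) \<Rightarrow> 'a) \<Rightarrow> ((nat \<Rightarrow> 'g) \<Rightarrow> 'a) \<Rightarrow> bool"
  where "cohomologous m i G act \<mu> p \<sigma> f \<longleftrightarrow>
     (if p = 0 then (AE x in tmeas \<mu> 1. \<sigma> x = f x)
      else (\<exists>\<tau>. eq_cochain m i G act \<mu> p \<tau>
                 \<and> (AE x in tmeas \<mu> (Suc p). \<sigma> x - f x = cobdry p \<tau> x)))"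

definition loc_finite_valued :: "('x::topological_space) set \<Rightarrow> ('x \<Rightarrow> 'a) \<Rightarrow> bool"
  where "loc_finite_valued X \<sigma> \<longleftrightarrow> (\<forall>x\<in>X. \<exists>U. open U \<and> x \<in> U \<and> finite (\<sigma> ` (U \<inter> X)))"

definition loc_const_on :: "('x::topological_space) set \<Rightarrow> ('x \<Rightarrow> 'a) \<Rightarrow> bool"
  where "loc_const_on W \<sigma> \<longleftrightarrow> (\<forall>x\<in>W. \<exists>U. open U \<and> x \<in> U \<and> (\<forall>y\<in>U \<inter> W. \<sigma> y = \<sigma> x))"

inductive_set polyfuns :: "('x \<Rightarrow> real) set \<Rightarrow> ('x \<Rightarrow> real) set" for C where
  pconst: "(\<lambda>_. c) \<in> polyfuns C"
| pcoord: "f \<in> C \<Longrightarrow> f \<in> polyfuns C"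
| padd: "f \<in> polyfuns C \<Longrightarrow> g \<in> polyfuns C \<Longrightarrow> (\<lambda>x. f x + g x) \<in> polyfuns C"
| pmult: "f \<in> polyfuns C \<Longrightarrow> g \<in> polyfuns C \<Longrightarrow> (\<lambda>x. f x * g x) \<in> polyfuns C"

inductive_set semialg :: "('x \<Rightarrow> real) set \<Rightarrow> 'x set set" for C where
  sbasic: "f \<in> polyfuns C \<Longrightarrow> {x. 0 < f x} \<in> semialg C"
| scompl: "S \<in> semialg C \<Longrightarrow> - S \<in> semialg C"
| sunion: "S \<in> semialg C \<Longrightarrow> T \<in> semialg C \<Longrightarrow> S \<union> T \<in> semialg C"

definition mat_coords :: "(real^'n^'n \<Rightarrow> real) set"
  where "mat_coords = {(\<lambda>A. A $ r $ s) | r s. True}"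

definition tuple_coords :: "nat \<Rightarrow> ((nat \<Rightarrow> real^'n^'n) \<Rightarrow> real) set"
  where "tuple_coords q = {(\<lambda>x. x k $ r $ s) | k r s. k < q}"

definition closed_algebraic_subgroup :: "(real^'n^'n) set \<Rightarrow> bool"
  where "closed_algebraic_subgroup G \<longleftrightarrow>
     mat 1 \<in> G \<and> (\<forall>A\<in>G. \<forall>B\<in>G. A ** B \<in> G) \<and> (\<forall>A\<in>G. matrix_inv A \<in> G)
   \<and> (\<exists>S \<subseteq> polyfuns mat_coords. G = {A. invertible A \<and> (\<forall>f\<in>S. f A = 0)})
   \<and> closedin (top_of_set {A. invertible A}) G"

end

(* Call a function of (x, y), x in G^a and y in G^k, tame if locally in x it is determined, up to
   small measure in y, by finitely many tests whether x_b^-1 x_c lies in a basic open set B.  A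
   measurable cocycle f on G^(p+1) is tame for a = 0, and a tame function with k = 0 is locally
   determined by finitely many tests.  Moving the variables one at a time from the y-side to the
   x-side leads from f to such a cocycle: in each step one has to solve d_y S = Z for S, with a
   given tame Z that is a cocycle in y.  A cone over a generic point solves the equation for fixed
   x.  To keep S tame and equivariant one replaces x by the representatives of finer and finer
   cells, defined by tests, and sums cones of the differences, which converges by Borel-Cantelli.
   The resulting cocycle is cohomologous to f by a prism homotopy along a generic right
   translation.  It remains to choose the basis of open sets: with null boundaries in general, and
   for algebraic groups the balls whose boundary avoids the identity, where x_b^-1 x_c in B becomes
   a polynomial inequality after multiplication by the squared determinant of x_b. *)

theory Submission
  imports Defs "HOL-Probability.Probability"
begin

section \<open>Groups, modules and tuples\<close>

text \<open>A cocycle is an almost-everywhere class, so its single values mean nothing. Hence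
  equations hold for every x but only up to null sets in y. With no variables y left, the measure
  lives on one empty tuple, where small means empty, so the last function has honest values.
  Smallness needs a probability measure: Haar measure is replaced by one with the same null sets,
  for which invariance weakens to local uniform absolute continuity. Quotients are tested because
  the diagonal action does not change them; the price is that x is seen only up to translation, so
  cones are built for x_0 = e and carried back by x_0. This preserves tameness because translating a
  measurable cochain is continuous in measure, which for values in a discrete module means agreement
  off a small set. The comparison of the two cocycles would naturally repeat a vertex x_a; tuples
  with a repeated vertex may form a null set, where almost-everywhere identities say nothing. The
  second copy is therefore x_a h, and right multiplication is used since it commutes with the
  diagonal left action.\<close>

locale haar_module =
  fixes G :: "'g::{t2_space,second_countable_topology} set"
    and m :: "'g \<Rightarrow> 'g \<Rightarrow> 'g" and i :: "'g \<Rightarrow> 'g" and e :: 'g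
    and \<mu> :: "'g measure" and act :: "'g \<Rightarrow> 'a::{ab_group_add,countable} \<Rightarrow> 'a"
  assumes lcsc: "lcsc_group G m i e" and haar: "haar_measure G m \<mu>"
    and dmod: "discrete_module G m e act"
begin

lemma e_in [simp, intro]: "e \<in> G"
  and m_in [simp, intro]: "\<And>x y. x \<in> G \<Longrightarrow> y \<in> G \<Longrightarrow> m x y \<in> G"
  and i_in [simp, intro]: "\<And>x. x \<in> G \<Longrightarrow> i x \<in> G"
  and m_assoc: "\<And>x y z. x \<in> G \<Longrightarrow> y \<in> G \<Longrightarrow> z \<in> G \<Longrightarrow> m (m x y) z = m x (m y z)"
  and m_e [simp]: "\<And>x. x \<in> G \<Longrightarrow> m x e = x" "\<And>x. x \<in> G \<Longrightarrow> m e x = x"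
  and m_inv [simp]: "\<And>x. x \<in> G \<Longrightarrow> m (i x) x = e" "\<And>x. x \<in> G \<Longrightarrow> m x (i x) = e"
  and cont_m: "continuous_on (G \<times> G) (\<lambda>z. m (fst z) (snd z))"
  and cont_i: "continuous_on G i"
  and loc_compact: "locally_compact_space (top_of_set G)"
  using lcsc unfolding lcsc_group_def by auto

lemma inv_m_cancel [simp]:
  assumes "x \<in> G" "y \<in> G"
  shows "m (i x) (m x y) = y" "m x (m (i x) y) = y" "m (m y x) (i x) = y" "m (m y (i x)) x = y"
  using assms by (simp_all add: m_assoc[symmetric]) (simp_all add: m_assoc)

lemma m_left_cancel:
  assumes "x \<in> G" "y \<in> G" "z \<in> G" "m x y = m x z"
  shows "y = z"
  using assms inv_m_cancel(1) by metis

lemma i_i [simp]: "x \<in> G \<Longrightarrow> i (i x) = x"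
  by (rule m_left_cancel[of "i x"]) auto

lemma i_m: "x \<in> G \<Longrightarrow> y \<in> G \<Longrightarrow> i (m x y) = m (i y) (i x)"
  by (rule m_left_cancel[of "m x y"]) (auto simp: m_assoc)

lemma i_e [simp]: "i e = e"
  using m_inv(1)[of e] by simp

lemma act_e [simp]: "act e a = a"
  and act_m: "g \<in> G \<Longrightarrow> h \<in> G \<Longrightarrow> act (m g h) a = act g (act h a)"
  and act_add: "g \<in> G \<Longrightarrow> act g (a + b) = act g a + act g b"
  and act_open: "openin (top_of_set G) {g \<in> G. act g a = b}"
  using dmod unfolding discrete_module_def by auto

lemma act_0 [simp]: "g \<in> G \<Longrightarrow> act g 0 = 0"
  using act_add[of g 0 0] by simp

lemma act_minus: "g \<in> G \<Longrightarrow> act g (- a) = - act g a"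
  using act_add[of g a "- a"] by (simp add: eq_neg_iff_add_eq_0 add.commute)

lemma act_diff: "g \<in> G \<Longrightarrow> act g (a - b) = act g a - act g b"
  using act_add[of g a "- b"] by (simp add: act_minus)

lemma act_sum: "g \<in> G \<Longrightarrow> act g (sum f A) = (\<Sum>x\<in>A. act g (f x))"
  by (induction A rule: infinite_finite_induct) (auto simp: act_add)

lemma act_inv [simp]: "g \<in> G \<Longrightarrow> act g (act (i g) a) = a" "g \<in> G \<Longrightarrow> act (i g) (act g a) = a"
  by (simp_all add: act_m[symmetric])

section \<open>Tuples, the diagonal action and the face maps\<close>

abbreviation "T \<equiv> tuples G"
abbreviation "sh g q x \<equiv> gshift m g q x"

lemma tuples_D: "x \<in> T q \<Longrightarrow> k < q \<Longrightarrow> x k \<in> G"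
  by (auto simp: tuples_def)

lemma restrict_in_tuples: "(\<And>k. k < q \<Longrightarrow> f k \<in> G) \<Longrightarrow> restrict f {..<q} \<in> T q"
  by (auto simp: tuples_def)

lemma tuples_eqI: "x \<in> T q \<Longrightarrow> y \<in> T q \<Longrightarrow> (\<And>k. k < q \<Longrightarrow> x k = y k) \<Longrightarrow> x = y"
  unfolding tuples_def by (rule PiE_ext) auto

lemma sh_in [simp, intro]: "g \<in> G \<Longrightarrow> x \<in> T q \<Longrightarrow> sh g q x \<in> T q"
  unfolding gshift_def by (rule restrict_in_tuples) (auto intro: tuples_D)

lemma sh_sh: "g \<in> G \<Longrightarrow> h \<in> G \<Longrightarrow> x \<in> T q \<Longrightarrow> sh g q (sh h q x) = sh (m g h) q x"
  by (rule tuples_eqI[of _ q]) (auto simp: gshift_def m_assoc tuples_D[of x q] intro!: restrict_in_tuples)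

lemma sh_e [simp]: "x \<in> T q \<Longrightarrow> sh e q x = x"
  by (rule tuples_eqI[of _ q]) (auto simp: gshift_def tuples_D[of x q] intro!: restrict_in_tuples)

lemma sh_inv [simp]: "g \<in> G \<Longrightarrow> x \<in> T q \<Longrightarrow> sh g q (sh (i g) q x) = x"
  "g \<in> G \<Longrightarrow> x \<in> T q \<Longrightarrow> sh (i g) q (sh g q x) = x"
  by (simp_all add: sh_sh)

lemma face_in [simp, intro]: "x \<in> T (Suc q) \<Longrightarrow> face q j x \<in> T q"
  unfolding face_def by (rule restrict_in_tuples) (auto intro: tuples_D)

lemma face_sh: "x \<in> T (Suc q) \<Longrightarrow> g \<in> G \<Longrightarrow> face q j (sh g (Suc q) x) = sh g q (face q j x)"
  by (rule tuples_eqI[of _ q]) (auto intro: face_in, auto simp: face_def gshift_def)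

section \<open>Borel measurability of the group operations and of the action\<close>

abbreviation "N \<equiv> restrict_space borel G"

lemma space_mu [simp]: "space \<mu> = G" and sets_mu [measurable_cong]: "sets \<mu> = sets N"
  and mu_left: "g \<in> G \<Longrightarrow> B \<in> sets \<mu> \<Longrightarrow> emeasure \<mu> (m g ` B) = emeasure \<mu> B"
  and mu_compact: "compact K \<Longrightarrow> K \<subseteq> G \<Longrightarrow> emeasure \<mu> K < \<infinity>"
  and mu_open: "openin (top_of_set G) U \<Longrightarrow> U \<noteq> {} \<Longrightarrow> emeasure \<mu> U > 0"
  using haar unfolding haar_measure_def by auto

lemma space_N [simp]: "space N = G"
  by (simp add: space_restrict_space)

lemma open_N [measurable]: "openin (top_of_set G) U \<Longrightarrow> U \<in> sets N"
  by (auto simp: openin_open sets_restrict_space)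

lemma compact_N: "compact K \<Longrightarrow> K \<subseteq> G \<Longrightarrow> K \<in> sets N"
  unfolding sets_restrict_space using compact_imp_closed[of K]
  by (intro image_eqI[of _ _ K]) auto

text \<open>Continuity of \<open>m\<close> on \<open>G \<times> G\<close> makes it Borel there;
  second countability is what makes the pair of two Borel maps Borel for the product
  topology.\<close>

lemma m_measurable [measurable (raw)]:
  assumes [measurable]: "f \<in> measurable M N" "h \<in> measurable M N"
  shows "(\<lambda>x. m (f x) (h x)) \<in> measurable M N"
proof (rule measurable_restrict_space2)
  have fG: "f x \<in> G" if "x \<in> space M" for x using measurable_space[OF assms(1) that] by simp
  have hG: "h x \<in> G" if "x \<in> space M" for x using measurable_space[OF assms(2) that] by simp
  show "(\<lambda>x. m (f x) (h x)) \<in> space M \<rightarrow> G" using fG hG by auto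
  have 1: "(\<lambda>z. m (fst z) (snd z)) \<in> measurable (restrict_space borel (G \<times> G)) borel"
    by (rule borel_measurable_continuous_on_restrict[OF cont_m])
  have "f \<in> borel_measurable M" "h \<in> borel_measurable M"
    using assms by (auto simp: measurable_restrict_space2_iff)
  then have "(\<lambda>x. (f x, h x)) \<in> measurable M (restrict_space borel (G \<times> G))"
    using fG hG by (intro measurable_restrict_space2 borel_measurable_Pair) auto
  from measurable_compose[OF this 1] show "(\<lambda>x. m (f x) (h x)) \<in> borel_measurable M" by simp
qed

lemma i_measurable [measurable]: "i \<in> measurable N N"
  by (rule measurable_restrict_space2)
     (auto intro: borel_measurable_continuous_on_restrict[OF cont_i])

text \<open>For a fixed module element the orbit map has open level sets, and \<open>h\<close> takes
  only countably many values, so the two variables can be treated one after the other.\<close>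

lemma act_measurable [measurable (raw)]:
  assumes [measurable]: "f \<in> measurable M N" "h \<in> measurable M (count_space UNIV)"
  shows "(\<lambda>x. act (f x) (h x)) \<in> measurable M (count_space UNIV)"
proof -
  have "(\<lambda>g. act g a) \<in> measurable N (count_space UNIV)" for a
    by (subst measurable_count_space_eq2_countable)
      (simp_all add: vimage_def Int_def conj_commute open_N[OF act_open])
  from measurable_compose[OF assms(1) this] show ?thesis
    by (rule measurable_compose_countable) fact+
qed

lemma count_measurable2:
  fixes h1 :: "'x \<Rightarrow> 'b::countable" and h2 :: "'x \<Rightarrow> 'c::countable"
  assumes [measurable]: "h1 \<in> measurable M (count_space UNIV)" "h2 \<in> measurable M (count_space UNIV)"
  shows "(\<lambda>x. F (h1 x) (h2 x)) \<in> measurable M (count_space UNIV)"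
  by (rule measurable_compose_countable[OF measurable_compose[OF assms(2)] assms(1)]) simp

lemma sum_count_measurable [measurable (raw)]:
  fixes h :: "'j \<Rightarrow> 'x \<Rightarrow> 'b::{countable,ab_group_add}"
  assumes "\<And>j. j \<in> J \<Longrightarrow> h j \<in> measurable M (count_space UNIV)"
  shows "(\<lambda>x. \<Sum>j\<in>J. h j x) \<in> measurable M (count_space UNIV)"
  using assms
proof (induction J rule: infinite_finite_induct)
  case (insert j J)
  then have "(\<lambda>x. h j x + (\<Sum>j\<in>J. h j x)) \<in> measurable M (count_space UNIV)"
    by (intro count_measurable2[of _ _ _ "(+)"]) auto
  then show ?case using insert by simp
qed auto

lemma face_measurable [measurable]: "(\<lambda>x. face q j x) \<in> measurable (tmeas M (Suc q)) (tmeas M q)"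
  unfolding face_def tmeas_def by (rule measurable_restrict) auto

lemma space_tmeas: "space M = G \<Longrightarrow> space (tmeas M q) = T q"
  by (simp add: tmeas_def tuples_def space_PiM)

lemma sets_tmeas_cong: "sets M = sets M' \<Longrightarrow> sets (tmeas M q) = sets (tmeas M' q)"
  unfolding tmeas_def by (rule sets_PiM_cong) auto

lemma sh_measurable [measurable (raw)]:
  assumes [measurable]: "f \<in> measurable M N" "h \<in> measurable M (tmeas N q)"
  shows "(\<lambda>x. sh (f x) q (h x)) \<in> measurable M (tmeas N q)"
  unfolding gshift_def tmeas_def
proof (rule measurable_restrict)
  fix k assume k: "k \<in> {..<q}"
  have "(\<lambda>x. h x k) \<in> measurable M N"
    using measurable_compose[OF assms(2)[unfolded tmeas_def] measurable_component_singleton[OF k]] by simp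
  then show "(\<lambda>x. m (f x) (h x k)) \<in> measurable M N" by measurable
qed

end

section \<open>An equivalent probability measure\<close>

context haar_module begin

lemma compact_nbhd:
  assumes "x \<in> G"
  obtains U K where "openin (top_of_set G) U" "compact K" "x \<in> U" "U \<subseteq> K" "K \<subseteq> G"
  using loc_compact assms unfolding locally_compact_space_def compactin_subtopology by fastforce

text \<open>Second countability gives a countable subcover of the cover by relatively open sets that
  lie in a compact subset of \<open>G\<close>.\<close>

lemma compact_exhaustion:
  obtains U K :: "nat \<Rightarrow> 'g set"
  where "\<And>n. openin (top_of_set G) (U n)" "\<And>n. compact (K n)" "\<And>n. U n \<subseteq> K n" "\<And>n. K n \<subseteq> G"
    "(\<Union>n. U n) = G"
proof -
  define F where "F = {U. openin (top_of_set G) U \<and> (\<exists>K. compact K \<and> U \<subseteq> K \<and> K \<subseteq> G)}"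
  have U: "\<Union>F = G"
  proof
    show "\<Union>F \<subseteq> G" by (auto simp: F_def)
    show "G \<subseteq> \<Union>F"
    proof
      fix x assume "x \<in> G"
      from compact_nbhd[OF this] obtain U K
        where "openin (top_of_set G) U" "compact K" "x \<in> U" "U \<subseteq> K" "K \<subseteq> G" .
      then show "x \<in> \<Union>F" unfolding F_def by blast
    qed
  qed
  obtain F' where F': "F' \<subseteq> F" "countable F'" "\<Union>F' = \<Union>F"
    using Lindelof_openin[of F G] by (auto simp: F_def)
  have ne: "F' \<noteq> {}" using F'(3) U e_in by auto
  have "\<forall>n. from_nat_into F' n \<in> F" using from_nat_into[OF ne] F'(1) by auto
  then have "\<forall>n. \<exists>K. compact K \<and> from_nat_into F' n \<subseteq> K \<and> K \<subseteq> G" by (auto simp: F_def)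
  then obtain K where K: "\<And>n. compact (K n) \<and> from_nat_into F' n \<subseteq> K n \<and> K n \<subseteq> G" by metis
  show thesis
  proof (rule that[of "from_nat_into F'" K])
    show "openin (top_of_set G) (from_nat_into F' n)" for n
      using \<open>\<forall>n. from_nat_into F' n \<in> F\<close> by (auto simp: F_def)
    show "(\<Union>n. from_nat_into F' n) = G"
      using range_from_nat_into[OF ne F'(2)] F'(3) U by simp
  qed (use K in auto)
qed

lemma sigma_finite_mu: "sigma_finite_measure \<mu>"
proof
  obtain U K where K: "\<And>n::nat. openin (top_of_set G) (U n)" "\<And>n. compact (K n)" "\<And>n. U n \<subseteq> K n"
    "\<And>n. K n \<subseteq> G" "(\<Union>n. U n) = G" by (rule compact_exhaustion) blast
  show "\<exists>A. countable A \<and> A \<subseteq> sets \<mu> \<and> \<Union> A = space \<mu> \<and> (\<forall>a\<in>A. emeasure \<mu> a \<noteq> \<infinity>)"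
  proof (intro exI[of _ "range K"] conjI)
    show "range K \<subseteq> sets \<mu>" using compact_N[OF K(2,4)] by (auto simp: sets_mu)
    show "\<Union> (range K) = space \<mu>" using K(3,4,5) by fastforce
    show "\<forall>a\<in>range K. emeasure \<mu> a \<noteq> \<infinity>" using mu_compact[OF K(2,4)] by (auto simp: less_top)
  qed auto
qed

lemma open_finite_exhaustion:
  obtains U :: "nat \<Rightarrow> 'g set" where "\<And>n. openin (top_of_set G) (U n)" "\<And>n. emeasure \<mu> (U n) < \<infinity>"
    "(\<Union>n. U n) = G"
proof -
  obtain U K where K: "\<And>n::nat. openin (top_of_set G) (U n)" "\<And>n. compact (K n)" "\<And>n. U n \<subseteq> K n"
    "\<And>n. K n \<subseteq> G" "(\<Union>n. U n) = G" by (rule compact_exhaustion) blast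
  have "emeasure \<mu> (U n) < \<infinity>" for n
    using emeasure_mono[OF K(3)[of n], of \<mu>] mu_compact[OF K(2,4), of n] compact_N[OF K(2,4), of n]
    by (auto simp: sets_mu)
  with K show thesis by (intro that[of U]) auto
qed

text \<open>The weight is a normalised sum of indicators of open sets of finite measure that cover
  \<open>G\<close>. Every point meets a positive term, and a compact set is covered by finitely many
  of the open sets, which bounds the sum below on it.\<close>

lemma prob_weight_exists:
  obtains \<phi> :: "'g \<Rightarrow> ennreal" and C :: ennreal
  where "\<phi> \<in> borel_measurable N" "integral\<^sup>N \<mu> \<phi> = 1" "C < \<infinity>" "\<And>x. \<phi> x \<le> C"
    "\<And>K. compact K \<Longrightarrow> K \<subseteq> G \<Longrightarrow> \<exists>c>0. \<forall>x\<in>K. c \<le> \<phi> x"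
proof -
  obtain U where U: "\<And>n::nat. openin (top_of_set G) (U n)" "\<And>n. emeasure \<mu> (U n) < \<infinity>" "(\<Union>n. U n) = G"
    by (rule open_finite_exhaustion) blast
  have [measurable]: "U n \<in> sets N" for n using U(1) by measurable
  \<comment> \<open>With this denominator both \<open>a n\<close> and \<open>a n\<close> times the
    measure of \<open>U n\<close> are at most \<open>(1/2)^n\<close>, so one geometric series bounds
    the values and the integral of \<open>h\<close>.\<close>
  define a :: "nat \<Rightarrow> real" where "a n = (1/2)^n / (1 + measure \<mu> (U n))" for n
  have a0: "0 < a n" for n by (simp add: a_def add_pos_nonneg)
  define h where "h x = (\<Sum>n. ennreal (a n) * indicator (U n) x)" for x
  have hm [measurable]: "h \<in> borel_measurable N" unfolding h_def by measurable
  have geo: "(\<Sum>n. ennreal ((1/2)^n)) = 2"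
  proof -
    have "(\<lambda>n. (1/2::real)^n) sums 2" using geometric_sums[of "1/2::real"] by simp
    then have "(\<Sum>n. ennreal ((1/2)^n)) = ennreal 2" by (intro suminf_ennreal_eq) auto
    then show ?thesis by simp
  qed
  have hle: "h x \<le> 2" for x
    unfolding h_def geo[symmetric]
    by (intro suminf_le) (auto simp: a_def divide_le_eq ennreal_leI indicator_def mult_le_cancel_left1)
  have hint: "integral\<^sup>N \<mu> h = (\<Sum>n. ennreal (a n) * emeasure \<mu> (U n))"
    unfolding h_def by (subst nn_integral_suminf) (auto simp: nn_integral_cmult_indicator sets_mu)
  have "integral\<^sup>N \<mu> h \<le> 2"
    unfolding hint geo[symmetric]
  proof (intro suminf_le)
    fix n
    have "emeasure \<mu> (U n) = ennreal (measure \<mu> (U n))"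
      using U(2)[of n] by (simp add: emeasure_eq_ennreal_measure)
    then have "ennreal (a n) * emeasure \<mu> (U n) = ennreal (a n * measure \<mu> (U n))"
      using a0[of n] by (simp add: ennreal_mult)
    also have "\<dots> \<le> ennreal ((1/2)^n)"
      by (rule ennreal_leI) (simp add: a_def field_simps add_pos_nonneg)
    finally show "ennreal (a n) * emeasure \<mu> (U n) \<le> ennreal ((1/2)^n)" .
  qed auto
  then have fin: "integral\<^sup>N \<mu> h < \<infinity>"
    by (rule order.strict_trans1) simp
  have low: "ennreal (a n) \<le> h x" if "x \<in> U n" for x n
  proof -
    have "(\<Sum>k\<in>{n}. ennreal (a k) * indicator (U k) x) \<le> h x"
      unfolding h_def by (intro sum_le_suminf) auto
    with that show ?thesis by simp
  qed
  obtain n0 where n0: "e \<in> U n0" using U(3) e_in by blast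
  have pos: "integral\<^sup>N \<mu> h > 0"
  proof -
    have "0 < ennreal (a n0) * emeasure \<mu> (U n0)"
      using a0[of n0] mu_open[OF U(1)[of n0]] n0 by (auto simp: ennreal_zero_less_mult_iff)
    also have "\<dots> = (\<Sum>n\<in>{n0}. ennreal (a n) * emeasure \<mu> (U n))" by simp
    also have "\<dots> \<le> integral\<^sup>N \<mu> h" unfolding hint by (intro sum_le_suminf) auto
    finally show ?thesis .
  qed
  let ?I = "integral\<^sup>N \<mu> h"
  show thesis
  proof (rule that[of "\<lambda>x. h x / ?I" "2 / ?I"])
    show "(\<lambda>x. h x / ?I) \<in> borel_measurable N" by measurable
    show "(\<integral>\<^sup>+x. h x / ?I \<partial>\<mu>) = 1"
      using pos fin by (subst nn_integral_divide) (auto simp: ennreal_divide_self less_top)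
    show "2 / ?I < \<infinity>" using pos by (auto simp: ennreal_divide_eq_top_iff less_top[symmetric])
    show "h x / ?I \<le> 2 / ?I" for x by (rule divide_right_mono_ennreal[OF hle])
    fix K assume K: "compact K" "K \<subseteq> G"
    have "\<forall>n. \<exists>V. open V \<and> U n = G \<inter> V" using U(1) by (simp add: openin_open)
    then obtain V where V: "\<And>n. open (V n)" "\<And>n. U n = G \<inter> V n" by metis
    have "K \<subseteq> (\<Union>n\<in>UNIV. V n)" using K(2) U(3) V(2) by auto
    then obtain D where D: "finite D" "K \<subseteq> (\<Union>n\<in>D. V n)"
      using compactE_image[OF K(1), of UNIV V] V(1) by metis
    define b where "b = Min (insert 1 (a ` D))"
    have b0: "0 < b" unfolding b_def using D(1) a0 by (subst Min_gr_iff) auto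
    show "\<exists>c>0. \<forall>x\<in>K. c \<le> h x / ?I"
    proof (intro exI[of _ "ennreal b / ?I"] conjI ballI)
      show "0 < ennreal b / ?I" using b0 fin by (auto simp: ennreal_zero_less_divide)
      fix x assume x: "x \<in> K"
      then obtain n where n: "n \<in> D" "x \<in> V n" using D(2) by auto
      then have "x \<in> U n" using x K(2) V(2) by auto
      have "b \<le> a n" unfolding b_def using D(1) n(1) by (intro Min_le) auto
      then have "ennreal b \<le> h x" using low[OF \<open>x \<in> U n\<close>] by (meson ennreal_leI order_trans)
      then show "ennreal b / ?I \<le> h x / ?I" by (rule divide_right_mono_ennreal)
    qed
  qed
qed

end

text \<open>The probability measure with density \<open>\<phi>\<close> has the null sets of \<open>\<mu>\<close>.  As \<open>\<phi>\<close> is bounded, and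
  bounded below on compact sets, the left translations near a given point are uniformly
  absolutely continuous for it and for its powers, see \<open>translate_abs_cont\<close> below.\<close>

locale haar_prob = haar_module G m i e \<mu> act
  for G :: "'g::{t2_space,second_countable_topology} set" and m i e \<mu>
    and act :: "'g \<Rightarrow> 'a::{ab_group_add,countable} \<Rightarrow> 'a" +
  fixes \<phi> :: "'g \<Rightarrow> ennreal" and C :: ennreal
  assumes phi_meas [measurable]: "\<phi> \<in> borel_measurable (restrict_space borel G)"
    and phi_int: "integral\<^sup>N \<mu> \<phi> = 1" and C_fin: "C < \<infinity>" and phi_le: "\<And>x. \<phi> x \<le> C"
    and phi_low: "\<And>K. compact K \<Longrightarrow> K \<subseteq> G \<Longrightarrow> \<exists>c>0. \<forall>x\<in>K. c \<le> \<phi> x"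
begin

definition "\<nu> = density \<mu> \<phi>"
abbreviation "P q \<equiv> tmeas \<nu> q"

lemma sets_nu [measurable_cong]: "sets \<nu> = sets N" by (simp add: \<nu>_def sets_mu)
lemma space_nu [simp]: "space \<nu> = G" by (simp add: \<nu>_def)
lemma space_P [simp]: "space (P q) = T q" by (simp add: space_tmeas)
lemma sets_P [measurable_cong]: "sets (P q) = sets (tmeas N q)" by (rule sets_tmeas_cong[OF sets_nu])
lemma sets_tmu [measurable_cong]: "sets (tmeas \<mu> q) = sets (tmeas N q)" by (rule sets_tmeas_cong[OF sets_mu])
lemma space_tmu [simp]: "space (tmeas \<mu> q) = T q" by (simp add: space_tmeas)
lemma space_tN [simp]: "space (tmeas N q) = T q" by (simp add: space_tmeas)

lemma prob_nu: "prob_space \<nu>"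
proof (rule prob_spaceI)
  have "emeasure \<nu> (space \<nu>) = (\<integral>\<^sup>+x. \<phi> x * indicator G x \<partial>\<mu>)"
    by (simp add: \<nu>_def emeasure_density sets_mu)
  also have "\<dots> = integral\<^sup>N \<mu> \<phi>" by (rule nn_integral_cong) simp
  finally show "emeasure \<nu> (space \<nu>) = 1" by (simp add: phi_int)
qed

sublocale nu: prob_space \<nu> by (rule prob_nu)

lemma prob_P: "prob_space (P q)"
  unfolding tmeas_def by (rule prob_space_PiM) (rule prob_nu)

sublocale PP: product_prob_space "\<lambda>_::nat. \<nu>" "UNIV" by standard
sublocale MM: product_sigma_finite "\<lambda>_::nat. \<mu>"
  by (simp add: product_sigma_finite_def sigma_finite_mu)

lemma phi_pos: "x \<in> G \<Longrightarrow> 0 < \<phi> x"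
  using phi_low[of "{x}"] by auto

text \<open>Power measures are determined by boxes, and on a box the integral of the product density
  factors over the coordinates.\<close>

lemma P_density: "P q = density (tmeas \<mu> q) (\<lambda>x. \<Prod>j<q. \<phi> (x j))"
  unfolding tmeas_def
proof (rule PP.PiM_eqI[symmetric])
  have ms: "(\<lambda>x. \<Prod>j<q. \<phi> (x j)) \<in> borel_measurable (PiM {..<q} (\<lambda>_. \<mu>))" by measurable
  fix A :: "nat \<Rightarrow> 'g set" assume A: "\<And>j. j \<in> {..<q} \<Longrightarrow> A j \<in> sets \<nu>"
  then have A': "j < q \<Longrightarrow> A j \<in> sets \<mu>" for j by (simp add: sets_nu sets_mu)
  have "emeasure (density (PiM {..<q} (\<lambda>_. \<mu>)) (\<lambda>x. \<Prod>j<q. \<phi> (x j))) (PiE {..<q} A)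
    = (\<integral>\<^sup>+x. (\<Prod>j<q. \<phi> (x j)) * indicator (PiE {..<q} A) x \<partial>PiM {..<q} (\<lambda>_. \<mu>))"
    using A' by (subst emeasure_density[OF ms]) (auto intro!: sets_PiM_I_finite)
  also have "\<dots> = (\<integral>\<^sup>+x. (\<Prod>j<q. \<phi> (x j) * indicator (A j) (x j)) \<partial>PiM {..<q} (\<lambda>_. \<mu>))"
  proof (rule nn_integral_cong)
    fix x assume "x \<in> space (PiM {..<q} (\<lambda>_. \<mu>))"
    then have x: "x \<in> extensional {..<q}" by (simp add: space_PiM PiE_def)
    show "(\<Prod>j<q. \<phi> (x j)) * indicator (PiE {..<q} A) x = (\<Prod>j<q. \<phi> (x j) * indicator (A j) (x j))"
    proof (cases "x \<in> PiE {..<q} A")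
      case True then show ?thesis by (auto simp: PiE_iff intro!: prod.cong)
    next
      case False
      then obtain j where "j < q" "x j \<notin> A j" using x by (auto simp: PiE_iff)
      then have "(\<Prod>j<q. \<phi> (x j) * indicator (A j) (x j)) = 0" by (intro prod_zero bexI[of _ j]) auto
      with False show ?thesis by simp
    qed
  qed
  also have "\<dots> = (\<Prod>j<q. \<integral>\<^sup>+y. \<phi> y * indicator (A j) y \<partial>\<mu>)"
    using A' by (subst MM.product_nn_integral_prod) (auto simp: sets_mu)
  also have "\<dots> = (\<Prod>j<q. emeasure \<nu> (A j))"
    unfolding \<nu>_def using A' by (intro prod.cong) (auto simp: emeasure_density sets_mu)
  finally show "emeasure (density (PiM {..<q} (\<lambda>_. \<mu>)) (\<lambda>x. \<Prod>j<q. \<phi> (x j))) (PiE {..<q} A)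
    = (\<Prod>j<q. emeasure \<nu> (A j))" .
qed (auto simp: sets_nu sets_mu intro!: sets_PiM_cong)

lemma prod_phi_meas [measurable]: "(\<lambda>x. \<Prod>j<q. \<phi> (x j)) \<in> borel_measurable (tmeas \<mu> q)"
  unfolding tmeas_def by measurable

text \<open>The density is positive at every tuple, so both measures have the same null sets.
  Through this equivalence the cochains of the statement, which are classes for
  \<open>\<mu>\<close>, are handled with \<open>P\<close>.\<close>

lemma AE_P_iff: "(AE x in P q. R x) \<longleftrightarrow> (AE x in tmeas \<mu> q. R x)"
proof -
  have "(AE x in P q. R x) \<longleftrightarrow> (AE x in tmeas \<mu> q. 0 < (\<Prod>j<q. \<phi> (x j)) \<longrightarrow> R x)"
    unfolding P_density by (rule AE_density) measurable
  also have "\<dots> \<longleftrightarrow> (AE x in tmeas \<mu> q. R x)"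
  proof (rule AE_cong)
    fix x assume "x \<in> space (tmeas \<mu> q)"
    then have "\<phi> (x j) > 0" if "j < q" for j using that by (auto intro!: phi_pos tuples_D)
    then have "(\<Prod>j<q. \<phi> (x j)) \<noteq> 0" by (auto simp: less_le)
    then show "(0 < (\<Prod>j<q. \<phi> (x j)) \<longrightarrow> R x) = R x" by (simp add: zero_less_iff_neq_zero)
  qed
  finally show ?thesis .
qed

lemma m_left_measurable: "g \<in> G \<Longrightarrow> (\<lambda>x. m g x) \<in> measurable N N"
  by (rule m_measurable) auto

lemma sh_left_measurable: "g \<in> G \<Longrightarrow> (\<lambda>y. sh g q y) \<in> measurable (tmeas N q) (tmeas N q)"
  by (rule sh_measurable) auto

text \<open>This bound and its counterpart \<open>mu_le_P\<close> allow a detour through the Haar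
  power, for which left translation is exact, and back to \<open>P\<close> wherever the density is
  bounded below.\<close>

lemma P_le_mu: "E \<in> sets (P q) \<Longrightarrow> emeasure (P q) E \<le> C ^ q * emeasure (tmeas \<mu> q) E"
proof -
  assume E: "E \<in> sets (P q)"
  then have [measurable]: "E \<in> sets (tmeas \<mu> q)" by (simp add: sets_P sets_tmu)
  have "emeasure (P q) E = (\<integral>\<^sup>+x. (\<Prod>j<q. \<phi> (x j)) * indicator E x \<partial>tmeas \<mu> q)"
    unfolding P_density by (subst emeasure_density) auto
  also have "\<dots> \<le> (\<integral>\<^sup>+x. C ^ q * indicator E x \<partial>tmeas \<mu> q)"
  proof (intro nn_integral_mono mult_right_mono)
    fix x
    have "(\<Prod>j<q. \<phi> (x j)) \<le> (\<Prod>j<q. C)" by (rule prod_mono_ennreal) (simp add: phi_le)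
    then show "(\<Prod>j<q. \<phi> (x j)) \<le> C ^ q" by simp
  qed simp
  also have "\<dots> = C ^ q * emeasure (tmeas \<mu> q) E" by (simp add: nn_integral_cmult_indicator)
  finally show ?thesis .
qed

lemma mu_le_P:
  assumes E: "E \<in> sets (P q)" and c: "\<And>x j. x \<in> E \<Longrightarrow> j < q \<Longrightarrow> c \<le> \<phi> (x j)"
  shows "c ^ q * emeasure (tmeas \<mu> q) E \<le> emeasure (P q) E"
proof -
  have [measurable]: "E \<in> sets (tmeas \<mu> q)" using E by (simp add: sets_P sets_tmu)
  have "c ^ q * emeasure (tmeas \<mu> q) E = (\<integral>\<^sup>+x. c ^ q * indicator E x \<partial>tmeas \<mu> q)"
    by (simp add: nn_integral_cmult_indicator)
  also have "\<dots> \<le> (\<integral>\<^sup>+x. (\<Prod>j<q. \<phi> (x j)) * indicator E x \<partial>tmeas \<mu> q)"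
  proof (intro nn_integral_mono)
    fix x
    have "c ^ q \<le> (\<Prod>j<q. \<phi> (x j))" if "x \<in> E"
      using prod_mono_ennreal[of "{..<q}" "\<lambda>_. c" "\<lambda>j. \<phi> (x j)"] c[OF that] by simp
    then show "c ^ q * indicator E x \<le> (\<Prod>j<q. \<phi> (x j)) * indicator E x"
      by (auto simp: indicator_def)
  qed
  also have "\<dots> = emeasure (P q) E" unfolding P_density by (subst emeasure_density) auto
  finally show ?thesis .
qed

text \<open>On boxes the translation acts coordinatewise, and the preimage of \<open>A j\<close>
  under \<open>m g\<close> is its image under \<open>m (i g)\<close>, which is the form in which
  Haar invariance is assumed.\<close>

lemma tmu_left:
  assumes g: "g \<in> G" and E: "E \<in> sets (P q)"
  shows "emeasure (tmeas \<mu> q) {y \<in> T q. sh g q y \<in> E} = emeasure (tmeas \<mu> q) E"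
proof -
  have [measurable]: "(\<lambda>y. sh g q y) \<in> measurable (tmeas \<mu> q) (tmeas \<mu> q)"
    using sh_left_measurable[OF g] by (simp add: measurable_cong_sets[OF sets_tmu sets_tmu])
  have "distr (tmeas \<mu> q) (tmeas \<mu> q) (\<lambda>y. sh g q y) = tmeas \<mu> q"
    unfolding tmeas_def
  proof (rule MM.PiM_eqI)
    fix A :: "nat \<Rightarrow> 'g set" assume A: "\<And>j. j \<in> {..<q} \<Longrightarrow> A j \<in> sets \<mu>"
    have AG: "j < q \<Longrightarrow> A j \<subseteq> G" for j using sets.sets_into_space[OF A[of j]] by simp
    have im: "m (i g) ` A j \<in> sets \<mu>" "emeasure \<mu> (m (i g) ` A j) = emeasure \<mu> (A j)" if "j < q" for j
    proof -
      have "m (i g) ` A j = (\<lambda>x. m g x) -` A j \<inter> space N"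
        using AG[OF that] g by (force simp: image_iff)
      moreover have "(\<lambda>x. m g x) \<in> measurable N N" using g by (rule m_left_measurable)
      ultimately show "m (i g) ` A j \<in> sets \<mu>" using A[of j] that by (auto simp: sets_mu)
    qed (use mu_left A that g in auto)
    have eq: "(\<lambda>y. sh g q y) -` PiE {..<q} A \<inter> space (PiM {..<q} (\<lambda>_. \<mu>)) = PiE {..<q} (\<lambda>j. m (i g) ` A j)"
    proof (intro set_eqI iffI)
      fix y assume "y \<in> (\<lambda>y. sh g q y) -` PiE {..<q} A \<inter> space (PiM {..<q} (\<lambda>_. \<mu>))"
      then have y: "sh g q y \<in> PiE {..<q} A" "y \<in> PiE {..<q} (\<lambda>_. G)" by (auto simp: space_PiM)
      have "y j \<in> m (i g) ` A j" if "j < q" for j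
      proof (rule image_eqI)
        show "m g (y j) \<in> A j" using y(1) that by (auto simp: PiE_iff gshift_def split: if_splits)
        have "y j \<in> G" using y(2) that by auto
        with g show "y j = m (i g) (m g (y j))" by simp
      qed
      then show "y \<in> PiE {..<q} (\<lambda>j. m (i g) ` A j)" using y(2) by (auto simp: PiE_iff)
    next
      fix y assume y: "y \<in> PiE {..<q} (\<lambda>j. m (i g) ` A j)"
      have "y j \<in> G \<and> m g (y j) \<in> A j" if "j < q" for j
      proof -
        obtain z where "z \<in> A j" "y j = m (i g) z" using y \<open>j < q\<close> by (auto simp: PiE_iff)
        then show ?thesis using AG[OF that] g by auto
      qed
      then show "y \<in> (\<lambda>y. sh g q y) -` PiE {..<q} A \<inter> space (PiM {..<q} (\<lambda>_. \<mu>))"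
        using y by (auto simp: space_PiM PiE_iff gshift_def)
    qed
    have "emeasure (distr (PiM {..<q} (\<lambda>_. \<mu>)) (PiM {..<q} (\<lambda>_. \<mu>)) (\<lambda>y. sh g q y)) (PiE {..<q} A)
      = emeasure (PiM {..<q} (\<lambda>_. \<mu>)) (PiE {..<q} (\<lambda>j. m (i g) ` A j))"
      using A by (subst emeasure_distr) (auto simp: eq intro!: sets_PiM_I_finite simp: \<open>(\<lambda>y. sh g q y) \<in> _\<close>[unfolded tmeas_def])
    also have "\<dots> = (\<Prod>j<q. emeasure \<mu> (m (i g) ` A j))"
      using im by (intro MM.emeasure_PiM) auto
    finally show "emeasure (distr (PiM {..<q} (\<lambda>_. \<mu>)) (PiM {..<q} (\<lambda>_. \<mu>)) (\<lambda>y. sh g q y)) (PiE {..<q} A)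
      = (\<Prod>j<q. emeasure \<mu> (A j))" using im by simp
  qed auto
  then have "emeasure (tmeas \<mu> q) E = emeasure (distr (tmeas \<mu> q) (tmeas \<mu> q) (\<lambda>y. sh g q y)) E" by simp
  also have "\<dots> = emeasure (tmeas \<mu> q) {y \<in> T q. sh g q y \<in> E}"
    using E by (subst emeasure_distr) (auto simp: sets_P sets_tmu vimage_def Int_def conj_commute)
  finally show ?thesis ..
qed

end

section \<open>Continuity of translation\<close>

context haar_prob begin

sublocale P: prob_space "P q" for q by (rule prob_P)

lemma sh_left_P [measurable]: "g \<in> G \<Longrightarrow> (\<lambda>y. sh g q y) \<in> measurable (P q) (P q)"
  using sh_left_measurable by (simp add: measurable_cong_sets[OF sets_P sets_P])

lemma sh_sets: "g \<in> G \<Longrightarrow> E \<in> sets (P q) \<Longrightarrow> {y \<in> T q. sh g q y \<in> E} \<in> sets (P q)"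
  using measurable_sets[OF sh_left_P, of g E q] by (simp add: vimage_def Int_def conj_commute)

lemma cyl_sets: "j < q \<Longrightarrow> A \<in> sets \<nu> \<Longrightarrow> {y \<in> T q. y j \<in> A} \<in> sets (P q)"
  and cyl_measure: "j < q \<Longrightarrow> A \<in> sets \<nu> \<Longrightarrow> measure (P q) {y \<in> T q. y j \<in> A} = measure \<nu> A"
proof -
  assume j: "j < q" and A: "A \<in> sets \<nu>"
  have m: "(\<lambda>y. y j) \<in> measurable (P q) \<nu>"
    unfolding tmeas_def using j by (intro measurable_component_singleton) auto
  show "{y \<in> T q. y j \<in> A} \<in> sets (P q)"
    using measurable_sets[OF m A] by (simp add: vimage_def Int_def conj_commute)
  have "distr (P q) \<nu> (\<lambda>y. y j) = \<nu>"
    unfolding tmeas_def using j distr_PiM_component[of "{..<q}" "\<lambda>_. \<nu>" j] prob_nu by auto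
  then have "measure \<nu> A = measure (distr (P q) \<nu> (\<lambda>y. y j)) A" by simp
  also have "\<dots> = measure (P q) {y \<in> T q. y j \<in> A}"
    using A m by (subst measure_distr) (auto simp: vimage_def Int_def conj_commute)
  finally show "measure (P q) {y \<in> T q. y j \<in> A} = measure \<nu> A" ..
qed

text \<open>Finite unions of the exhausting compact sets increase to \<open>G\<close>, so their
  probabilities tend to 1.\<close>

lemma compact_almost_full:
  assumes "(0::real) < eps"
  obtains K where "compact K" "K \<subseteq> G" "measure \<nu> (G - K) \<le> eps"
proof -
  obtain U K where K: "\<And>n::nat. openin (top_of_set G) (U n)" "\<And>n. compact (K n)" "\<And>n. U n \<subseteq> K n"
    "\<And>n. K n \<subseteq> G" "(\<Union>n. U n) = G" by (rule compact_exhaustion) blast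
  have KS: "K n \<in> sets \<nu>" for n using compact_N[OF K(2,4)] by (simp add: sets_nu)
  define L where "L n = (\<Union>k<n. K k)" for n
  have L: "L n \<in> sets \<nu>" "compact (L n)" "L n \<subseteq> G" for n
    unfolding L_def using KS K(2) K(4) by (auto intro!: compact_UN)
  have U: "(\<Union>n. L n) = G"
  proof
    show "(\<Union>n. L n) \<subseteq> G" using L(3) by blast
    show "G \<subseteq> (\<Union>n. L n)"
    proof
      fix x assume "x \<in> G"
      then obtain n where "x \<in> U n" using K(5) by blast
      then have "x \<in> L (Suc n)" using K(3) by (auto simp: L_def)
      then show "x \<in> (\<Union>n. L n)" by blast
    qed
  qed
  have "incseq L" unfolding L_def incseq_def by force
  then have "(\<lambda>n. measure \<nu> (L n)) \<longlonglongrightarrow> measure \<nu> (\<Union>n. L n)"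
    using L by (intro nu.finite_Lim_measure_incseq) auto
  moreover have "measure \<nu> (\<Union>n. L n) = 1" unfolding U using nu.prob_space by simp
  ultimately have "(\<lambda>n. measure \<nu> (L n)) \<longlonglongrightarrow> 1" by simp
  from order_tendstoD(1)[OF this, of "1 - eps"] assms
  obtain n where "measure \<nu> (L n) > 1 - eps" by (auto simp: eventually_sequentially)
  moreover have "measure \<nu> (G - L n) = 1 - measure \<nu> (L n)"
    using nu.prob_compl[OF L(1)] by simp
  ultimately show thesis using L by (intro that[of "L n"]) auto
qed

text \<open>Tuples with a coordinate outside a large compact \<open>K\<close> are negligible. For
  the others the translate has its coordinates in the compact \<open>K'\<close>, where the density
  is at least \<open>r\<close>; passing to the Haar power, translating there and returning costs the
  factor \<open>(C' / r) ^ q\<close>, uniformly for \<open>g\<close> in a relatively compact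
  neighbourhood of \<open>c\<close>.\<close>

lemma translate_abs_cont:
  assumes c: "c \<in> G" and eps: "(0::real) < eps"
  obtains V \<delta> where "openin (top_of_set G) V" "c \<in> V" "(0::real) < \<delta>"
    "\<And>g E. g \<in> V \<Longrightarrow> E \<in> sets (P q) \<Longrightarrow> measure (P q) E < \<delta> \<Longrightarrow>
       measure (P q) {y \<in> T q. sh (i g) q y \<in> E} \<le> eps"
proof -
  \<comment> \<open>Half of \<open>eps\<close> is shared among the \<open>q\<close> coordinates;
    adding 1 keeps the divisor positive for \<open>q = 0\<close>.\<close>
  obtain K where K: "compact K" "K \<subseteq> G" "measure \<nu> (G - K) \<le> eps / (2 * (real q + 1))"
    using compact_almost_full[of "eps / (2 * (real q + 1))"] eps by (auto simp: divide_pos_pos)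
  obtain V L where V: "openin (top_of_set G) V" "compact L" "c \<in> V" "V \<subseteq> L" "L \<subseteq> G"
    using compact_nbhd[OF c] .
  define K' where "K' = (\<lambda>z. m (i (fst z)) (snd z)) ` (L \<times> K)"
  have "continuous_on (L \<times> K) (\<lambda>z. m (i (fst z)) (snd z))"
  proof -
    have 1: "continuous_on (L \<times> K) (\<lambda>z. (i (fst z), snd z))"
      by (intro continuous_intros continuous_on_compose2[OF cont_i]) (use V K in auto)
    show ?thesis
      using continuous_on_compose2[OF cont_m 1] V K by (auto simp: subset_eq)
  qed
  then have K'c: "compact K'" unfolding K'_def by (intro compact_continuous_image compact_Times V K)
  have K'G: "K' \<subseteq> G" unfolding K'_def using V K by (auto simp: subset_eq)
  obtain c0 where c0: "c0 > 0" "\<And>x. x \<in> K' \<Longrightarrow> c0 \<le> \<phi> x" using phi_low[OF K'c K'G] by auto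
  \<comment> \<open>The lower bound \<open>c0\<close> is an extended real and may be infinite; a
    positive real number below it is needed for division.\<close>
  obtain r where r: "0 < r" "ennreal r \<le> c0"
  proof (cases c0)
    case (real r) with c0(1) show thesis by (intro that[of r]) auto
  next
    case top then show thesis by (intro that[of 1]) auto
  qed
  define C' where "C' = enn2real C + 1"
  have C': "C' > 0" "C \<le> ennreal C'"
    using C_fin unfolding C'_def by (auto simp: add_nonneg_pos less_top ennreal_plus)
  define \<delta> where "\<delta> = eps / 2 * r ^ q / C' ^ q"
  have d: "0 < \<delta>" unfolding \<delta>_def using eps r C' by simp
  have KS: "K \<in> sets \<nu>" "G - K \<in> sets \<nu>" "K' \<in> sets \<nu>"
    using compact_N[OF K(1,2)] compact_N[OF K'c K'G] sets.compl_sets[of K \<nu>] by (auto simp: sets_nu)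
  show thesis
  proof (rule that[OF V(1,3) d])
    fix g E assume g: "g \<in> V" and E: "E \<in> sets (P q)" and Ed: "measure (P q) E < \<delta>"
    have gG: "g \<in> G" "g \<in> L" using g V by auto
    have ET: "E \<subseteq> T q" using sets.sets_into_space[OF E] by simp
    define Y where "Y = {y \<in> T q. sh (i g) q y \<in> E}"
    have Y: "Y \<in> sets (P q)" unfolding Y_def using gG E by (intro sh_sets) auto
    define B where "B = (\<Union>j<q. {y \<in> T q. y j \<in> G - K})"
    have Bj: "{y \<in> T q. y j \<in> G - K} \<in> sets (P q)" if "j < q" for j using that KS by (intro cyl_sets)
    then have B: "B \<in> sets (P q)" unfolding B_def by (intro sets.finite_UN) auto
    have "measure (P q) B \<le> (\<Sum>j<q. measure (P q) {y \<in> T q. y j \<in> G - K})"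
      unfolding B_def using Bj by (intro measure_UNION_le) auto
    also have "\<dots> = real q * measure \<nu> (G - K)" using KS(2) by (simp add: cyl_measure del: Diff_iff)
    also have "\<dots> \<le> real q * (eps / (2 * (real q + 1)))" using K(3) by (intro mult_left_mono) auto
    also have "\<dots> \<le> eps / 2" using eps by (simp add: field_simps)
    finally have mB: "measure (P q) B \<le> eps / 2" .
    define E' where "E' = E \<inter> (\<Inter>j<q. {y \<in> T q. y j \<in> K'})"
    have E'S: "E' \<in> sets (P q)"
    proof (cases "q = 0")
      case False
      then show ?thesis unfolding E'_def using E KS by (intro sets.Int sets.finite_INT cyl_sets) auto
    qed (use E in \<open>simp add: E'_def\<close>)
    have E'K: "x \<in> E' \<Longrightarrow> j < q \<Longrightarrow> ennreal r \<le> \<phi> (x j)" for x j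
      using r(2) c0(2) order_trans unfolding E'_def by blast
    have mP: "ennreal r ^ q * emeasure (tmeas \<mu> q) E' \<le> emeasure (P q) E'"
      by (rule mu_le_P[OF E'S]) (rule E'K)
    define Y' where "Y' = {y \<in> T q. sh (i g) q y \<in> E'}"
    have Y'S: "Y' \<in> sets (P q)" unfolding Y'_def using gG E'S by (intro sh_sets) auto
    have sub: "Y \<subseteq> B \<union> Y'"
    proof
      fix y assume y: "y \<in> Y"
      show "y \<in> B \<union> Y'"
      proof (cases "\<forall>j<q. y j \<in> K")
        case True
        have "sh (i g) q y j \<in> K'" if "j < q" for j
          unfolding K'_def using True that gG by (auto simp: gshift_def intro!: image_eqI[of _ _ "(g, y j)"])
        moreover have "sh (i g) q y \<in> T q" using y ET by (auto simp: Y_def)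
        ultimately show ?thesis using y by (auto simp: Y_def Y'_def E'_def)
      next
        case False
        then obtain j where j: "j < q" "y j \<notin> K" by auto
        moreover have "y \<in> T q" using y by (simp add: Y_def)
        ultimately show ?thesis using tuples_D[of y q j] by (auto simp: B_def)
      qed
    qed
    have "emeasure (P q) Y' \<le> C ^ q * emeasure (tmeas \<mu> q) Y'" by (rule P_le_mu[OF Y'S])
    also have "emeasure (tmeas \<mu> q) Y' = emeasure (tmeas \<mu> q) E'"
      unfolding Y'_def using gG E'S by (intro tmu_left) auto
    also have "C ^ q * emeasure (tmeas \<mu> q) E' \<le> ennreal C' ^ q * emeasure (tmeas \<mu> q) E'"
      using C'(2) by (intro mult_right_mono power_mono) auto
    also have "ennreal C' ^ q = ennreal (C' ^ q / r ^ q) * ennreal r ^ q"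
      using r(1) C'(1) by (simp add: ennreal_power ennreal_mult[symmetric] del: ennreal_mult)
    also have "ennreal (C' ^ q / r ^ q) * ennreal r ^ q * emeasure (tmeas \<mu> q) E'
        \<le> ennreal (C' ^ q / r ^ q) * emeasure (P q) E'"
      unfolding mult.assoc using mP by (intro mult_left_mono) auto
    also have "\<dots> \<le> ennreal (C' ^ q / r ^ q) * ennreal \<delta>"
    proof (intro mult_left_mono)
      have "measure (P q) E' \<le> measure (P q) E"
        using E by (intro P.finite_measure_mono) (auto simp: E'_def)
      then show "emeasure (P q) E' \<le> ennreal \<delta>"
        using Ed by (simp add: P.emeasure_eq_measure ennreal_leI)
    qed simp
    also have "\<dots> = ennreal (C' ^ q / r ^ q * \<delta>)" using d r C' by (intro ennreal_mult[symmetric]) auto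
    also have "C' ^ q / r ^ q * \<delta> = eps / 2" unfolding \<delta>_def using r(1) C'(1) by simp
    finally have "measure (P q) Y' \<le> eps / 2"
      using eps by (simp add: P.emeasure_eq_measure)
    moreover have "measure (P q) Y \<le> measure (P q) B + measure (P q) Y'"
      using sub B Y'S by (intro order_trans[OF P.finite_measure_mono measure_Un_le]) auto
    ultimately show "measure (P q) {y \<in> T q. sh (i g) q y \<in> E} \<le> eps" using mB unfolding Y_def by simp
  qed
qed

text \<open>Uniform absolute continuity at the point \<open>i g\<close>, used with every
  \<open>eps\<close>; the inverse in its statement turns \<open>i g\<close> back into
  \<open>g\<close>.\<close>

lemma AE_sh:
  assumes g: "g \<in> G" and ae: "AE y in P q. R y"
  shows "AE y in P q. R (sh g q y)"
proof -
  obtain E where E: "{y \<in> space (P q). \<not> R y} \<subseteq> E" "emeasure (P q) E = 0" "E \<in> sets (P q)"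
    using AE_E[OF ae] .
  have ig: "i g \<in> G" using g by simp
  have le: "measure (P q) {y \<in> T q. sh g q y \<in> E} \<le> eps" if e0: "0 < eps" for eps
  proof -
    obtain V \<delta> where "i g \<in> V" "(0::real) < \<delta>"
      "\<And>g E. g \<in> V \<Longrightarrow> E \<in> sets (P q) \<Longrightarrow> measure (P q) E < \<delta> \<Longrightarrow>
       measure (P q) {y \<in> T q. sh (i g) q y \<in> E} \<le> eps"
      by (rule translate_abs_cont[OF ig e0, of q]) blast
    from this(3)[OF this(1) E(3)] this(2) E(2) g show ?thesis by (simp add: measure_def)
  qed
  have "measure (P q) {y \<in> T q. sh g q y \<in> E} \<le> 0"
  proof (rule field_le_epsilon)
    fix eps :: real assume "0 < eps"
    from le[OF this] show "measure (P q) {y \<in> T q. sh g q y \<in> E} \<le> 0 + eps" by simp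
  qed
  then have "measure (P q) {y \<in> T q. sh g q y \<in> E} = 0"
    using measure_nonneg[of "P q"] by (simp add: order_antisym)
  then show ?thesis
    using E(1) g sh_sets[OF g E(3)]
    by (intro AE_I[of _ _ "{y \<in> T q. sh g q y \<in> E}"]) (auto simp: P.emeasure_eq_measure)
qed

text \<open>Every point leaves the sequence eventually, so the tail unions decrease to the empty
  set.\<close>

lemma (in prob_space) measure_tendsto_0:
  assumes A: "\<And>n. A n \<in> events" and ev: "\<And>x. x \<in> space M \<Longrightarrow> eventually (\<lambda>n. x \<notin> A n) sequentially"
  shows "(\<lambda>n. prob (A n)) \<longlonglongrightarrow> 0"
proof -
  define B where "B n = (\<Union>k\<in>{n..}. A k)" for n
  have BS: "B n \<in> events" for n unfolding B_def using A by (intro sets.countable_UN) auto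
  have "(\<Inter>n. B n) = {}"
  proof (rule ccontr)
    assume "(\<Inter>n. B n) \<noteq> {}"
    then obtain x where x: "\<And>n. x \<in> B n" by auto
    then have "x \<in> space M" using sets.sets_into_space[OF BS[of 0]] by auto
    from ev[OF this] obtain n where "\<And>k. n \<le> k \<Longrightarrow> x \<notin> A k" by (auto simp: eventually_sequentially)
    with x[of n] show False by (auto simp: B_def)
  qed
  moreover have "decseq B" unfolding decseq_def B_def by (intro allI impI UN_mono) auto
  then have "(\<lambda>n. prob (B n)) \<longlonglongrightarrow> prob (\<Inter>n. B n)"
    using BS by (intro finite_Lim_measure_decseq) auto
  ultimately have "(\<lambda>n. prob (B n)) \<longlonglongrightarrow> 0" by simp
  then show ?thesis
  proof (rule tendsto_sandwich[OF _ _ tendsto_const, rotated 2])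
    show "eventually (\<lambda>n. prob (A n) \<le> prob (B n)) sequentially"
      using BS by (intro always_eventually allI finite_measure_mono) (auto simp: B_def)
  qed auto
qed

text \<open>The sets with continuous translates form a sigma-algebra that contains the cylinders over
  open sets.\<close>

definition translate_cont :: "nat \<Rightarrow> (nat \<Rightarrow> 'g) set \<Rightarrow> bool" where
  "translate_cont q E \<longleftrightarrow> E \<in> sets (P q) \<and> (\<forall>c\<in>G. \<forall>eps>0. \<exists>V. openin (top_of_set G) V \<and> c \<in> V \<and>
     (\<forall>g\<in>V. measure (P q) {y \<in> T q. (sh (i g) q y \<in> E) \<noteq> (sh (i c) q y \<in> E)} \<le> eps))"

lemma symdiff_sets:
  assumes "g \<in> G" "c \<in> G" "E \<in> sets (P q)"
  shows "{y \<in> T q. (sh (i g) q y \<in> E) \<noteq> (sh (i c) q y \<in> E)} \<in> sets (P q)"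
proof -
  let ?A = "{y \<in> T q. sh (i g) q y \<in> E}" and ?B = "{y \<in> T q. sh (i c) q y \<in> E}"
  have "?A \<in> sets (P q)" "?B \<in> sets (P q)" using assms by (auto intro: sh_sets)
  then have "(?A - ?B) \<union> (?B - ?A) \<in> sets (P q)" by auto
  also have "(?A - ?B) \<union> (?B - ?A) = {y \<in> T q. (sh (i g) q y \<in> E) \<noteq> (sh (i c) q y \<in> E)}" by auto
  finally show ?thesis .
qed

lemma translate_cont_empty: "translate_cont q {}"
  unfolding translate_cont_def by (auto intro!: exI[of _ G])

lemma translate_cont_compl: "translate_cont q E \<Longrightarrow> translate_cont q (T q - E)"
proof -
  assume E: "translate_cont q E"
  have "{y \<in> T q. (sh (i g) q y \<in> T q - E) \<noteq> (sh (i c) q y \<in> T q - E)}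
      = {y \<in> T q. (sh (i g) q y \<in> E) \<noteq> (sh (i c) q y \<in> E)}" if "g \<in> G" "c \<in> G" for g c
    using that by auto
  then have eq: "{y \<in> T q. (sh (i g) q y \<in> T q - E) \<noteq> (sh (i c) q y \<in> T q - E)}
      = {y \<in> T q. (sh (i g) q y \<in> E) \<noteq> (sh (i c) q y \<in> E)}" if "g \<in> G" "c \<in> G" for g c
    using that by blast
  show "translate_cont q (T q - E)"
    unfolding translate_cont_def
  proof (intro conjI ballI allI impI)
    show "T q - E \<in> sets (P q)" using E sets.compl_sets[of E "P q"] by (simp add: translate_cont_def)
    fix c and eps :: real assume c: "c \<in> G" and eps: "0 < eps"
    obtain V where V: "openin (top_of_set G) V" "c \<in> V"
      "\<forall>g\<in>V. measure (P q) {y \<in> T q. (sh (i g) q y \<in> E) \<noteq> (sh (i c) q y \<in> E)} \<le> eps"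
      using E c eps unfolding translate_cont_def by blast
    have "V \<subseteq> G" using openin_imp_subset[OF V(1)] .
    then have "\<forall>g\<in>V. measure (P q) {y \<in> T q. (sh (i g) q y \<in> T q - E) \<noteq> (sh (i c) q y \<in> T q - E)} \<le> eps"
    proof (intro ballI)
      fix g assume g: "g \<in> V"
      with \<open>V \<subseteq> G\<close> have "g \<in> G" by auto
      show "measure (P q) {y \<in> T q. (sh (i g) q y \<in> T q - E) \<noteq> (sh (i c) q y \<in> T q - E)} \<le> eps"
        unfolding eq[OF \<open>g \<in> G\<close> c] using V(3) g by blast
    qed
    with V show "\<exists>V. openin (top_of_set G) V \<and> c \<in> V \<and>
      (\<forall>g\<in>V. measure (P q) {y \<in> T q. (sh (i g) q y \<in> T q - E) \<noteq> (sh (i c) q y \<in> T q - E)} \<le> eps)"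
      by blast
  qed
qed

text \<open>The union is cut off at \<open>M\<close>. The remainder has measure below the
  \<open>\<delta>\<close> of uniform absolute continuity, so its translates stay small near
  \<open>c\<close>, and the finitely many sets below \<open>M\<close> are continuous by assumption.
  The thirds of \<open>eps\<close> go to the finite part and to the two translates of the
  remainder.\<close>

lemma translate_cont_UN:
  fixes E :: "nat \<Rightarrow> (nat \<Rightarrow> 'g) set"
  assumes E: "\<And>n. translate_cont q (E n)"
  shows "translate_cont q (\<Union>n. E n)"
  unfolding translate_cont_def
proof (intro conjI ballI allI impI)
  have ES: "E n \<in> sets (P q)" for n using E by (simp add: translate_cont_def)
  then show US: "(\<Union>n. E n) \<in> sets (P q)" by auto
  fix c and eps :: real assume c: "c \<in> G" and eps: "0 < eps"
  have e3: "0 < eps / 3" using eps by simp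
  obtain V0 \<delta> where V0: "openin (top_of_set G) V0" "c \<in> V0" "(0::real) < \<delta>"
    "\<And>g E. g \<in> V0 \<Longrightarrow> E \<in> sets (P q) \<Longrightarrow> measure (P q) E < \<delta> \<Longrightarrow>
       measure (P q) {y \<in> T q. sh (i g) q y \<in> E} \<le> eps / 3"
    by (rule translate_abs_cont[OF c e3, of q]) blast
  define R where "R M = (\<Union>n. E n) - (\<Union>n<M. E n)" for M :: nat
  have RS: "R M \<in> sets (P q)" for M unfolding R_def using ES by auto
  have "(\<lambda>M. measure (P q) (R M)) \<longlonglongrightarrow> 0"
  proof (rule P.measure_tendsto_0[OF RS])
    fix x
    show "eventually (\<lambda>M. x \<notin> R M) sequentially"
    proof (cases "x \<in> (\<Union>n. E n)")
      case True
      then obtain n where "x \<in> E n" by auto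
      then have "x \<notin> R M" if "M \<ge> Suc n" for M using that by (auto simp: R_def)
      then show ?thesis by (auto simp: eventually_sequentially)
    qed (auto simp: R_def)
  qed
  from order_tendstoD(2)[OF this V0(3)] obtain M where M: "measure (P q) (R M) < \<delta>"
    by (auto simp: eventually_sequentially)
  have "\<forall>n. \<exists>V. openin (top_of_set G) V \<and> c \<in> V \<and>
     (\<forall>g\<in>V. measure (P q) {y \<in> T q. (sh (i g) q y \<in> E n) \<noteq> (sh (i c) q y \<in> E n)} \<le> eps / (3 * (real M + 1)))"
    using E c eps unfolding translate_cont_def by simp
  from choice[OF this] obtain V where V': "\<forall>n. openin (top_of_set G) (V n) \<and> c \<in> V n \<and>
     (\<forall>g\<in>V n. measure (P q) {y \<in> T q. (sh (i g) q y \<in> E n) \<noteq> (sh (i c) q y \<in> E n)} \<le> eps / (3 * (real M + 1)))" ..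
  then have V: "\<And>n. openin (top_of_set G) (V n)" "\<And>n. c \<in> V n"
     "\<And>n g. g \<in> V n \<Longrightarrow> measure (P q) {y \<in> T q. (sh (i g) q y \<in> E n) \<noteq> (sh (i c) q y \<in> E n)} \<le> eps / (3 * (real M + 1))"
    by blast+
  define W where "W = V0 \<inter> (G \<inter> (\<Inter>n\<in>{..<M}. V n))"
  have "openin (top_of_set G) (G \<inter> (\<Inter>n\<in>{..<M}. V n))"
    using V(1) by (induction M) (auto simp: lessThan_Suc Int_left_commute[of G] intro: openin_Int)
  then have W: "openin (top_of_set G) W" "c \<in> W" unfolding W_def using V0 V c by auto
  have "measure (P q) {y \<in> T q. (sh (i g) q y \<in> (\<Union>n. E n)) \<noteq> (sh (i c) q y \<in> (\<Union>n. E n))} \<le> eps"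
    if g: "g \<in> W" for g
  proof -
    have gG: "g \<in> G" using g by (auto simp: W_def)
    let ?D = "\<lambda>n. {y \<in> T q. (sh (i g) q y \<in> E n) \<noteq> (sh (i c) q y \<in> E n)}"
    let ?R = "\<lambda>g. {y \<in> T q. sh (i g) q y \<in> R M}"
    have S: "?D n \<in> sets (P q)" "?R g \<in> sets (P q)" "?R c \<in> sets (P q)" for n
      by (rule symdiff_sets[OF gG c ES], (rule sh_sets, use gG c RS in auto)+)
    have "measure (P q) {y \<in> T q. (sh (i g) q y \<in> (\<Union>n. E n)) \<noteq> (sh (i c) q y \<in> (\<Union>n. E n))}
        \<le> measure (P q) ((\<Union>n<M. ?D n) \<union> (?R g \<union> ?R c))"
      using S by (intro P.finite_measure_mono sets.Un sets.finite_UN) (auto simp: R_def)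
    also have "\<dots> \<le> measure (P q) (\<Union>n<M. ?D n) + (measure (P q) (?R g) + measure (P q) (?R c))"
      using S by (intro order_trans[OF measure_Un_le add_mono] measure_Un_le order_refl sets.finite_UN sets.Un) auto
    also have "measure (P q) (\<Union>n<M. ?D n) \<le> (\<Sum>n<M. measure (P q) (?D n))"
      using S by (intro measure_UNION_le) auto
    also have "\<dots> \<le> (\<Sum>n<M. eps / (3 * (real M + 1)))"
      using g by (intro sum_mono V(3)) (auto simp: W_def)
    also have "\<dots> \<le> eps / 3" using eps by (simp add: field_simps)
    also have "measure (P q) (?R g) \<le> eps / 3" using g by (intro V0(4) RS M) (auto simp: W_def)
    also have "measure (P q) (?R c) \<le> eps / 3" using V0(2) by (intro V0(4) RS M)
    finally show ?thesis by simp
  qed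
  with W show "\<exists>V. openin (top_of_set G) V \<and> c \<in> V \<and>
     (\<forall>g\<in>V. measure (P q) {y \<in> T q. (sh (i g) q y \<in> (\<Union>n. E n)) \<noteq> (sh (i c) q y \<in> (\<Union>n. E n))} \<le> eps)"
    by blast
qed

text \<open>A point of the translate by \<open>c\<close> eventually stays in the translates by
  \<open>g n\<close>, since \<open>U\<close> is open. The opposite inclusion has no such pointwise
  argument, because boundary points may keep entering. Written in the coordinates moved by
  \<open>g n\<close>, however, the entering points are a translate of a set \<open>Z n\<close> whose
  measure tends to 0, again by openness, and uniform absolute continuity finishes.\<close>

lemma translate_cont_cylinder_open:
  assumes j: "j < q" and U: "open U"
  shows "translate_cont q {y \<in> T q. y j \<in> G \<inter> U}"
  unfolding translate_cont_def
proof (intro conjI ballI allI impI)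
  let ?E = "{y \<in> T q. y j \<in> G \<inter> U}"
  have GU: "openin (top_of_set G) (G \<inter> U)" using U by (simp add: openin_open_Int)
  then have US: "G \<inter> U \<in> sets \<nu>" by (simp add: sets_nu open_N)
  show ES: "?E \<in> sets (P q)" by (rule cyl_sets[OF j US])
  fix c and eps :: real assume c: "c \<in> G" and eps: "0 < eps"
  \<comment> \<open>A countable neighbourhood base reduces continuity at \<open>c\<close> to
    sequences.\<close>
  obtain A :: "nat \<Rightarrow> 'g set" where A: "\<And>n. open (A n)" "\<And>n. c \<in> A n"
    "\<And>S. open S \<Longrightarrow> c \<in> S \<Longrightarrow> eventually (\<lambda>n. A n \<subseteq> S) sequentially"
    by (rule countable_basis_at_decseq) blast
  let ?D = "\<lambda>g. {y \<in> T q. (sh (i g) q y \<in> ?E) \<noteq> (sh (i c) q y \<in> ?E)}"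
  have opA: "openin (top_of_set G) (G \<inter> A n)" for n using A(1) by (simp add: openin_open_Int)
  show "\<exists>V. openin (top_of_set G) V \<and> c \<in> V \<and> (\<forall>g\<in>V. measure (P q) (?D g) \<le> eps)"
  proof (rule ccontr)
    assume neg: "\<not> ?thesis"
    have "\<exists>g. g \<in> G \<inter> A n \<and> eps < measure (P q) (?D g)" for n
      using neg opA[of n] A(2)[of n] c by (meson IntI not_le)
    then have "\<forall>n. \<exists>g. g \<in> G \<inter> A n \<and> eps < measure (P q) (?D g)" by blast
    from choice[OF this] obtain g where g': "\<forall>n. g n \<in> G \<inter> A n \<and> eps < measure (P q) (?D (g n))" ..
    then have gG: "g n \<in> G" and gA: "g n \<in> A n" and big: "eps < measure (P q) (?D (g n))" for n by blast+
    have glim: "eventually (\<lambda>n. g n \<in> V) sequentially" if V: "openin (top_of_set G) V" "c \<in> V" for V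
    proof -
      obtain S where S: "open S" "V = G \<inter> S" using V(1) by (auto simp: openin_open)
      have "eventually (\<lambda>n. A n \<subseteq> S) sequentially" using A(3)[OF S(1)] V(2) S(2) by auto
      then show ?thesis by eventually_elim (use gG gA S in auto)
    qed
    have conv: "eventually (\<lambda>n. h (g n) \<in> U) sequentially"
      if h: "continuous_on G h" "h c \<in> U" for h :: "'g \<Rightarrow> 'g"
    proof -
      have "openin (top_of_set G) (G \<inter> h -` U)" using h(1) U by (rule continuous_openin_preimage_gen)
      from glim[OF this] h(2) c show ?thesis by (auto elim: eventually_mono)
    qed
    have ci: "continuous_on G (\<lambda>u. m (i u) x)" if "x \<in> G" for x
    proof -
      have 1: "continuous_on G (\<lambda>u. (i u, x))" by (intro continuous_intros cont_i)
      show ?thesis using continuous_on_compose2[OF cont_m 1] that by (auto simp: subset_eq)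
    qed
    have cm: "continuous_on G (\<lambda>u. m (i c) (m u x))" if "x \<in> G" for x
    proof -
      have 1: "continuous_on G (\<lambda>u. (u, x))" by (intro continuous_intros)
      have 2: "continuous_on G (\<lambda>u. m u x)"
        using continuous_on_compose2[OF cont_m 1] that by (auto simp: subset_eq)
      have 3: "continuous_on G (\<lambda>u. (i c, m u x))" by (intro continuous_intros 2)
      show ?thesis using continuous_on_compose2[OF cont_m 3] that c by (auto simp: subset_eq)
    qed
    define X where "X n = {y \<in> T q. sh (i c) q y \<in> ?E} - {y \<in> T q. sh (i (g n)) q y \<in> ?E}" for n
    \<comment> \<open>If \<open>sh (i (g n)) q y\<close> lies in \<open>?E\<close> but
      \<open>sh (i c) q y\<close> does not, then the former lies in \<open>Z n\<close>, since
      \<open>m (i c) (g n)\<close> carries it to the latter.\<close>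
    define Z where "Z n = ?E - {y \<in> T q. sh (m (i c) (g n)) q y \<in> ?E}" for n
    have XS: "X n \<in> sets (P q)" for n unfolding X_def using c gG ES by (intro sets.Diff sh_sets) auto
    have ZS: "Z n \<in> sets (P q)" for n unfolding Z_def using c gG ES by (intro sets.Diff sh_sets) auto
    have "(\<lambda>n. measure (P q) (X n)) \<longlonglongrightarrow> 0"
    proof (rule P.measure_tendsto_0[OF XS])
      fix y assume "y \<in> space (P q)"
      then have y: "y \<in> T q" "y j \<in> G" using j by (auto intro: tuples_D)
      show "eventually (\<lambda>n. y \<notin> X n) sequentially"
      proof (cases "m (i c) (y j) \<in> U")
        case True
        from conv[OF ci[OF y(2)] this] show ?thesis
          by eventually_elim (use y gG j sh_in[OF i_in[OF gG] y(1)] in \<open>auto simp: X_def gshift_def\<close>)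
      qed (use j y c in \<open>auto simp: X_def gshift_def\<close>)
    qed
    from order_tendstoD(2)[OF this, of "eps / 2"] eps
    have evX: "eventually (\<lambda>n. measure (P q) (X n) < eps / 2) sequentially" by simp
    have Zlim: "(\<lambda>n. measure (P q) (Z n)) \<longlonglongrightarrow> 0"
    proof (rule P.measure_tendsto_0[OF ZS])
      fix y assume "y \<in> space (P q)"
      then have y: "y \<in> T q" "y j \<in> G" using j by (auto intro: tuples_D)
      show "eventually (\<lambda>n. y \<notin> Z n) sequentially"
      proof (cases "y j \<in> U")
        case True
        then have "m (i c) (m c (y j)) \<in> U" using c y by simp
        from conv[OF cm[OF y(2)] this] show ?thesis
          by eventually_elim (use y gG j c sh_in[OF m_in[OF i_in[OF c] gG] y(1)] in \<open>auto simp: Z_def gshift_def m_assoc\<close>)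
      qed (auto simp: Z_def)
    qed
    have e2: "0 < eps / 2" using eps by simp
    obtain V \<delta> where V: "openin (top_of_set G) V" "c \<in> V" "(0::real) < \<delta>"
      "\<And>g E. g \<in> V \<Longrightarrow> E \<in> sets (P q) \<Longrightarrow> measure (P q) E < \<delta> \<Longrightarrow>
         measure (P q) {y \<in> T q. sh (i g) q y \<in> E} \<le> eps / 2"
      by (rule translate_abs_cont[OF c e2, of q]) blast
    have "eventually (\<lambda>n. g n \<in> V \<and> measure (P q) (Z n) < \<delta> \<and> measure (P q) (X n) < eps / 2) sequentially"
      using glim[OF V(1,2)] order_tendstoD(2)[OF Zlim V(3)] evX by eventually_elim blast
    then obtain n where n: "g n \<in> V" "measure (P q) (Z n) < \<delta>" "measure (P q) (X n) < eps / 2"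
      by (auto simp: eventually_sequentially)
    have "?D (g n) \<subseteq> X n \<union> {y \<in> T q. sh (i (g n)) q y \<in> Z n}"
    proof
      fix y assume y: "y \<in> ?D (g n)"
      have "sh (m (i c) (g n)) q (sh (i (g n)) q y) = sh (i c) q y"
        using y gG[of n] c by (simp add: sh_sh)
      then show "y \<in> X n \<union> {y \<in> T q. sh (i (g n)) q y \<in> Z n}"
        using y gG[of n] c unfolding X_def Z_def by auto
    qed
    then have "measure (P q) (?D (g n)) \<le> measure (P q) (X n) + measure (P q) {y \<in> T q. sh (i (g n)) q y \<in> Z n}"
      using XS[of n] sh_sets[OF i_in[OF gG[of n]] ZS[of n]]
      by (intro order_trans[OF P.finite_measure_mono measure_Un_le]) auto
    also have "measure (P q) {y \<in> T q. sh (i (g n)) q y \<in> Z n} \<le> eps / 2"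
      using n by (intro V(4) ZS)
    finally show False using n(3) big[of n] by linarith
  qed
qed

lemma translate_cont_cylinder:
  assumes j: "j < q" and A: "A \<in> sets \<nu>"
  shows "translate_cont q {y \<in> T q. y j \<in> A}"
proof -
  obtain B where B: "B \<in> sets borel" "A = G \<inter> B" using A by (auto simp: sets_nu sets_restrict_space)
  have "B \<in> sigma_sets UNIV {S. open S}" using B(1) by (simp add: borel_def)
  then have "translate_cont q {y \<in> T q. y j \<in> G \<inter> B}"
  proof induction
    case (Basic S) then show ?case using translate_cont_cylinder_open[OF j] by simp
  next
    case Empty then show ?case using translate_cont_empty by simp
  next
    case (Compl S)
    have "{y \<in> T q. y j \<in> G \<inter> (UNIV - S)} = T q - {y \<in> T q. y j \<in> G \<inter> S}"
      using j by (auto intro: tuples_D)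
    then show ?case using translate_cont_compl[OF Compl.IH] by simp
  next
    case (Union S)
    have "{y \<in> T q. y j \<in> G \<inter> (\<Union>n. S n)} = (\<Union>n. {y \<in> T q. y j \<in> G \<inter> S n})" by auto
    then show ?case using translate_cont_UN[OF Union.IH] by simp
  qed
  then show ?thesis by (simp add: B)
qed

lemma translate_cont_all: "E \<in> sets (P q) \<Longrightarrow> translate_cont q E"
proof -
  assume E: "E \<in> sets (P q)"
  have sp: "T q = PiE {..<q} (\<lambda>_. space \<nu>)" by (simp add: tuples_def)
  have "E \<in> sigma_sets (T q) {{f \<in> T q. f j \<in> A} | j A. j \<in> {..<q} \<and> A \<in> sets \<nu>}"
    using E unfolding tmeas_def sets_PiM_single sp by simp
  then show "translate_cont q E"
  proof induction
    case (Basic S) then show ?case using translate_cont_cylinder by auto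
  next
    case Empty then show ?case by (rule translate_cont_empty)
  next
    case (Compl S) then show ?case by (intro translate_cont_compl)
  next
    case (Union S) then show ?case by (intro translate_cont_UN)
  qed
qed

text \<open>Up to a set that stays small under translation, \<open>t\<close> takes values in a
  finite set. The finitely many level sets move continuously in measure, and the action on each of
  these values is locally constant near \<open>c\<close>.\<close>

lemma translate_continuous:
  fixes t :: "(nat \<Rightarrow> 'g) \<Rightarrow> 'a"
  assumes t: "t \<in> measurable (P q) (count_space UNIV)" and c: "c \<in> G" and eps: "(0::real) < eps"
  obtains V where "openin (top_of_set G) V" "c \<in> V"
    "\<And>g. g \<in> V \<Longrightarrow> measure (P q) {y \<in> T q. act g (t (sh (i g) q y)) \<noteq> act c (t (sh (i c) q y))} \<le> eps"
proof -
  have e2: "0 < eps / 2" using eps by simp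
  obtain V0 \<delta> where V0: "openin (top_of_set G) V0" "c \<in> V0" "(0::real) < \<delta>"
    "\<And>g E. g \<in> V0 \<Longrightarrow> E \<in> sets (P q) \<Longrightarrow> measure (P q) E < \<delta> \<Longrightarrow>
       measure (P q) {y \<in> T q. sh (i g) q y \<in> E} \<le> eps / 2"
    by (rule translate_abs_cont[OF c e2, of q]) blast
  \<comment> \<open>An enumeration of the countable module serves to cut off all but finitely many
    values.\<close>
  define R where "R M = {y \<in> T q. M \<le> to_nat (t y)}" for M
  define E where "E a = {y \<in> T q. t y = a}" for a
  have tv: "{y \<in> T q. t y \<in> S} \<in> sets (P q)" for S
    using measurable_sets[OF t, of S] by (simp add: vimage_def Int_def conj_commute)
  have RS: "R M \<in> sets (P q)" for M
    unfolding R_def using tv[of "{a. M \<le> to_nat a}"] by simp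
  have ES: "E a \<in> sets (P q)" for a unfolding E_def using tv[of "{a}"] by simp
  have "(\<lambda>M. measure (P q) (R M)) \<longlonglongrightarrow> 0"
  proof (rule P.measure_tendsto_0[OF RS])
    fix x
    show "eventually (\<lambda>M. x \<notin> R M) sequentially"
      unfolding R_def eventually_sequentially by (intro exI[of _ "Suc (to_nat (t x))"]) auto
  qed
  from order_tendstoD(2)[OF this V0(3)] obtain M where M: "measure (P q) (R M) < \<delta>"
    by (auto simp: eventually_sequentially)
  define F where "F = {a::'a. to_nat a < M}"
  have F: "finite F" unfolding F_def
    by (rule finite_subset[OF _ finite_imageI[of "{..<M}" from_nat]]) (auto intro!: image_eqI[of _ _ "to_nat _"])
  have "\<forall>a. \<exists>V. openin (top_of_set G) V \<and> c \<in> V \<and>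
     (\<forall>g\<in>V. measure (P q) {y \<in> T q. (sh (i g) q y \<in> E a) \<noteq> (sh (i c) q y \<in> E a)} \<le> eps / (2 * (real (card F) + 1)))"
    using translate_cont_all[OF ES] c eps unfolding translate_cont_def by simp
  from choice[OF this] obtain V where V': "\<forall>a. openin (top_of_set G) (V a) \<and> c \<in> V a \<and>
     (\<forall>g\<in>V a. measure (P q) {y \<in> T q. (sh (i g) q y \<in> E a) \<noteq> (sh (i c) q y \<in> E a)} \<le> eps / (2 * (real (card F) + 1)))" ..
  then have V: "\<And>a. openin (top_of_set G) (V a)" "\<And>a. c \<in> V a"
     "\<And>a g. g \<in> V a \<Longrightarrow> measure (P q) {y \<in> T q. (sh (i g) q y \<in> E a) \<noteq> (sh (i c) q y \<in> E a)} \<le> eps / (2 * (real (card F) + 1))"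
    by blast+
  define W where "W = V0 \<inter> (G \<inter> (\<Inter>a\<in>F. V a \<inter> {g \<in> G. act g a = act c a}))"
  have "openin (top_of_set G) (G \<inter> (\<Inter>a\<in>F. V a \<inter> {g \<in> G. act g a = act c a}))"
    using F V(1) by (induction F) (auto simp: Int_left_commute[of G] intro!: openin_Int act_open)
  then have W: "openin (top_of_set G) W" "c \<in> W" unfolding W_def using V0 V c by auto
  show thesis
  proof (rule that[OF W])
    fix g assume g: "g \<in> W"
    have gG: "g \<in> G" using g by (auto simp: W_def)
    let ?D = "\<lambda>a. {y \<in> T q. (sh (i g) q y \<in> E a) \<noteq> (sh (i c) q y \<in> E a)}"
    let ?R = "{y \<in> T q. sh (i g) q y \<in> R M}"
    have S: "?D a \<in> sets (P q)" "?R \<in> sets (P q)" for a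
      by (rule symdiff_sets[OF gG c ES], rule sh_sets[OF i_in[OF gG] RS])
    have SU: "(\<Union>a\<in>F. ?D a) \<in> sets (P q)" using S F by (intro sets.finite_UN) auto
    have "{y \<in> T q. act g (t (sh (i g) q y)) \<noteq> act c (t (sh (i c) q y))} \<subseteq> (\<Union>a\<in>F. ?D a) \<union> ?R"
    proof
      fix y assume "y \<in> {y \<in> T q. act g (t (sh (i g) q y)) \<noteq> act c (t (sh (i c) q y))}"
      then have y: "y \<in> T q" "act g (t (sh (i g) q y)) \<noteq> act c (t (sh (i c) q y))" by auto
      have yT: "sh (i g) q y \<in> T q" "sh (i c) q y \<in> T q" using y gG c by auto
      show "y \<in> (\<Union>a\<in>F. ?D a) \<union> ?R"
      proof (cases "t (sh (i g) q y) \<in> F")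
        case True
        then have "act g (t (sh (i g) q y)) = act c (t (sh (i g) q y))" using g by (auto simp: W_def)
        then have "t (sh (i g) q y) \<noteq> t (sh (i c) q y)" using y(2) by auto
        then have "y \<in> ?D (t (sh (i g) q y))" using y yT by (simp add: E_def)
        then show ?thesis using True by blast
      next
        case False
        then show ?thesis using y yT by (auto simp: F_def R_def)
      qed
    qed
    then have "measure (P q) {y \<in> T q. act g (t (sh (i g) q y)) \<noteq> act c (t (sh (i c) q y))}
        \<le> measure (P q) (\<Union>a\<in>F. ?D a) + measure (P q) ?R"
      using SU S(2) by (intro order_trans[OF P.finite_measure_mono measure_Un_le] sets.Un)
    also have "measure (P q) (\<Union>a\<in>F. ?D a) \<le> (\<Sum>a\<in>F. measure (P q) (?D a))"
      using S F by (intro measure_UNION_le) auto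
    also have "\<dots> \<le> (\<Sum>a\<in>F. eps / (2 * (real (card F) + 1)))"
      using g by (intro sum_mono V(3)) (auto simp: W_def)
    also have "\<dots> \<le> eps / 2" using eps by (simp add: field_simps)
    also have "measure (P q) ?R \<le> eps / 2" using g by (intro V0(4) RS M) (auto simp: W_def)
    finally show "measure (P q) {y \<in> T q. act g (t (sh (i g) q y)) \<noteq> act c (t (sh (i c) q y))} \<le> eps"
      by simp
  qed
qed

end

section \<open>Tame families of cochains\<close>

locale haar_base = haar_prob G m i e \<mu> act \<phi> C
  for G :: "'g::{t2_space,second_countable_topology} set" and m i e \<mu>
    and act :: "'g \<Rightarrow> 'a::{ab_group_add,countable} \<Rightarrow> 'a" and \<phi> C +
  fixes BB :: "'g set set"
  assumes BB_countable: "countable BB" and BB_open: "\<And>B. B \<in> BB \<Longrightarrow> openin (top_of_set G) B"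
    and BB_base: "\<And>U x. openin (top_of_set G) U \<Longrightarrow> x \<in> U \<Longrightarrow> \<exists>B\<in>BB. x \<in> B \<and> B \<subseteq> U"
begin

text \<open>Membership of the quotients of two coordinates in basic open sets: the diagonal action does
  not change the outcome of such a test.\<close>

definition sat :: "(nat \<Rightarrow> 'g) \<Rightarrow> nat \<times> nat \<times> 'g set \<Rightarrow> bool" where
  "sat x t = (case t of (b, c, B) \<Rightarrow> m (i (x b)) (x c) \<in> B)"

definition tests :: "nat \<Rightarrow> (nat \<times> nat \<times> 'g set) set" where
  "tests a = {..<a} \<times> {..<a} \<times> BB"

lemma countable_tests: "countable (tests a)"
  unfolding tests_def using BB_countable by (intro countable_SIGMA) auto

lemma continuous_quotient:
  assumes "b < a" "c < a"
  shows "continuous_on (T a) (\<lambda>x. m (i (x b)) (x c))"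
proof -
  have co: "continuous_on (T a) (\<lambda>x. x k)" for k
    by (rule continuous_on_subset[OF continuous_on_product_coordinates]) simp
  have 1: "continuous_on (T a) (\<lambda>x. (i (x b), x c))"
    by (intro continuous_intros continuous_on_compose2[OF cont_i] co)
       (use assms in \<open>auto intro: tuples_D\<close>)
  have 2: "(\<lambda>x. (i (x b), x c)) ` T a \<subseteq> G \<times> G" using assms by (auto intro: tuples_D)
  show ?thesis using continuous_on_compose2[OF cont_m 1 2] by simp
qed

text \<open>Only the positive outcome is an open condition. Neighbourhoods are therefore described
  by tests that hold, while other tests only compare outcomes.\<close>

lemma sat_open:
  assumes t: "t \<in> tests a" and x: "x0 \<in> T a" and s: "sat x0 t"
  shows "\<exists>U. open U \<and> x0 \<in> U \<and> (\<forall>x\<in>T a \<inter> U. sat x t)"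
proof -
  obtain b c B where t': "t = (b, c, B)" "b < a" "c < a" "B \<in> BB" using t by (auto simp: tests_def)
  obtain V where V: "open V" "B = G \<inter> V" using BB_open[OF t'(4)] by (auto simp: openin_open)
  have "openin (top_of_set (T a)) (T a \<inter> (\<lambda>x. m (i (x b)) (x c)) -` V)"
    using continuous_quotient[OF t'(2,3)] V(1) by (rule continuous_openin_preimage_gen)
  then obtain U where U: "open U" "T a \<inter> (\<lambda>x. m (i (x b)) (x c)) -` V = T a \<inter> U"
    by (auto simp: openin_open)
  have "x0 \<in> U" using U(2) x s V(2) by (auto simp: sat_def t')
  moreover have "sat x t" if "x \<in> T a \<inter> U" for x
  proof -
    have "m (i (x b)) (x c) \<in> V" using that U(2) by auto
    moreover have "m (i (x b)) (x c) \<in> G" using that t' by (auto intro: tuples_D)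
    ultimately show ?thesis using V(2) by (simp add: sat_def t')
  qed
  ultimately show ?thesis using U(1) by blast
qed

lemma sat_open_finite:
  assumes "finite Q" "Q \<subseteq> tests a" "x0 \<in> T a" "\<forall>t\<in>Q. sat x0 t"
  shows "\<exists>U. open U \<and> x0 \<in> U \<and> (\<forall>x\<in>T a \<inter> U. \<forall>t\<in>Q. sat x t)"
  using assms
proof (induction Q rule: finite_induct)
  case empty then show ?case by (intro exI[of _ UNIV]) auto
next
  case (insert t Q)
  then obtain U where U: "open U" "x0 \<in> U" "\<forall>x\<in>T a \<inter> U. \<forall>t\<in>Q. sat x t" by auto
  obtain U' where U': "open U'" "x0 \<in> U'" "\<forall>x\<in>T a \<inter> U'. sat x t"
    using sat_open[of t a x0] insert by auto
  show ?case by (rule exI[of _ "U \<inter> U'"]) (use U U' in auto)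
qed

lemma sat_sh:
  assumes "t \<in> tests a" "x \<in> T a" "g \<in> G"
  shows "sat (sh g a x) t = sat x t"
proof -
  obtain b c B where t: "t = (b, c, B)" "b < a" "c < a" using assms by (auto simp: tests_def)
  have "x b \<in> G" "x c \<in> G" using assms t by (auto intro: tuples_D)
  then show ?thesis using assms(3) t by (simp add: sat_def gshift_def i_m m_assoc)
qed

lemma sat_measurable:
  assumes "t \<in> tests a"
  shows "(\<lambda>x. sat x t) \<in> measurable (tmeas N a) (count_space UNIV)"
proof -
  obtain b c B where t: "t = (b, c, B)" "b < a" "c < a" "B \<in> BB" using assms by (auto simp: tests_def)
  have co: "(\<lambda>x. x k) \<in> measurable (tmeas N a) N" if "k < a" for k
    unfolding tmeas_def using that by (intro measurable_component_singleton) auto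
  have "(\<lambda>x. m (i (x b)) (x c)) \<in> measurable (tmeas N a) N"
    by (intro m_measurable measurable_compose[OF co i_measurable] co t)
  from measurable_sets[OF this open_N[OF BB_open[OF t(4)]]]
  have "{x \<in> space (tmeas N a). sat x t} \<in> sets (tmeas N a)"
    by (simp add: t(1) sat_def vimage_def Int_def conj_commute)
  then show ?thesis by (simp add: pred_def)
qed

lemma pattern_measurable:
  fixes h :: "(nat \<times> nat \<times> 'g set) set \<Rightarrow> nat"
  assumes "finite F" "F \<subseteq> tests a"
  shows "(\<lambda>x. h {t \<in> F. sat x t}) \<in> measurable (tmeas N a) (count_space UNIV)"
proof -
  \<comment> \<open>Quantified over \<open>h\<close>, because the pattern on
    \<open>insert s F\<close> is the pattern on \<open>F\<close>, fed to \<open>h\<close> directly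
    or after inserting \<open>s\<close>.\<close>
  have "\<forall>h :: (nat \<times> nat \<times> 'g set) set \<Rightarrow> nat.
      (\<lambda>x. h {t \<in> F. sat x t}) \<in> measurable (tmeas N a) (count_space UNIV)"
    using assms
  proof (induction F rule: finite_induct)
    case empty show ?case by simp
  next
    case (insert s F)
    show ?case
    proof
      fix h :: "(nat \<times> nat \<times> 'g set) set \<Rightarrow> nat"
      have sm: "Measurable.pred (tmeas N a) (\<lambda>x. sat x s)" using insert.prems by (intro sat_measurable) auto
      have IH: "(\<lambda>x. h' {t \<in> F. sat x t}) \<in> measurable (tmeas N a) (count_space UNIV)"
        for h' :: "(nat \<times> nat \<times> 'g set) set \<Rightarrow> nat" using insert.IH insert.prems by blast
      have "(\<lambda>x. if sat x s then h (insert s {t \<in> F. sat x t}) else h {t \<in> F. sat x t})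
          \<in> measurable (tmeas N a) (count_space UNIV)"
        by (rule measurable_If[OF IH[of "\<lambda>X. h (insert s X)"] IH[of h] sm[unfolded pred_def]])
      also have "(\<lambda>x. if sat x s then h (insert s {t \<in> F. sat x t}) else h {t \<in> F. sat x t})
         = (\<lambda>x. h {t \<in> insert s F. sat x t})"
        by (rule ext, auto intro!: arg_cong[of _ _ h])
      finally show "(\<lambda>x. h {t \<in> insert s F. sat x t}) \<in> measurable (tmeas N a) (count_space UNIV)" .
    qed
  qed
  then show ?thesis by blast
qed

text \<open>A family of cochains in \<open>y\<close>, indexed by \<open>x\<close>, is tame if locally in \<open>x\<close> finitely many tests
  determine it up to a set of small measure.  No variables \<open>x\<close>: every cochain is tame.  No
  variables \<open>y\<close>: finitely many tests determine the value, as the empty tuple has measure 1.\<close>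

definition tame :: "nat \<Rightarrow> nat \<Rightarrow> ((nat \<Rightarrow> 'g) \<Rightarrow> (nat \<Rightarrow> 'g) \<Rightarrow> 'a) \<Rightarrow> bool" where
  "tame a k S \<longleftrightarrow> (\<forall>x0\<in>T a. \<forall>eps>0. \<exists>U F. open U \<and> x0 \<in> U \<and> finite F \<and> F \<subseteq> tests a \<and>
     (\<forall>x\<in>T a \<inter> U. \<forall>x'\<in>T a \<inter> U. (\<forall>t\<in>F. sat x t = sat x' t) \<longrightarrow>
        measure (P k) {y \<in> T k. S x y \<noteq> S x' y} \<le> eps))"

lemma tameE:
  assumes "tame a k S" "x0 \<in> T a" "0 < eps"
  obtains U F where "open U" "x0 \<in> U" "finite F" "F \<subseteq> tests a"
    "\<forall>x\<in>T a \<inter> U. \<forall>x'\<in>T a \<inter> U. (\<forall>t\<in>F. sat x t = sat x' t) \<longrightarrow>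
        measure (P k) {y \<in> T k. S x y \<noteq> S x' y} \<le> eps"
  using assms(1)[unfolded tame_def, THEN bspec, OF assms(2), THEN spec, THEN mp, OF assms(3)]
  by (elim exE conjE) (rule that)

text \<open>On \<open>X\<close> the map \<open>h\<close> factors through the finitely many subsets
  of \<open>F\<close> that occur as patterns of outcomes.\<close>

lemma finite_image_patterns:
  fixes R :: "'x \<Rightarrow> 't \<Rightarrow> bool"
  assumes F: "finite F"
    and h: "\<And>x x'. x \<in> X \<Longrightarrow> x' \<in> X \<Longrightarrow> \<forall>t\<in>F. R x t = R x' t \<Longrightarrow> h x = h x'"
  shows "finite (h ` X)"
proof (rule finite_subset)
  define pat where "pat x = {t \<in> F. R x t}" for x
  show "h ` X \<subseteq> (\<lambda>D. h (SOME x. x \<in> X \<and> pat x = D)) ` Pow F"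
  proof
    fix v assume "v \<in> h ` X"
    then obtain x where x: "x \<in> X" "v = h x" by auto
    let ?z = "SOME z. z \<in> X \<and> pat z = pat x"
    have z: "?z \<in> X \<and> pat ?z = pat x"
      by (rule someI[of "\<lambda>z. z \<in> X \<and> pat z = pat x" x]) (use x in auto)
    then have "\<forall>t\<in>F. R x t = R ?z t" unfolding pat_def by blast
    then have "v = h ?z" using h[of x ?z] x z by simp
    moreover have "pat x \<in> Pow F" by (auto simp: pat_def)
    ultimately show "v \<in> (\<lambda>D. h (SOME x. x \<in> X \<and> pat x = D)) ` Pow F" by blast
  qed
qed (use F in simp)

text \<open>When the first entry is \<open>e\<close>, the quotient of the entries 0 and
  \<open>b\<close> is the entry \<open>b\<close> itself, so tests can express membership in a box.
  Without normalisation tests see a tuple only up to the diagonal action.\<close>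

lemma basic_box:
  assumes a: "0 < a" and x0: "x0 \<in> T a" "x0 0 = e" and U: "open U" "x0 \<in> U"
  shows "\<exists>Q. finite Q \<and> Q \<subseteq> tests a \<and> (\<forall>t\<in>Q. sat x0 t) \<and>
    (\<forall>x\<in>T a. x 0 = e \<and> (\<forall>t\<in>Q. sat x t) \<longrightarrow> x \<in> U)"
proof -
  have "openin (product_topology (\<lambda>i. euclidean) UNIV) U" 
    by (subst euclidean_product_topology) (rule open_openin[THEN iffD1, OF U(1)])
  from product_topology_open_contains_basis[OF this U(2)]
  obtain X where X: "x0 \<in> PiE UNIV X" "\<And>i. open (X i)" "PiE UNIV X \<subseteq> U" by auto
  have "\<forall>b. \<exists>B. b < a \<longrightarrow> B \<in> BB \<and> x0 b \<in> B \<and> B \<subseteq> X b"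
  proof
    fix b
    have "\<exists>B\<in>BB. x0 b \<in> B \<and> B \<subseteq> G \<inter> X b" if "b < a"
      using X x0 that by (intro BB_base) (auto simp: openin_open_Int intro: tuples_D)
    then show "\<exists>B. b < a \<longrightarrow> B \<in> BB \<and> x0 b \<in> B \<and> B \<subseteq> X b" by blast
  qed
  from choice[OF this] obtain B where B: "\<And>b. b < a \<Longrightarrow> B b \<in> BB \<and> x0 b \<in> B b \<and> B b \<subseteq> X b" by blast
  show ?thesis
  proof (intro exI[of _ "(\<lambda>b. (0::nat, b, B b)) ` {..<a}"] conjI ballI impI)
    fix x assume x: "x \<in> T a" and h: "x 0 = e \<and> (\<forall>t\<in>(\<lambda>b. (0::nat, b, B b)) ` {..<a}. sat x t)"
    have "x b \<in> X b" for b
    proof (cases "b < a")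
      case True
      then have "sat x (0::nat, b, B b)" and "x 0 = e" using h by blast+
      then have "x b \<in> B b" using tuples_D[OF x True] by (simp add: sat_def)
      then show ?thesis using B[OF True] by auto
    next
      case False
      then have "x b = x0 b" using x x0(1) by (auto simp: tuples_def PiE_def extensional_def)
      then show ?thesis using X(1) by auto
    qed
    then show "x \<in> U" using X(3) by auto
  next
    fix t assume "t \<in> (\<lambda>b. (0::nat, b, B b)) ` {..<a}"
    then obtain b where b: "b < a" "t = (0, b, B b)" by auto
    have "i (x0 0) = e" using x0(2) by simp
    then show "sat x0 t" using b tuples_D[OF x0(1) b(1)] B[OF b(1)] by (simp add: sat_def)
  next
    show "finite ((\<lambda>b. (0::nat, b, B b)) ` {..<a})" by simp
    show "(\<lambda>b. (0::nat, b, B b)) ` {..<a} \<subseteq> tests a"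
      unfolding tests_def using a B by blast
  qed
qed

text \<open>Countably many neighbourhoods given by tests suffice; the code of \<open>x\<close> is the first of them that
  contains \<open>x\<close>, together with the outcome of the tests that belong to it.\<close>

lemma cell_codes:
  assumes a: "0 < a" and Z: "tame a k Z"
  obtains code :: "nat \<Rightarrow> (nat \<Rightarrow> 'g) \<Rightarrow> nat"
  where "\<And>n. code n \<in> measurable (tmeas N a) (count_space UNIV)"
    "\<And>n g x. g \<in> G \<Longrightarrow> x \<in> T a \<Longrightarrow> code n (sh g a x) = code n x"
    "\<And>n x x'. x \<in> T a \<Longrightarrow> x' \<in> T a \<Longrightarrow> x 0 = e \<Longrightarrow> x' 0 = e \<Longrightarrow> code n x = code n x' \<Longrightarrow>
       measure (P k) {y \<in> T k. Z x y \<noteq> Z x' y} \<le> (1/2) ^ n"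
    "\<And>n x0. x0 \<in> T a \<Longrightarrow> \<exists>U F. open U \<and> x0 \<in> U \<and> finite F \<and> F \<subseteq> tests a \<and>
       (\<forall>x\<in>T a \<inter> U. \<forall>x'\<in>T a \<inter> U. (\<forall>t\<in>F. sat x t = sat x' t) \<longrightarrow> code n x = code n x')"
proof -
  define FT where "FT = {A. finite A \<and> A \<subseteq> tests a}"
  have FTc: "countable FT" unfolding FT_def by (rule countable_Collect_finite_subset[OF countable_tests])
  \<comment> \<open>The first component of \<open>p\<close> cuts out a neighbourhood by tests that
    must hold; the second lists the tests whose outcomes determine \<open>Z\<close> there up to
    \<open>(1/2) ^ n\<close>.\<close>
  define tol where "tol n p \<longleftrightarrow>
    (\<forall>x\<in>T a. \<forall>x'\<in>T a. x 0 = e \<and> x' 0 = e \<and> (\<forall>t\<in>fst p. sat x t) \<and> (\<forall>t\<in>fst p. sat x' t) \<and>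
       (\<forall>t\<in>snd p. sat x t = sat x' t) \<longrightarrow> measure (P k) {y \<in> T k. Z x y \<noteq> Z x' y} \<le> (1/2) ^ n)"
    for n :: nat and p
  define good where "good n = {p \<in> FT \<times> FT. tol n p}" for n :: nat
  have "countable (FT \<times> FT)" using FTc by (intro countable_SIGMA)
  then have gc: "countable (good n)" for n unfolding good_def by (rule countable_subset[rotated]) blast
  have cov0: "\<exists>p\<in>good n. \<forall>t\<in>fst p. sat x t" if x: "x \<in> T a" "x 0 = e" for x n
  proof -
    have h0: "(0::real) < (1/2) ^ n" by simp
    obtain U F where U: "open U" "x \<in> U" "finite F" "F \<subseteq> tests a"
      "\<forall>z\<in>T a \<inter> U. \<forall>z'\<in>T a \<inter> U. (\<forall>t\<in>F. sat z t = sat z' t) \<longrightarrow>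
        measure (P k) {y \<in> T k. Z z y \<noteq> Z z' y} \<le> (1/2) ^ n"
      using tameE[OF Z x(1) h0] .
    obtain Q where Q: "finite Q" "Q \<subseteq> tests a" "\<forall>t\<in>Q. sat x t"
      "\<forall>z\<in>T a. z 0 = e \<and> (\<forall>t\<in>Q. sat z t) \<longrightarrow> z \<in> U"
      using basic_box[OF a x U(1,2)] by blast
    have "tol n (Q, F)" unfolding tol_def fst_conv snd_conv using U(5) Q(4) by blast
    then have "(Q, F) \<in> good n" unfolding good_def FT_def using Q(1,2) U(3,4) by blast
    then show ?thesis using Q(3) by (intro bexI[of _ "(Q, F)"]) auto
  qed
  \<comment> \<open>Moving \<open>x\<close> to first entry \<open>e\<close> does not change the
    outcome of any test, so covering the normalised tuples is enough.\<close>
  have cov: "\<exists>p\<in>good n. \<forall>t\<in>fst p. sat x t" if x: "x \<in> T a" for x n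
  proof -
    have x0: "x 0 \<in> G" using x a by (rule tuples_D)
    have "sh (i (x 0)) a x \<in> T a" using x x0 by simp
    moreover have "sh (i (x 0)) a x 0 = e" using x0 a by (simp add: gshift_def)
    ultimately have "\<exists>p\<in>good n. \<forall>t\<in>fst p. sat (sh (i (x 0)) a x) t" by (rule cov0)
    then obtain p where p: "p \<in> good n" "\<forall>t\<in>fst p. sat (sh (i (x 0)) a x) t" by auto
    have "fst p \<subseteq> tests a" using p(1) by (auto simp: good_def FT_def)
    then have "\<forall>t\<in>fst p. sat x t" using p(2) sat_sh[OF _ x i_in[OF x0]] by blast
    with p(1) show ?thesis by blast
  qed
  have "restrict (\<lambda>_. e) {..<a} \<in> T a" by (rule restrict_in_tuples) simp
  then have gne: "good n \<noteq> {}" for n using cov by blast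
  define en where "en n j = from_nat_into (good n) j" for n j
  have eng: "en n j \<in> good n" for n j unfolding en_def using from_nat_into[OF gne] .
  have enF: "finite (fst (en n j))" "fst (en n j) \<subseteq> tests a" "finite (snd (en n j))" "snd (en n j) \<subseteq> tests a" for n j
    using eng[of n j] by (auto simp: good_def FT_def)
  have ex: "\<exists>j. \<forall>t\<in>fst (en n j). sat x t" if "x \<in> T a" for n x
    using cov[OF that, of n] from_nat_into_surj[OF gc[of n]] unfolding en_def by metis
  define jn where "jn n x = (LEAST j. \<forall>t\<in>fst (en n j). sat x t)" for n x
  have jn: "\<forall>t\<in>fst (en n (jn n x)). sat x t" if "x \<in> T a" for n x
    unfolding jn_def by (rule LeastI_ex[OF ex[OF that]])
  define pat where "pat n x = {t \<in> snd (en n (jn n x)). sat x t}" for n x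
  define code where "code n x = prod_encode (jn n x, to_nat_on FT (pat n x))" for n x
  have patFT: "pat n x \<in> FT" for n x
    unfolding pat_def FT_def using enF(3,4)[of n "jn n x"] by auto
  have code_eq: "jn n x = jn n x' \<and> pat n x = pat n x'" if "code n x = code n x'" for n x x'
    using that inj_on_to_nat_on[OF FTc] patFT by (auto simp: code_def inj_on_eq_iff)
  show thesis
  proof (rule that[of code])
    fix n
    have "Measurable.pred (tmeas N a) (\<lambda>x. \<forall>t\<in>fst (en n j). sat x t)" for j
      using enF(1,2)[of n j] by (intro pred_intros_finite) (auto intro!: sat_measurable)
    then have jm: "jn n \<in> measurable (tmeas N a) (count_space UNIV)"
      unfolding jn_def by (intro measurable_Least)
    have "(\<lambda>x. prod_encode (j, to_nat_on FT {t \<in> snd (en n j). sat x t})) \<in> measurable (tmeas N a) (count_space UNIV)" for j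
      using enF(3,4)[of n j] by (rule pattern_measurable)
    from measurable_compose_countable[OF this jm]
    show "code n \<in> measurable (tmeas N a) (count_space UNIV)"
      unfolding code_def pat_def by simp
  next
    fix n g x assume g: "g \<in> G" and x: "x \<in> T a"
    have "(\<forall>t\<in>fst (en n j). sat (sh g a x) t) = (\<forall>t\<in>fst (en n j). sat x t)" for j
      by (rule ball_cong[OF refl]) (rule sat_sh[OF subsetD[OF enF(2)] x g])
    then have j: "jn n (sh g a x) = jn n x" unfolding jn_def by simp
    have "pat n (sh g a x) = pat n x"
      unfolding pat_def j by (intro Collect_cong conj_cong refl) (rule sat_sh[OF subsetD[OF enF(4)] x g])
    with j show "code n (sh g a x) = code n x" by (simp add: code_def)
  next
    fix n x x' assume x: "x \<in> T a" "x' \<in> T a" "x 0 = e" "x' 0 = e" and eq: "code n x = code n x'"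
    have j: "jn n x = jn n x'" and p: "pat n x = pat n x'" using code_eq[OF eq] by auto
    have "sat x t = sat x' t" if "t \<in> snd (en n (jn n x))" for t
    proof -
      have "sat x t \<longleftrightarrow> t \<in> pat n x" "sat x' t \<longleftrightarrow> t \<in> pat n x'" using that j by (auto simp: pat_def)
      then show ?thesis using p by simp
    qed
    then have "\<forall>t\<in>snd (en n (jn n x)). sat x t = sat x' t" by blast
    moreover have "tol n (en n (jn n x))" using eng by (simp add: good_def)
    moreover have "\<forall>t\<in>fst (en n (jn n x)). sat x' t" using jn[OF x(2), of n] j by simp
    ultimately show "measure (P k) {y \<in> T k. Z x y \<noteq> Z x' y} \<le> (1/2) ^ n"
      using x jn[OF x(1), of n] unfolding tol_def by blast
  next
    fix n x0 assume x0: "x0 \<in> T a"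
    obtain U where U: "open U" "x0 \<in> U" "\<forall>x\<in>T a \<inter> U. \<forall>t\<in>fst (en n (jn n x0)). sat x t"
      using sat_open_finite[OF enF(1,2) x0 jn[OF x0]] by blast
    \<comment> \<open>Near \<open>x0\<close> the covering tests of the index \<open>jn n x0\<close>
      hold, so no larger index occurs. The covering tests of the indices up to it decide which index
      is least, and the second components then decide the pattern.\<close>
    define F where "F = (\<Union>j\<in>{..jn n x0}. fst (en n j) \<union> snd (en n j))"
    show "\<exists>U F. open U \<and> x0 \<in> U \<and> finite F \<and> F \<subseteq> tests a \<and>
       (\<forall>x\<in>T a \<inter> U. \<forall>x'\<in>T a \<inter> U. (\<forall>t\<in>F. sat x t = sat x' t) \<longrightarrow> code n x = code n x')"
    proof (intro exI[of _ U] exI[of _ F] conjI ballI impI)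
      show "finite F" unfolding F_def using enF(1,3) by auto
      show "F \<subseteq> tests a" unfolding F_def by (intro UN_least Un_least enF)
      fix x x' assume x: "x \<in> T a \<inter> U" "x' \<in> T a \<inter> U" and F: "\<forall>t\<in>F. sat x t = sat x' t"
      have le: "jn n z \<le> jn n x0" if "z \<in> T a \<inter> U" for z
        unfolding jn_def[of n z] by (rule Least_le) (use U(3) that in auto)
      have iff: "(\<forall>t\<in>fst (en n j). sat x t) = (\<forall>t\<in>fst (en n j). sat x' t)" if "j \<le> jn n x0" for j
        using F that by (auto simp: F_def)
      have "jn n x' \<le> jn n x"
        unfolding jn_def[of n x'] by (rule Least_le) (use iff[OF le[OF x(1)]] jn[of x n] x in auto)
      moreover have "jn n x \<le> jn n x'"
        unfolding jn_def[of n x] by (rule Least_le) (use iff[OF le[OF x(2)]] jn[of x' n] x in auto)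
      ultimately have j: "jn n x = jn n x'" by simp
      have "pat n x = pat n x'" unfolding pat_def j[symmetric] using F le[OF x(1)] by (auto simp: F_def)
      with j show "code n x = code n x'" by (simp add: code_def)
    qed (use U in auto)
  qed
qed

end

section \<open>Primitives of cocycles\<close>

lemma cobdry_sum:
  fixes U :: "'n \<Rightarrow> (nat \<Rightarrow> 'g) \<Rightarrow> 'a::ab_group_add"
  shows "cobdry k (\<lambda>z. \<Sum>n\<in>I. U n z) y = (\<Sum>n\<in>I. cobdry k (U n) y)"
  unfolding cobdry_def by (subst sum.swap) (auto intro!: sum.cong simp: sum_negf)

lemma cobdry_diff:
  fixes S S' :: "(nat \<Rightarrow> 'g) \<Rightarrow> 'a::ab_group_add"
  shows "cobdry k (\<lambda>z. S z - S' z) y = cobdry k S y - cobdry k S' y"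
  unfolding cobdry_def by (auto simp: sum_subtractf[symmetric] intro!: sum.cong)

lemma cobdry_minus:
  fixes S :: "(nat \<Rightarrow> 'g) \<Rightarrow> 'a::ab_group_add"
  shows "cobdry k (\<lambda>z. - S z) y = - cobdry k S y"
  unfolding cobdry_def by (auto simp: sum_negf[symmetric] intro!: sum.cong)

lemma cobdry_cong:
  assumes "\<And>j. j \<le> k \<Longrightarrow> S (face k j y) = S' (face k j y)"
  shows "cobdry k S y = cobdry k S' y"
  unfolding cobdry_def using assms by (intro sum.cong) auto

text \<open>Equal to 0 on the sequences that do not vanish eventually.\<close>

definition fsum :: "(nat \<Rightarrow> 'a::ab_group_add) \<Rightarrow> 'a" where
  "fsum v = (if \<exists>M. \<forall>n\<ge>M. v n = 0 then sum v {..<LEAST M. \<forall>n\<ge>M. v n = 0} else 0)"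

lemma fsum_eq:
  assumes "\<forall>n\<ge>M. v n = 0"
  shows "fsum v = sum v {..<M}"
proof -
  define K where "K = (LEAST M. \<forall>n\<ge>M. v n = 0)"
  have L: "\<forall>n\<ge>K. v n = 0" unfolding K_def by (rule LeastI[of "\<lambda>M. \<forall>n\<ge>M. v n = 0", OF assms])
  have "K \<le> M" unfolding K_def by (rule Least_le) (rule assms)
  then have "sum v {..<M} = sum v {..<K}"
    using L by (intro sum.mono_neutral_right) auto
  moreover have "\<exists>M. \<forall>n\<ge>M. v n = 0" using assms by blast
  ultimately show ?thesis unfolding fsum_def K_def by simp
qed

lemma (in haar_module) fsum_measurable:
  fixes v :: "nat \<Rightarrow> 'x \<Rightarrow> 'b::{countable,ab_group_add}"
  assumes v: "\<And>n. v n \<in> measurable M (count_space UNIV)"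
  shows "(\<lambda>x. fsum (\<lambda>n. v n x)) \<in> measurable M (count_space UNIV)"
proof -
  have p0: "Measurable.pred M (\<lambda>x. v n x = 0)" for n
    using measurable_compose[OF v[of n], of "\<lambda>a. a = 0" "count_space UNIV"] by simp
  have p: "Measurable.pred M (\<lambda>x. \<forall>n\<ge>K. v n x = 0)" for K
    by (intro pred_intros_countable pred_intros_logic p0) simp
  have pe: "Measurable.pred M (\<lambda>x. \<exists>K. \<forall>n\<ge>K. v n x = 0)"
    by (intro pred_intros_countable p)
  have L: "(\<lambda>x. LEAST K. \<forall>n\<ge>K. v n x = 0) \<in> measurable M (count_space UNIV)"
    by (rule measurable_Least) (rule p)
  have s: "(\<lambda>x. \<Sum>n<K. v n x) \<in> measurable M (count_space UNIV)" for K
    by (rule sum_count_measurable) (rule v)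
  have "(\<lambda>x. \<Sum>n<(LEAST K. \<forall>n\<ge>K. v n x = 0). v n x) \<in> measurable M (count_space UNIV)"
    by (rule measurable_compose_countable[OF s L])
  from measurable_If[OF this _ pe[unfolded pred_def], of "\<lambda>_. 0"]
  show ?thesis unfolding fsum_def by simp
qed

section \<open>Fubini in the last variable and the cone\<close>

context haar_prob begin

text \<open>An injective selection of coordinates carries one power measure to the other. This
  serves for faces, for reordering coordinates and for picking a pair of them.\<close>

lemma AE_reindex:
  assumes f: "inj_on f {..<k}" "\<And>n. n < k \<Longrightarrow> f n < k'" and ae: "AE y in P k. R y"
  shows "AE y in P k'. R (restrict (\<lambda>n. y (f n)) {..<k})"
proof -
  have d: "distr (P k') (P k) (\<lambda>y. restrict (\<lambda>n. y (f n)) {..<k}) = P k"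
    unfolding tmeas_def using f by (intro distr_PiM_reindex[of "{..<k'}" "\<lambda>_. \<nu>" f "{..<k}"] prob_nu) auto
  have m: "(\<lambda>y. restrict (\<lambda>n. y (f n)) {..<k}) \<in> measurable (P k') (P k)"
    unfolding tmeas_def using f(2) by (intro measurable_restrict measurable_component_singleton) auto
  show ?thesis by (rule AE_distrD[OF m]) (simp only: d ae)
qed

lemma AE_face:
  assumes "AE y in P k. R y"
  shows "AE y in P (Suc k). R (face k j y)"
proof -
  have eq: "face k j y = restrict (\<lambda>n. y (if n < j then n else Suc n)) {..<k}" for y :: "nat \<Rightarrow> 'g"
    unfolding face_def by (rule restrict_ext) simp
  show ?thesis unfolding eq by (rule AE_reindex[OF _ _ assms]) (auto simp: inj_on_def)
qed

lemma snoc_in: "y \<in> T q \<Longrightarrow> v \<in> G \<Longrightarrow> y(q := v) \<in> T (Suc q)"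
  unfolding tuples_def lessThan_Suc by (rule PiE_fun_upd)

lemma snoc_distr:
  "(\<lambda>(v, y). y(q := v)) \<in> measurable (\<nu> \<Otimes>\<^sub>M P q) (P (Suc q))"
  "distr (\<nu> \<Otimes>\<^sub>M P q) (P (Suc q)) (\<lambda>(v, y). y(q := v)) = P (Suc q)"
proof -
  show "(\<lambda>(v, y). y(q := v)) \<in> measurable (\<nu> \<Otimes>\<^sub>M P q) (P (Suc q))"
    unfolding tmeas_def lessThan_Suc by measurable
  show "distr (\<nu> \<Otimes>\<^sub>M P q) (P (Suc q)) (\<lambda>(v, y). y(q := v)) = P (Suc q)"
    unfolding tmeas_def lessThan_Suc
    using distr_pair_PiM_eq_PiM[of "{..<q}" "\<lambda>_. \<nu>" q] prob_nu by simp
qed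

lemma AE_snoc:
  assumes "AE z in P (Suc q). R z"
  shows "AE v in \<nu>. AE y in P q. R (y(q := v))"
proof -
  interpret PN: pair_prob_space \<nu> "P q" by standard
  have "AE z in distr (\<nu> \<Otimes>\<^sub>M P q) (P (Suc q)) (\<lambda>(v, y). y(q := v)). R z"
    unfolding snoc_distr(2) by (rule assms)
  from AE_distrD[OF snoc_distr(1) this] have "AE p in \<nu> \<Otimes>\<^sub>M P q. R ((snd p)(q := fst p))"
    by (simp add: case_prod_beta)
  from PN.AE_pair[OF this] show ?thesis by simp
qed

lemma emeasure_snoc:
  assumes E: "E \<in> sets (P (Suc q))"
  shows "emeasure (P (Suc q)) E = (\<integral>\<^sup>+v. emeasure (P q) {y \<in> T q. y(q := v) \<in> E} \<partial>\<nu>)"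
proof -
  interpret PN: pair_prob_space \<nu> "P q" by standard
  let ?E = "(\<lambda>(v, y). y(q := v)) -` E \<inter> space (\<nu> \<Otimes>\<^sub>M P q)"
  have "emeasure (P (Suc q)) E = emeasure (distr (\<nu> \<Otimes>\<^sub>M P q) (P (Suc q)) (\<lambda>(v, y). y(q := v))) E"
    unfolding snoc_distr(2) ..
  also have "\<dots> = emeasure (\<nu> \<Otimes>\<^sub>M P q) ?E" by (rule emeasure_distr[OF snoc_distr(1) E])
  also have "\<dots> = (\<integral>\<^sup>+v. emeasure (P q) (Pair v -` ?E) \<partial>\<nu>)"
    by (rule P.emeasure_pair_measure_alt[OF measurable_sets[OF snoc_distr(1) E]])
  also have "\<dots> = (\<integral>\<^sup>+v. emeasure (P q) {y \<in> T q. y(q := v) \<in> E} \<partial>\<nu>)"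
    by (intro nn_integral_cong arg_cong2[where f = emeasure] refl) (auto simp: space_pair_measure)
  finally show ?thesis .
qed

lemma face_snoc:
  assumes "y \<in> T (Suc k)" "v \<in> G"
  shows "j \<le> k \<Longrightarrow> face (Suc k) j (y(Suc k := v)) = (face k j y)(k := v)"
    and "face (Suc k) (Suc k) (y(Suc k := v)) = y"
  using assms by (auto simp: face_def restrict_def fun_eq_iff tuples_def PiE_def extensional_def)

text \<open>The cone formula. The last face omits the cone point \<open>v\<close> and has sign plus;
  in all others the sign is opposite to that of the same face of \<open>y\<close>. Where the left
  side vanishes, \<open>W\<close> coned off at \<open>v\<close> is a primitive of
  \<open>W\<close>.\<close>

lemma cobdry_snoc:
  fixes W :: "(nat \<Rightarrow> 'g) \<Rightarrow> 'a"
  assumes y: "y \<in> T (Suc k)" "v \<in> G"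
  shows "cobdry (Suc k) W (y(Suc k := v)) = W y - cobdry k (\<lambda>z. W (z(k := v))) y"
proof -
  have "cobdry (Suc k) W (y(Suc k := v)) = W (face (Suc k) (Suc k) (y(Suc k := v)))
     + (\<Sum>j\<le>k. if even (Suc k - j) then W (face (Suc k) j (y(Suc k := v))) else - W (face (Suc k) j (y(Suc k := v))))"
    unfolding cobdry_def by (simp add: add.commute)
  also have "(\<Sum>j\<le>k. if even (Suc k - j) then W (face (Suc k) j (y(Suc k := v))) else - W (face (Suc k) j (y(Suc k := v))))
     = (\<Sum>j\<le>k. - (if even (k - j) then W ((face k j y)(k := v)) else - W ((face k j y)(k := v))))"
    by (rule sum.cong[OF refl]) (auto simp: face_snoc[OF y] Suc_diff_le)
  finally show ?thesis unfolding face_snoc(2)[OF y] cobdry_def[of k] sum_negf by (simp only: add_uminus_conv_diff)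
qed

text \<open>A cone over a generic point \<open>v\<close> turns the cocycle \<open>W\<close> into a coboundary; by Fubini
  the cone can be chosen to vanish where \<open>W\<close> mostly vanishes.\<close>

lemma small_primitive:
  fixes W :: "(nat \<Rightarrow> 'g) \<Rightarrow> 'a"
  assumes W: "W \<in> measurable (P (Suc k)) (count_space UNIV)"
    and cocyc: "AE z in P (Suc (Suc k)). cobdry (Suc k) W z = 0"
    and small: "measure (P (Suc k)) {y \<in> T (Suc k). W y \<noteq> 0} \<le> \<epsilon>" and eps: "0 < \<epsilon>"
  shows "\<exists>u. u \<in> measurable (P k) (count_space UNIV) \<and> (AE y in P (Suc k). cobdry k u y = W y)
    \<and> measure (P k) {y \<in> T k. u y \<noteq> 0} \<le> 2 * \<epsilon>"
proof (rule ccontr)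
  assume neg: "\<not> ?thesis"
  let ?u = "\<lambda>v y. W (y(k := v))"
  define E where "E = {y \<in> T (Suc k). W y \<noteq> 0}"
  have E: "E \<in> sets (P (Suc k))"
    unfolding E_def using measurable_sets[OF W, of "- {0}"] by (simp add: vimage_def Int_def conj_commute)
  have "?u v \<in> measurable (P k) (count_space UNIV)" if "v \<in> G" for v
  proof -
    have "(\<lambda>y. (v, y)) \<in> measurable (P k) (\<nu> \<Otimes>\<^sub>M P k)" using that by (intro measurable_Pair1') simp
    from measurable_compose[OF measurable_compose[OF this snoc_distr(1)] W] show ?thesis by simp
  qed
  note um = this
  have good: "AE v in \<nu>. AE y in P (Suc k). cobdry k (?u v) y = W y"
    using AE_snoc[OF cocyc] AE_space
  proof eventually_elim
    case (elim v)
    show ?case using elim(1) AE_space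
      by eventually_elim (use elim(2) in \<open>simp add: cobdry_snoc\<close>)
  qed
  \<comment> \<open>Almost every \<open>v\<close> is an admissible cone point, so by assumption it
    violates the bound; integrating the slices over the probability \<open>\<nu>\<close> then gives
    \<open>E\<close> measure at least \<open>2 * \<epsilon>\<close>.\<close>
  have "AE v in \<nu>. ennreal (2 * \<epsilon>) \<le> emeasure (P k) {y \<in> T k. y(k := v) \<in> E}"
    using good AE_space
  proof eventually_elim
    case (elim v)
    then have v: "v \<in> G" by simp
    have "{y \<in> T k. y(k := v) \<in> E} = {y \<in> T k. ?u v y \<noteq> 0}"
      using v by (auto simp: E_def snoc_in)
    moreover have "\<not> measure (P k) {y \<in> T k. ?u v y \<noteq> 0} \<le> 2 * \<epsilon>"
      using neg elim(1) um[OF v] by blast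
    ultimately show ?case by (simp add: P.emeasure_eq_measure ennreal_leI)
  qed
  then have "(\<integral>\<^sup>+v. ennreal (2 * \<epsilon>) \<partial>\<nu>) \<le> (\<integral>\<^sup>+v. emeasure (P k) {y \<in> T k. y(k := v) \<in> E} \<partial>\<nu>)"
    by (rule nn_integral_mono_AE)
  also have "\<dots> = emeasure (P (Suc k)) E" by (rule emeasure_snoc[OF E, symmetric])
  also have "\<dots> \<le> ennreal \<epsilon>" using small by (simp add: P.emeasure_eq_measure ennreal_leI E_def)
  finally have "ennreal (2 * \<epsilon>) \<le> ennreal \<epsilon>" using nu.emeasure_space_1 by (simp del: ennreal_le_iff)
  then show False using eps by simp
qed

lemma cobdry_act:
  fixes F :: "(nat \<Rightarrow> 'g) \<Rightarrow> 'a"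
  assumes y: "y \<in> T (Suc k)" and g: "g \<in> G"
  shows "cobdry k (\<lambda>z. act g (F (sh (i g) k z))) y = act g (cobdry k F (sh (i g) (Suc k) y))"
  unfolding cobdry_def using face_sh[OF y i_in[OF g]] g
  by (auto simp: act_sum act_minus intro!: sum.cong)

definition jmeas :: "nat \<Rightarrow> nat \<Rightarrow> ((nat \<Rightarrow> 'g) \<Rightarrow> (nat \<Rightarrow> 'g) \<Rightarrow> 'a) \<Rightarrow> bool" where
  "jmeas a k S \<longleftrightarrow> (\<lambda>p. S (fst p) (snd p)) \<in> measurable (tmeas N a \<Otimes>\<^sub>M tmeas N k) (count_space UNIV)"

text \<open>Required at every pair of tuples rather than almost everywhere, so that \<open>x\<close>
  can be moved to first entry \<open>e\<close> without an exceptional null set depending on the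
  group element.\<close>

definition equiv2 :: "nat \<Rightarrow> nat \<Rightarrow> ((nat \<Rightarrow> 'g) \<Rightarrow> (nat \<Rightarrow> 'g) \<Rightarrow> 'a) \<Rightarrow> bool" where
  "equiv2 a k S \<longleftrightarrow> (\<forall>g\<in>G. \<forall>x\<in>T a. \<forall>y\<in>T k. S (sh g a x) (sh g k y) = act g (S x y))"

lemma jmeas_compose:
  assumes "jmeas a k S" "f \<in> measurable M (tmeas N a)" "h \<in> measurable M (tmeas N k)"
  shows "(\<lambda>x. S (f x) (h x)) \<in> measurable M (count_space UNIV)"
  using measurable_compose[OF measurable_Pair[OF assms(2,3)] assms(1)[unfolded jmeas_def]] by simp

lemma jmeas_slice: "jmeas a k S \<Longrightarrow> x \<in> T a \<Longrightarrow> S x \<in> measurable (P k) (count_space UNIV)"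
  using jmeas_compose[of a k S "\<lambda>_. x" "P k" "\<lambda>y. y"] by (simp add: measurable_ident_sets[OF sets_P])

lemma neq_sets:
  fixes s s' :: "(nat \<Rightarrow> 'g) \<Rightarrow> 'a"
  assumes "s \<in> measurable (P k) (count_space UNIV)" "s' \<in> measurable (P k) (count_space UNIV)"
  shows "{y \<in> T k. s y \<noteq> s' y} \<in> sets (P k)"
proof -
  have "Measurable.pred (P k) (\<lambda>y. s y \<noteq> s' y)" by (rule count_measurable2[OF assms])
  then show ?thesis by (simp add: pred_def)
qed

end

lemma summable_half: "summable (\<lambda>n. c * (1/2::real) ^ n)"
  by (intro summable_mult summable_geometric) simp

lemma suminf_half_tail: "(\<Sum>n. c * (1/2::real) ^ (n + M)) = 2 * c * (1/2) ^ M"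
proof -
  have "(\<lambda>n. (c * (1/2) ^ M) * (1/2::real) ^ n) sums (c * (1/2) ^ M * (1 / (1 - 1/2)))"
    by (intro sums_mult geometric_sums) simp
  then show ?thesis by (simp add: sums_iff power_add mult_ac)
qed

context haar_base begin

text \<open>The measures of the exceptional sets are summable, so Borel--Cantelli applies. The bound
  starts at 1 because in the telescoping series to which this is applied the term 0 is not a
  difference.\<close>

lemma eventually_equal:
  fixes s :: "nat \<Rightarrow> (nat \<Rightarrow> 'g) \<Rightarrow> 'a"
  assumes s: "\<And>n. s n \<in> measurable (P k) (count_space UNIV)" and s': "s' \<in> measurable (P k) (count_space UNIV)"
    and le: "\<And>n. n > 0 \<Longrightarrow> measure (P k) {y \<in> T k. s n y \<noteq> s' y} \<le> c * (1/2) ^ n"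
  shows "AE y in P k. \<exists>M. \<forall>n\<ge>M. s n y = s' y"
proof -
  let ?A = "\<lambda>n. {y \<in> T k. s n y \<noteq> s' y}"
  have S: "?A n \<in> sets (P k)" for n by (rule neq_sets[OF s s'])
  have sum: "summable (\<lambda>n. measure (P k) (?A n))"
  proof (rule summable_comparison_test'[OF summable_half[of c], of 1])
    fix n :: nat assume "1 \<le> n"
    then show "norm (measure (P k) (?A n)) \<le> c * (1/2) ^ n" using le[of n] by simp
  qed
  have "AE y in P k. eventually (\<lambda>n. y \<in> space (P k) - ?A n) sequentially"
    by (rule borel_cantelli_AE1[OF S _ sum]) (simp add: P.emeasure_eq_measure)
  then show ?thesis
    by eventually_elim (auto simp: eventually_sequentially)
qed

text \<open>Let \<open>r\<^sub>n\<close> be a representative of the \<open>n\<close>-th cell of \<open>x\<close>.  A cone over a generic point, which depends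
  on the cells only, gives a primitive of \<open>Z r\<^sub>n - Z r\<^sub>n\<^sub>-\<^sub>1\<close> that is small in measure.  By
  Borel--Cantelli the sum of these primitives is almost everywhere finite; it is a primitive of
  \<open>Z x\<close> for normalised \<open>x\<close>, and the general case follows by equivariance.\<close>

lemma lifting:
  fixes Z :: "(nat \<Rightarrow> 'g) \<Rightarrow> (nat \<Rightarrow> 'g) \<Rightarrow> 'a"
  assumes a: "0 < a" and jm: "jmeas a (Suc k) Z" and ev: "equiv2 a (Suc k) Z" and tm: "tame a (Suc k) Z"
    and cocyc: "\<And>x. x \<in> T a \<Longrightarrow> AE z in P (Suc (Suc k)). cobdry (Suc k) (Z x) z = 0"
  shows "\<exists>S. jmeas a k S \<and> equiv2 a k S \<and> tame a k S \<and>
    (\<forall>x\<in>T a. AE y in P (Suc k). cobdry k (S x) y = Z x y)"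
proof -
  obtain code :: "nat \<Rightarrow> (nat \<Rightarrow> 'g) \<Rightarrow> nat"
    where code_meas: "\<And>n. code n \<in> measurable (tmeas N a) (count_space UNIV)"
    and code_sh: "\<And>n g x. g \<in> G \<Longrightarrow> x \<in> T a \<Longrightarrow> code n (sh g a x) = code n x"
    and code_tol: "\<And>n x x'. x \<in> T a \<Longrightarrow> x' \<in> T a \<Longrightarrow> x 0 = e \<Longrightarrow> x' 0 = e \<Longrightarrow> code n x = code n x' \<Longrightarrow>
       measure (P (Suc k)) {y \<in> T (Suc k). Z x y \<noteq> Z x' y} \<le> (1/2) ^ n"
    and code_loc: "\<And>n x0. x0 \<in> T a \<Longrightarrow> \<exists>U F. open U \<and> x0 \<in> U \<and> finite F \<and> F \<subseteq> tests a \<and>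
       (\<forall>x\<in>T a \<inter> U. \<forall>x'\<in>T a \<inter> U. (\<forall>t\<in>F. sat x t = sat x' t) \<longrightarrow> code n x = code n x')"
    by (rule cell_codes[OF a tm]) (rule that)
  have Zm: "Z x \<in> measurable (P (Suc k)) (count_space UNIV)" if "x \<in> T a" for x
    by (rule jmeas_slice[OF jm that])
  define nrm where "nrm x = sh (i (x 0)) a x" for x
  have x0G: "x 0 \<in> G" if "x \<in> T a" for x using tuples_D[OF that a] .
  have nrm1: "nrm x \<in> T a" if "x \<in> T a" for x
    unfolding nrm_def using x0G[OF that] that by simp
  have nrm2: "nrm x 0 = e" if "x \<in> T a" for x
    unfolding nrm_def gshift_def using x0G[OF that] a by simp
  have nrm3: "code n (nrm x) = code n x" if "x \<in> T a" for x n
    unfolding nrm_def using code_sh[OF i_in[OF x0G[OF that]] that] .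
  note nrm = nrm1 nrm2 nrm3
  define base where "base = restrict (\<lambda>_. e) {..<a}"
  have base: "base \<in> T a" "base 0 = e" unfolding base_def using a by (auto intro!: restrict_in_tuples)
  \<comment> \<open>A representative for every pair of level and code; for a code that no normalised
    tuple has, \<open>base\<close> shows that some normalised tuple can still be taken, so that
    \<open>Z (rep n \<kappa>)\<close> is always a cocycle.\<close>
  have "\<forall>p. \<exists>z. z \<in> T a \<and> z 0 = e \<and> ((\<exists>x\<in>T a. x 0 = e \<and> code (fst p) x = snd p) \<longrightarrow> code (fst p) z = snd p)"
    using base by blast
  from choice[OF this] obtain rp where rp: "\<forall>p. rp p \<in> T a \<and> rp p 0 = e \<and>
      ((\<exists>x\<in>T a. x 0 = e \<and> code (fst p) x = snd p) \<longrightarrow> code (fst p) (rp p) = snd p)" ..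
  define rep where "rep n \<kappa> = rp (n, \<kappa>)" for n \<kappa>
  have rep': "rep n \<kappa> \<in> T a \<and> rep n \<kappa> 0 = e \<and>
      ((\<exists>x\<in>T a. x 0 = e \<and> code n x = \<kappa>) \<longrightarrow> code n (rep n \<kappa>) = \<kappa>)" for n \<kappa>
    using rp[THEN spec, of "(n, \<kappa>)"] unfolding rep_def by simp
  have rep: "rep n \<kappa> \<in> T a" "rep n \<kappa> 0 = e" for n \<kappa> using rep' by blast+
  have repc: "code n (rep n (code n x)) = code n x" if "x \<in> T a" for n x
    using rep'[of n "code n x"] nrm1[OF that] nrm2[OF that] nrm3[OF that] by blast
  \<comment> \<open>The series telescopes to \<open>Z (rep n \<kappa>)\<close>. Its summands depend
    on \<open>x\<close> only through two codes, hence there are countably many of them and one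
    primitive can be fixed for each.\<close>
  define W where "W n \<kappa> \<kappa>' y = (if n = 0 then Z (rep 0 \<kappa>) y else Z (rep n \<kappa>) y - Z (rep (n - 1) \<kappa>') y)"
    for n \<kappa> \<kappa>' y
  have Wm: "W n \<kappa> \<kappa>' \<in> measurable (P (Suc k)) (count_space UNIV)" for n \<kappa> \<kappa>'
    unfolding W_def by (cases "n = 0") (simp_all add: Zm rep count_measurable2)
  have Wc: "AE z in P (Suc (Suc k)). cobdry (Suc k) (W n \<kappa> \<kappa>') z = 0" for n \<kappa> \<kappa>'
  proof (cases "n = 0")
    case True
    then show ?thesis using cocyc[OF rep(1)[of 0 \<kappa>]] unfolding W_def by simp
  next
    case False
    have "W n \<kappa> \<kappa>' = (\<lambda>y. Z (rep n \<kappa>) y - Z (rep (n - 1) \<kappa>') y)" using False by (auto simp: W_def)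
    then show ?thesis
      using cocyc[OF rep(1)[of n \<kappa>]] cocyc[OF rep(1)[of "n - 1" \<kappa>']] by (auto simp: cobdry_diff)
  qed
  \<comment> \<open>For \<open>n > 0\<close> and the codes of a common tuple the bound
    \<open>3 * (1/2) ^ n\<close> holds, being \<open>(1/2) ^ n + (1/2) ^ (n - 1)\<close>, and
    \<open>small_primitive\<close> doubles it. Other pairs of codes get an arbitrary primitive, so
    smallness is only conditional.\<close>
  have "\<forall>p. \<exists>u. u \<in> measurable (P k) (count_space UNIV) \<and>
      (AE y in P (Suc k). cobdry k u y = W (fst p) (fst (snd p)) (snd (snd p)) y) \<and>
      (measure (P (Suc k)) {y \<in> T (Suc k). W (fst p) (fst (snd p)) (snd (snd p)) y \<noteq> 0} \<le> 3 * (1/2) ^ fst p \<longrightarrow>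
       measure (P k) {y \<in> T k. u y \<noteq> 0} \<le> 6 * (1/2) ^ fst p)"
  proof
    fix p
    let ?W = "W (fst p) (fst (snd p)) (snd (snd p))"
    show "\<exists>u. u \<in> measurable (P k) (count_space UNIV) \<and> (AE y in P (Suc k). cobdry k u y = ?W y) \<and>
      (measure (P (Suc k)) {y \<in> T (Suc k). ?W y \<noteq> 0} \<le> 3 * (1/2) ^ fst p \<longrightarrow>
       measure (P k) {y \<in> T k. u y \<noteq> 0} \<le> 6 * (1/2) ^ fst p)"
    proof (cases "measure (P (Suc k)) {y \<in> T (Suc k). ?W y \<noteq> 0} \<le> 3 * (1/2) ^ fst p")
      case True
      have "(0::real) < 3 * (1/2) ^ fst p" by simp
      from small_primitive[OF Wm Wc True this] show ?thesis by (auto simp: mult.assoc[symmetric])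
    next
      case False
      have "measure (P (Suc k)) {y \<in> T (Suc k). ?W y \<noteq> 0} \<le> 1" by simp
      from small_primitive[OF Wm Wc this] show ?thesis using False by auto
    qed
  qed
  from choice[OF this] obtain u' where u': "\<forall>p. u' p \<in> measurable (P k) (count_space UNIV) \<and>
      (AE y in P (Suc k). cobdry k (u' p) y = W (fst p) (fst (snd p)) (snd (snd p)) y) \<and>
      (measure (P (Suc k)) {y \<in> T (Suc k). W (fst p) (fst (snd p)) (snd (snd p)) y \<noteq> 0} \<le> 3 * (1/2) ^ fst p \<longrightarrow>
       measure (P k) {y \<in> T k. u' p y \<noteq> 0} \<le> 6 * (1/2) ^ fst p)" ..
  define U where "U n x = u' (n, code n x, code (n - 1) x)" for n x
  have Um: "U n x \<in> measurable (P k) (count_space UNIV)" for n x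
    unfolding U_def using u' by blast
  have Ud: "AE y in P (Suc k). cobdry k (U n x) y = W n (code n x) (code (n - 1) x) y" for n x
    using u'[THEN spec, of "(n, code n x, code (n - 1) x)"] unfolding U_def by simp
  have repZ: "measure (P (Suc k)) {y \<in> T (Suc k). Z (rep n (code n x)) y \<noteq> Z (nrm x) y} \<le> (1/2) ^ n"
    if "x \<in> T a" for n x
    using that by (intro code_tol rep nrm) (simp_all add: repc nrm)
  have Us: "measure (P k) {y \<in> T k. U n x y \<noteq> 0} \<le> 6 * (1/2) ^ n" if x: "x \<in> T a" and n: "0 < n" for n x
  proof -
    let ?D = "\<lambda>n. {y \<in> T (Suc k). Z (rep n (code n x)) y \<noteq> Z (nrm x) y}"
    have DS: "?D n \<in> sets (P (Suc k))" for n by (rule neq_sets[OF Zm[OF rep(1)] Zm[OF nrm(1)[OF x]]])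
    have "measure (P (Suc k)) {y \<in> T (Suc k). W n (code n x) (code (n - 1) x) y \<noteq> 0}
        \<le> measure (P (Suc k)) (?D n \<union> ?D (n - 1))"
      using DS n by (intro P.finite_measure_mono sets.Un) (auto simp: W_def)
    also have "\<dots> \<le> measure (P (Suc k)) (?D n) + measure (P (Suc k)) (?D (n - 1))"
      by (rule measure_Un_le[OF DS DS])
    also have "\<dots> \<le> (1/2) ^ n + (1/2) ^ (n - 1)" by (intro add_mono repZ x)
    also have "\<dots> = 3 * (1/2) ^ n" using n by (cases n) auto
    finally show ?thesis using u'[THEN spec, of "(n, code n x, code (n - 1) x)"] unfolding U_def by simp
  qed
  have Ufin: "AE y in P k. \<exists>M. \<forall>n\<ge>M. U n x y = 0" if "x \<in> T a" for x
    using eventually_equal[of "\<lambda>n. U n x" k "\<lambda>_. 0" 6] Um Us[OF that] by simp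
  have Zfin: "AE y in P (Suc k). \<exists>M. \<forall>n\<ge>M. Z (rep n (code n x)) y = Z (nrm x) y" if "x \<in> T a" for x
    using eventually_equal[of "\<lambda>n. Z (rep n (code n x))" "Suc k" "Z (nrm x)" 1]
      Zm[OF rep(1)] Zm[OF nrm(1)[OF that]] repZ[OF that] by simp
  define R where "R x y = fsum (\<lambda>n. U n x y)" for x y
  have Rd: "AE y in P (Suc k). cobdry k (R x) y = Z (nrm x) y" if x: "x \<in> T a" for x
  proof -
    have f: "AE y in P (Suc k). \<forall>j\<in>{..k}. \<exists>M. \<forall>n\<ge>M. U n x (face k j y) = 0"
      using AE_face[OF Ufin[OF x]] by (subst AE_finite_all) auto
    have d: "AE y in P (Suc k). \<forall>n. cobdry k (U n x) y = W n (code n x) (code (n - 1) x) y"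
      using Ud by (subst AE_all_countable) blast
    show ?thesis using f d Zfin[OF x]
    proof eventually_elim
      case (elim y)
      from elim(1) obtain Mf where Mf: "\<forall>j\<in>{..k}. \<forall>n\<ge>Mf j. U n x (face k j y) = 0" by metis
      from elim(3) obtain M2 where M2: "\<forall>n\<ge>M2. Z (rep n (code n x)) y = Z (nrm x) y" by blast
      \<comment> \<open>Beyond the index of every face, so that all the sums stop, and at least one
        more than \<open>M2\<close>, so that the last representative, of level \<open>M - 1\<close>,
        already gives the limit value.\<close>
      define M where "M = Suc (M2 + (\<Sum>j\<le>k. Mf j))"
      have MM: "Mf j \<le> M" if "j \<le> k" for j
        using member_le_sum[of j "{..k}" Mf] that unfolding M_def by simp
      have "cobdry k (R x) y = cobdry k (\<lambda>z. \<Sum>n<M. U n x z) y"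
        unfolding R_def by (intro cobdry_cong fsum_eq) (use Mf MM in \<open>meson atMost_iff order_trans\<close>)
      also have "\<dots> = (\<Sum>n<M. W n (code n x) (code (n - 1) x) y)"
        using elim(2) by (simp add: cobdry_sum)
      also have "\<dots> = Z (rep (M - 1) (code (M - 1) x)) y"
      proof -
        have "(\<Sum>n<Suc L. W n (code n x) (code (n - 1) x) y) = Z (rep L (code L x)) y" for L
          by (induction L) (auto simp: W_def)
        then show ?thesis by (simp add: M_def)
      qed
      also have "\<dots> = Z (nrm x) y" using M2 by (simp add: M_def)
      finally show ?case .
    qed
  qed
  \<comment> \<open>The tail of \<open>6 * (1/2) ^ n\<close> from \<open>M\<close> on sums to
    \<open>12 * (1/2) ^ M\<close>.\<close>
  have Rtail: "measure (P k) {y \<in> T k. R x y \<noteq> (\<Sum>n<M. U n x y)} \<le> 12 * (1/2) ^ M"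
    if x: "x \<in> T a" and M: "0 < M" for x M
  proof -
    let ?A = "\<lambda>n. {y \<in> T k. U (n + M) x y \<noteq> 0}"
    have S: "?A n \<in> sets (P k)" for n using neq_sets[OF Um measurable_const[of 0]] by simp
    have le: "measure (P k) (?A n) \<le> 6 * (1/2) ^ (n + M)" for n using M by (intro Us x) simp
    have sm: "summable (\<lambda>n. 6 * (1/2::real) ^ (n + M))"
      using summable_ignore_initial_segment[OF summable_half[of 6], of M] .
    have sA: "summable (\<lambda>n. measure (P k) (?A n))"
      by (rule summable_comparison_test'[OF sm, of 0]) (use le in auto)
    have "measure (P k) {y \<in> T k. R x y \<noteq> (\<Sum>n<M. U n x y)} \<le> measure (P k) (\<Union>n. ?A n)"
    proof (intro P.finite_measure_mono sets.countable_UN)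
      show "{y \<in> T k. R x y \<noteq> (\<Sum>n<M. U n x y)} \<subseteq> (\<Union>n. ?A n)"
      proof (rule subsetI, rule ccontr)
        fix y assume y: "y \<in> {y \<in> T k. R x y \<noteq> (\<Sum>n<M. U n x y)}" "y \<notin> (\<Union>n. ?A n)"
        then have "\<forall>n. U (n + M) x y = 0" by auto
        then have "\<forall>n\<ge>M. U n x y = 0" by (metis le_add_diff_inverse2)
        from fsum_eq[OF this] y(1) show False by (simp add: R_def)
      qed
    qed (use S in auto)
    also have "\<dots> \<le> (\<Sum>n. measure (P k) (?A n))"
      using S by (intro P.finite_measure_subadditive_countably sA) auto
    also have "\<dots> \<le> (\<Sum>n. 6 * (1/2) ^ (n + M))" by (rule suminf_le[OF le sA sm])
    also have "\<dots> = 12 * (1/2) ^ M" using suminf_half_tail[of 6 M] by simp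
    finally show ?thesis .
  qed
  \<comment> \<open>\<open>R x\<close> is a primitive for the normalised tuple only; this is the one
    extension compatible with equivariance, as \<open>R x\<close> does not change under the diagonal
    action on \<open>x\<close>.\<close>
  define S where "S x y = act (x 0) (R x (sh (i (x 0)) k y))" for x y
  have ev': "equiv2 a k S"
    unfolding equiv2_def
  proof (intro ballI)
    fix g x y assume g: "g \<in> G" and x: "x \<in> T a" and y: "y \<in> T k"
    have x0: "(sh g a x) 0 = m g (x 0)" using a by (simp add: gshift_def)
    have R: "R (sh g a x) = R x" unfolding R_def U_def using code_sh[OF g x] by simp
    have "sh (i (m g (x 0))) k (sh g k y) = sh (i (x 0)) k y"
      using g x0G[OF x] y by (simp add: sh_sh i_m m_assoc)
    then show "S (sh g a x) (sh g k y) = act g (S x y)"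
      unfolding S_def x0 R using g x0G[OF x] by (simp add: act_m)
  qed
  have jm': "jmeas a k S"
  proof -
    let ?M = "tmeas N a \<Otimes>\<^sub>M tmeas N k"
    have uj: "(\<lambda>p. u' q (snd p)) \<in> measurable ?M (count_space UNIV)" for q
    proof -
      have "u' q \<in> measurable (P k) (count_space UNIV)" using u' by blast
      then have "u' q \<in> measurable (tmeas N k) (count_space UNIV)"
        by (simp add: measurable_cong_sets[OF sets_P refl])
      then show ?thesis by (rule measurable_compose[OF measurable_snd])
    qed
    have cm: "(\<lambda>p. code n (fst p)) \<in> measurable ?M (count_space UNIV)" for n
      by (rule measurable_compose[OF measurable_fst code_meas])
    have "(\<lambda>p. u' (n, \<kappa>, code (n - 1) (fst p)) (snd p)) \<in> measurable ?M (count_space UNIV)" for n \<kappa>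
      by (rule measurable_compose_countable[OF uj cm])
    from measurable_compose_countable[OF this cm]
    have "(\<lambda>p. U n (fst p) (snd p)) \<in> measurable ?M (count_space UNIV)" for n
      unfolding U_def .
    from fsum_measurable[OF this] have Rj: "jmeas a k R" unfolding jmeas_def R_def .
    have z: "(\<lambda>p. fst p 0) \<in> measurable ?M N"
    proof (rule measurable_compose[OF measurable_fst])
      show "(\<lambda>x. x 0) \<in> measurable (tmeas N a) N"
        unfolding tmeas_def using a by (intro measurable_component_singleton) auto
    qed
    have "(\<lambda>p. sh (i (fst p 0)) k (snd p)) \<in> measurable ?M (tmeas N k)"
      by (intro sh_measurable measurable_compose[OF z i_measurable] measurable_snd)
    from act_measurable[OF z jmeas_compose[OF Rj measurable_fst this]]
    show ?thesis unfolding jmeas_def S_def .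
  qed
  have d': "AE y in P (Suc k). cobdry k (S x) y = Z x y" if x: "x \<in> T a" for x
  proof -
    have "AE y in P (Suc k). cobdry k (R x) (sh (i (x 0)) (Suc k) y) = Z (nrm x) (sh (i (x 0)) (Suc k) y)"
      by (rule AE_sh[OF i_in[OF x0G[OF x]] Rd[OF x]])
    then show ?thesis using AE_space
    proof eventually_elim
      case (elim y)
      then have y: "y \<in> T (Suc k)" by simp
      have "cobdry k (S x) y = act (x 0) (cobdry k (R x) (sh (i (x 0)) (Suc k) y))"
        unfolding S_def using cobdry_act[OF y x0G[OF x], of "R x"] .
      also have "\<dots> = act (x 0) (Z (sh (i (x 0)) a x) (sh (i (x 0)) (Suc k) y))"
        using elim(1) by (simp add: nrm_def)
      also have "\<dots> = Z x y" using ev[unfolded equiv2_def] x y x0G[OF x] by simp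
      finally show ?case .
    qed
  qed
  \<comment> \<open>Near \<open>x0\<close> the function \<open>R x\<close> is replaced by its
    partial sum \<open>Q x\<close>, which ranges over finitely many functions of \<open>y\<close>,
    and \<open>x 0\<close> by \<open>c\<close>. Each replacement costs \<open>eps / 4\<close>, and
    two tuples are compared.\<close>
  have tm': "tame a k S"
    unfolding tame_def
  proof (intro ballI allI impI)
    fix x0 and eps :: real assume x0: "x0 \<in> T a" and eps: "0 < eps"
    define c where "c = x0 0"
    have c: "c \<in> G" unfolding c_def by (rule x0G[OF x0])
    have e4: "0 < eps / 4" using eps by simp
    obtain V1 \<delta> where V1: "openin (top_of_set G) V1" "c \<in> V1" "(0::real) < \<delta>"
      "\<And>g E. g \<in> V1 \<Longrightarrow> E \<in> sets (P k) \<Longrightarrow> measure (P k) E < \<delta> \<Longrightarrow>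
         measure (P k) {y \<in> T k. sh (i g) k y \<in> E} \<le> eps / 4"
      by (rule translate_abs_cont[OF c e4, of k]) (rule that)
    have "(\<lambda>n. 12 * (1/2::real) ^ n) \<longlonglongrightarrow> 0" by (rule summable_LIMSEQ_zero[OF summable_half])
    from order_tendstoD(2)[OF this V1(3)] obtain M0 where M0: "\<forall>n\<ge>M0. 12 * (1/2::real) ^ n < \<delta>"
      by (auto simp: eventually_sequentially)
    define M where "M = Suc M0"
    have M: "0 < M" "12 * (1/2::real) ^ M < \<delta>" unfolding M_def using M0 by (simp, blast intro: le_SucI)
    define Q where "Q x y = (\<Sum>n<M. U n x y)" for x y
    have Qm: "Q x \<in> measurable (P k) (count_space UNIV)" for x
      unfolding Q_def by (rule sum_count_measurable) (rule Um)
    have Rm: "R x \<in> measurable (P k) (count_space UNIV)" for x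
      unfolding R_def by (rule fsum_measurable) (rule Um)
    have "\<forall>n. \<exists>UF. open (fst UF) \<and> x0 \<in> fst UF \<and> finite (snd UF) \<and> snd UF \<subseteq> tests a \<and>
       (\<forall>x\<in>T a \<inter> fst UF. \<forall>x'\<in>T a \<inter> fst UF. (\<forall>t\<in>snd UF. sat x t = sat x' t) \<longrightarrow> code n x = code n x')"
      using code_loc[OF x0] by simp
    from choice[OF this] obtain UF where UF: "\<forall>n. open (fst (UF n)) \<and> x0 \<in> fst (UF n) \<and> finite (snd (UF n)) \<and> snd (UF n) \<subseteq> tests a \<and>
       (\<forall>x\<in>T a \<inter> fst (UF n). \<forall>x'\<in>T a \<inter> fst (UF n). (\<forall>t\<in>snd (UF n). sat x t = sat x' t) \<longrightarrow> code n x = code n x')" ..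
    define UU where "UU = (\<Inter>n\<in>{..<M}. fst (UF n))"
    define FF where "FF = (\<Union>n\<in>{..<M}. snd (UF n))"
    have UU: "open UU" "x0 \<in> UU" unfolding UU_def using UF by (auto intro!: open_INT)
    have FF: "finite FF" "FF \<subseteq> tests a" unfolding FF_def using UF by (simp, blast)
    have Qeq: "Q x = Q x'" if x: "x \<in> T a \<inter> UU" "x' \<in> T a \<inter> UU" and F: "\<forall>t\<in>FF. sat x t = sat x' t" for x x'
    proof -
      have ceq: "code n x = code n x'" if "n < M" for n
      proof -
        have "x \<in> T a \<inter> fst (UF n)" "x' \<in> T a \<inter> fst (UF n)" using x that by (auto simp: UU_def)
        moreover have "\<forall>t\<in>snd (UF n). sat x t = sat x' t" using F that by (auto simp: FF_def)
        ultimately show ?thesis using UF by blast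
      qed
      have "U n x = U n x'" if "n < M" for n
        unfolding U_def using ceq[OF that] ceq[of "n - 1"] that by simp
      then show ?thesis unfolding Q_def by simp
    qed
    define QS where "QS = Q ` (T a \<inter> UU)"
    have QSf: "finite QS" unfolding QS_def by (rule finite_image_patterns[OF FF(1) Qeq])
    have "\<forall>q. \<exists>V. openin (top_of_set G) V \<and> c \<in> V \<and> (q \<in> QS \<longrightarrow>
      (\<forall>g\<in>V. measure (P k) {y \<in> T k. act g (q (sh (i g) k y)) \<noteq> act c (q (sh (i c) k y))} \<le> eps / 4))"
    proof
      fix q
      show "\<exists>V. openin (top_of_set G) V \<and> c \<in> V \<and> (q \<in> QS \<longrightarrow>
        (\<forall>g\<in>V. measure (P k) {y \<in> T k. act g (q (sh (i g) k y)) \<noteq> act c (q (sh (i c) k y))} \<le> eps / 4))"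
      proof (cases "q \<in> QS")
        case True
        then have "q \<in> measurable (P k) (count_space UNIV)" using Qm by (auto simp: QS_def)
        then show ?thesis by (rule translate_continuous[OF _ c e4]) blast
      next
        case False
        have "openin (top_of_set G) G" by simp
        then show ?thesis using False c by blast
      qed
    qed
    from choice[OF this] obtain VV where VV: "\<forall>q. openin (top_of_set G) (VV q) \<and> c \<in> VV q \<and> (q \<in> QS \<longrightarrow>
      (\<forall>g\<in>VV q. measure (P k) {y \<in> T k. act g (q (sh (i g) k y)) \<noteq> act c (q (sh (i c) k y))} \<le> eps / 4))" ..
    define V where "V = V1 \<inter> (G \<inter> (\<Inter>q\<in>QS. VV q))"
    have "openin (top_of_set G) (G \<inter> (\<Inter>q\<in>QS. VV q))"
      using QSf
    proof (induction QS rule: finite_induct)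
      case (insert q F)
      have "openin (top_of_set G) (VV q)" using VV by blast
      from openin_Int[OF this insert.IH] show ?case by (simp add: Int_left_commute[of G])
    qed simp
    then have V: "openin (top_of_set G) V" "c \<in> V" unfolding V_def using V1 VV c by auto
    obtain V' where V': "open V'" "V = G \<inter> V'" using V(1) by (auto simp: openin_open)
    define UV where "UV = UU \<inter> (\<lambda>x. x 0) -` V'"
    have UV: "open UV" "x0 \<in> UV"
      unfolding UV_def using UU V V' by (auto simp: c_def intro!: open_Int open_vimage)
    have half: "measure (P k) {y \<in> T k. S x y \<noteq> act c (Q x (sh (i c) k y))} \<le> eps / 2"
      and halfS: "{y \<in> T k. S x y \<noteq> act c (Q x (sh (i c) k y))} \<in> sets (P k)"
      if x: "x \<in> T a \<inter> UV" for x
    proof -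
      have xT: "x \<in> T a" and xU: "x \<in> T a \<inter> UU" using x by (auto simp: UV_def)
      have gV: "x 0 \<in> V" using x x0G[OF xT] V' by (auto simp: UV_def)
      have gG: "x 0 \<in> G" by (rule x0G[OF xT])
      let ?A = "{y \<in> T k. sh (i (x 0)) k y \<in> {y \<in> T k. R x y \<noteq> Q x y}}"
      let ?B = "{y \<in> T k. act (x 0) (Q x (sh (i (x 0)) k y)) \<noteq> act c (Q x (sh (i c) k y))}"
      have am: "(\<lambda>y. act g (q (sh (i g) k y))) \<in> measurable (P k) (count_space UNIV)"
        if "g \<in> G" "q \<in> measurable (P k) (count_space UNIV)" for g q
        using measurable_compose[OF sh_left_P[OF i_in[OF that(1)]] that(2)]
        by (intro act_measurable) (auto simp: that)
      have S: "?A \<in> sets (P k)" by (rule sh_sets[OF i_in[OF gG] neq_sets[OF Rm Qm]])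
      have S2: "?B \<in> sets (P k)" by (rule neq_sets[OF am[OF gG Qm] am[OF c Qm]])
      show "{y \<in> T k. S x y \<noteq> act c (Q x (sh (i c) k y))} \<in> sets (P k)"
        unfolding S_def by (rule neq_sets[OF am[OF gG Rm] am[OF c Qm]])
      have "{y \<in> T k. S x y \<noteq> act c (Q x (sh (i c) k y))} \<subseteq> ?A \<union> ?B"
        using gG by (auto simp: S_def)
      then have "measure (P k) {y \<in> T k. S x y \<noteq> act c (Q x (sh (i c) k y))} \<le> measure (P k) ?A + measure (P k) ?B"
        using S S2 by (intro order_trans[OF P.finite_measure_mono measure_Un_le] sets.Un)
      moreover have "measure (P k) ?A \<le> eps / 4"
      proof (rule V1(4))
        show "x 0 \<in> V1" using gV by (simp add: V_def)
        show "{y \<in> T k. R x y \<noteq> Q x y} \<in> sets (P k)" by (rule neq_sets[OF Rm Qm])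
        show "measure (P k) {y \<in> T k. R x y \<noteq> Q x y} < \<delta>"
          using Rtail[OF xT M(1)] M(2) unfolding Q_def by linarith
      qed
      moreover have "measure (P k) ?B \<le> eps / 4"
      proof -
        have "Q x \<in> QS" using xU by (simp add: QS_def)
        then have "x 0 \<in> VV (Q x)" using gV by (auto simp: V_def)
        with VV \<open>Q x \<in> QS\<close> show ?thesis by blast
      qed
      ultimately show "measure (P k) {y \<in> T k. S x y \<noteq> act c (Q x (sh (i c) k y))} \<le> eps / 2" by linarith
    qed
    show "\<exists>U F. open U \<and> x0 \<in> U \<and> finite F \<and> F \<subseteq> tests a \<and>
     (\<forall>x\<in>T a \<inter> U. \<forall>x'\<in>T a \<inter> U. (\<forall>t\<in>F. sat x t = sat x' t) \<longrightarrow>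
        measure (P k) {y \<in> T k. S x y \<noteq> S x' y} \<le> eps)"
    proof (rule exI[of _ UV], rule exI[of _ FF], intro conjI UV FF ballI impI)
      fix x x' assume x: "x \<in> T a \<inter> UV" "x' \<in> T a \<inter> UV" and F: "\<forall>t\<in>FF. sat x t = sat x' t"
      have "Q x = Q x'" using x F by (intro Qeq) (auto simp: UV_def)
      then have "{y \<in> T k. S x y \<noteq> S x' y} \<subseteq> {y \<in> T k. S x y \<noteq> act c (Q x (sh (i c) k y))}
         \<union> {y \<in> T k. S x' y \<noteq> act c (Q x' (sh (i c) k y))}" by auto
      then have "measure (P k) {y \<in> T k. S x y \<noteq> S x' y} \<le>
          measure (P k) {y \<in> T k. S x y \<noteq> act c (Q x (sh (i c) k y))}
         + measure (P k) {y \<in> T k. S x' y \<noteq> act c (Q x' (sh (i c) k y))}"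
        using halfS[OF x(1)] halfS[OF x(2)]
        by (intro order_trans[OF P.finite_measure_mono measure_Un_le] sets.Un)
      then show "measure (P k) {y \<in> T k. S x y \<noteq> S x' y} \<le> eps"
        using half[OF x(1)] half[OF x(2)] by linarith
    qed
  qed
  from jm' ev' tm' d' show ?thesis by blast
qed

end

section \<open>The double complex\<close>

definition sg :: "nat \<Rightarrow> 'a::ab_group_add \<Rightarrow> 'a" where
  "sg n v = (if even n then v else - v)"

lemma sg_sum: "sg n (sum f A) = (\<Sum>x\<in>A. sg n (f x))"
  by (simp add: sg_def sum_negf)

lemma sg_0 [simp]: "sg n 0 = 0" by (simp add: sg_def)

lemma sg_sg: "sg n (sg k v) = sg (n + k) v" by (simp add: sg_def)

lemma sg_cong: "even n = even k \<Longrightarrow> sg n v = sg k v" by (simp add: sg_def)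

lemma sg_Suc: "sg (Suc n) v = - sg n v" by (simp add: sg_def)

lemma sg_diff: "sg n (v - w) = sg n v - sg n w" by (simp add: sg_def)

lemma cobdry_sg: "cobdry q \<sigma> x = (\<Sum>j\<le>q. sg (q - j) (\<sigma> (face q j x)))"
  by (simp add: cobdry_def sg_def)

lemma face_face:
  assumes "j < l" "l \<le> Suc q"
  shows "face q j (face (Suc q) l x) = face q (l - 1) (face (Suc q) j x)"
  using assms by (auto simp: face_def fun_eq_iff)

lemma cobdry_cobdry:
  fixes F :: "(nat \<Rightarrow> 'g) \<Rightarrow> 'a::ab_group_add"
  shows "cobdry (Suc q) (cobdry q F) x = 0"
proof -
  define t where "t p = sg (Suc q - fst p + (q - snd p)) (F (face q (snd p) (face (Suc q) (fst p) x)))" for p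
  define A where "A = {p. snd p < fst p \<and> fst p \<le> Suc q}"
  define B where "B = {p. fst p \<le> snd p \<and> snd p \<le> q}"
  have fin: "finite A" "finite B"
    by (rule finite_subset[of _ "{..Suc q} \<times> {..Suc q}"]; force simp: A_def B_def)+
  have "cobdry (Suc q) (cobdry q F) x = (\<Sum>p\<in>{..Suc q} \<times> {..q}. t p)"
    unfolding cobdry_sg sg_sum sg_sg t_def by (simp only: sum.cartesian_product split_def)
  also have "{..Suc q} \<times> {..q} = A \<union> B" by (auto simp: A_def B_def)
  also have "sum t (A \<union> B) = sum t A + sum t B" using fin by (intro sum.union_disjoint) (auto simp: A_def B_def)
  also have "sum t A = (\<Sum>p\<in>B. t (Suc (snd p), fst p))"
    by (rule sum.reindex_bij_witness[of _ "\<lambda>p. (Suc (snd p), fst p)" "\<lambda>p. (snd p, fst p - 1)"])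
       (auto simp: A_def B_def)
  also have "\<dots> = (\<Sum>p\<in>B. - t p)"
  proof (rule sum.cong[OF refl])
    fix p assume "p \<in> B"
    then have p: "fst p \<le> snd p" "snd p \<le> q" by (auto simp: B_def)
    have "face q (fst p) (face (Suc q) (Suc (snd p)) x) = face q (snd p) (face (Suc q) (fst p) x)"
      using face_face[of "fst p" "Suc (snd p)" q x] p by simp
    moreover have "Suc q - fst p + (q - snd p) = Suc (q - snd p + (q - fst p))" using p by simp
    ultimately show "t (Suc (snd p), fst p) = - t p" unfolding t_def by (simp add: sg_Suc add.commute)
  qed
  finally show ?thesis by (simp add: sum_negf)
qed

lemma cobdry_commute:
  fixes S :: "(nat \<Rightarrow> 'g) \<Rightarrow> (nat \<Rightarrow> 'h) \<Rightarrow> 'a::ab_group_add"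
  shows "cobdry k (\<lambda>y. cobdry a (\<lambda>x. S x y) x) y = cobdry a (\<lambda>x. cobdry k (S x) y) x"
  unfolding cobdry_sg sg_sum sg_sg by (subst sum.swap) (simp add: add.commute)

lemma cobdry_sg_out: "cobdry k (\<lambda>y. sg n (F y)) y = sg n (cobdry k F y)"
  unfolding cobdry_sg sg_sum sg_sg by (simp add: add.commute)

lemma face_continuous:
  fixes A :: "(nat \<Rightarrow> 'g::topological_space) set"
  shows "continuous_on A (face q j)"
proof (rule continuous_on_coordinatewise_then_product)
  fix k
  have "continuous_on A (\<lambda>x. x l)" for l
    by (rule continuous_on_subset[OF continuous_on_product_coordinates]) simp
  then show "continuous_on A (\<lambda>x. face q j x k)"
    unfolding face_def restrict_def by (cases "k < q"; cases "k < j") simp_all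
qed

section \<open>Null sets under inversion and right translation\<close>

context haar_prob begin

lemma AE_nu_left:
  assumes g: "g \<in> G" and ae: "AE x in \<nu>. R x"
  shows "AE x in \<nu>. R (m g x)"
proof -
  have "AE y in P (Suc 0). R (y 0)"
    unfolding tmeas_def by (rule AE_PiM_component[of "{..<Suc 0}" "\<lambda>_. \<nu>" 0 R]) (auto intro: prob_nu ae)
  from AE_sh[OF g this] have "AE y in P (Suc 0). R (sh g (Suc 0) y 0)" .
  from AE_snoc[OF this] have "AE v in \<nu>. AE y in P 0. R (m g v)" by (simp add: gshift_def)
  then show ?thesis by (simp add: P.AE_const)
qed

lemma AE_nu_ex: "AE x in \<nu>. R x \<Longrightarrow> \<exists>x\<in>G. R x"
proof (rule ccontr)
  assume ae: "AE x in \<nu>. R x" and no: "\<not> (\<exists>x\<in>G. R x)"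
  have "AE x in \<nu>. False" using ae AE_space by eventually_elim (use no in auto)
  then show False by (simp add: nu.AE_const)
qed

text \<open>A Fubini argument in place of the modular function: for almost all pairs
  \<open>y\<close>, \<open>x\<close> the product \<open>m (i y) x\<close> avoids the exceptional
  set, by left translation in \<open>x\<close>. For one good \<open>x\<close>, replacing
  \<open>y\<close> by \<open>m x y\<close> turns this product into \<open>i y\<close>.\<close>

lemma AE_nu_inv:
  assumes ae: "AE x in \<nu>. R x"
  shows "AE x in \<nu>. R (i x)"
proof -
  interpret PN: pair_prob_space \<nu> \<nu> by standard
  obtain E where E: "{x \<in> space \<nu>. \<not> R x} \<subseteq> E" "emeasure \<nu> E = 0" "E \<in> sets \<nu>"
    using AE_E[OF ae] .
  have E0: "AE x in \<nu>. x \<notin> E" by (rule AE_I[of _ _ E]) (use E in auto)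
  have "AE y in \<nu>. AE x in \<nu>. m (i y) x \<notin> E"
    using AE_space by eventually_elim (intro AE_nu_left E0 i_in, simp)
  moreover have "{p \<in> space (\<nu> \<Otimes>\<^sub>M \<nu>). m (i (fst p)) (snd p) \<notin> E} \<in> sets (\<nu> \<Otimes>\<^sub>M \<nu>)"
  proof -
    have f: "fst \<in> measurable (\<nu> \<Otimes>\<^sub>M \<nu>) N" "snd \<in> measurable (\<nu> \<Otimes>\<^sub>M \<nu>) N"
      using measurable_fst[of \<nu> \<nu>] measurable_snd[of \<nu> \<nu>]
      by (simp_all add: measurable_cong_sets[OF refl sets_nu])
    have "(\<lambda>p. m (i (fst p)) (snd p)) \<in> measurable (\<nu> \<Otimes>\<^sub>M \<nu>) N"
      by (intro m_measurable measurable_compose[OF f(1) i_measurable] f)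
    from measurable_sets[OF this, of "G - E"] sets.compl_sets[OF E(3)]
    have "(\<lambda>p. m (i (fst p)) (snd p)) -` (G - E) \<inter> space (\<nu> \<Otimes>\<^sub>M \<nu>) \<in> sets (\<nu> \<Otimes>\<^sub>M \<nu>)"
      by (simp add: sets_nu)
    also have "(\<lambda>p. m (i (fst p)) (snd p)) -` (G - E) \<inter> space (\<nu> \<Otimes>\<^sub>M \<nu>)
      = {p \<in> space (\<nu> \<Otimes>\<^sub>M \<nu>). m (i (fst p)) (snd p) \<notin> E}" by (auto simp: space_pair_measure)
    finally show ?thesis .
  qed
  ultimately have "AE x in \<nu>. AE y in \<nu>. m (i y) x \<notin> E"
    using PN.AE_commute[of "\<lambda>y x. m (i y) x \<notin> E"] by simp
  from AE_nu_ex[OF this] obtain x where x: "x \<in> G" "AE y in \<nu>. m (i y) x \<notin> E" by blast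
  have "AE y in \<nu>. m (i (m x y)) x \<notin> E" by (rule AE_nu_left[OF x])
  then show ?thesis using AE_space
  proof eventually_elim
    case (elim y)
    then have "m (i (m x y)) x = i y" using x(1) by (simp add: i_m m_assoc)
    with elim show "R (i y)" using E(1) by auto
  qed
qed

text \<open>Right translation is left translation conjugated by inversion, and both of these
  preserve null sets.\<close>

lemma AE_nu_right:
  assumes h: "h \<in> G" and ae: "AE x in \<nu>. R x"
  shows "AE x in \<nu>. R (m x h)"
proof -
  have "AE x in \<nu>. R (i (m (i h) (i x)))"
    by (rule AE_nu_inv[OF AE_nu_left[OF i_in[OF h] AE_nu_inv[OF ae]]])
  then show ?thesis using AE_space by eventually_elim (use h in \<open>simp add: i_m\<close>)
qed

text \<open>Evaluate the equivariance relation at \<open>g = w\<^sub>0 c\<close> for a generic \<open>c\<close>: the resulting function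
  \<open>g \<cdot> f (g\<^sup>-\<^sup>1 w)\<close> is strictly equivariant in \<open>w\<close>.\<close>

lemma strictify:
  fixes f :: "(nat \<Rightarrow> 'g) \<Rightarrow> 'a"
  assumes q: "0 < q" and f: "eq_cochain m i G act \<mu> q f"
  shows "\<exists>f'. f' \<in> measurable (tmeas N q) (count_space UNIV) \<and>
    (\<forall>g\<in>G. \<forall>x\<in>T q. f' (sh g q x) = act g (f' x)) \<and> (AE x in P q. f' x = f x)"
proof -
  interpret PN: pair_prob_space \<nu> "P q" by standard
  have fm: "f \<in> measurable (tmeas N q) (count_space UNIV)"
    using f by (simp add: eq_cochain_def measurable_cong_sets[OF sets_tmu refl])
  have fe: "AE w in P q. act g (f (sh (i g) q w)) = f w" if "g \<in> G" for g
    using f that by (simp add: eq_cochain_def AE_P_iff)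
  have "AE g in \<nu>. AE w in P q. act g (f (sh (i g) q w)) = f w"
    using AE_space by eventually_elim (simp add: fe)
  have g1: "fst \<in> measurable (\<nu> \<Otimes>\<^sub>M P q) N" and g2: "snd \<in> measurable (\<nu> \<Otimes>\<^sub>M P q) (tmeas N q)"
    using measurable_fst[of \<nu> "P q"] measurable_snd[of \<nu> "P q"]
    by (simp_all add: measurable_cong_sets[OF refl sets_nu] measurable_cong_sets[OF refl sets_P])
  have key: "{p \<in> space (\<nu> \<Otimes>\<^sub>M P q). act (h p) (f (sh (i (h p)) q (snd p))) = f (snd p)} \<in> sets (\<nu> \<Otimes>\<^sub>M P q)"
    if h: "h \<in> measurable (\<nu> \<Otimes>\<^sub>M P q) N" for h
  proof -
    have 1: "(\<lambda>p. act (h p) (f (sh (i (h p)) q (snd p)))) \<in> measurable (\<nu> \<Otimes>\<^sub>M P q) (count_space UNIV)"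
      by (intro act_measurable h measurable_compose[OF sh_measurable fm] measurable_compose[OF h i_measurable] g2)
    have "Measurable.pred (\<nu> \<Otimes>\<^sub>M P q) (\<lambda>p. act (h p) (f (sh (i (h p)) q (snd p))) = f (snd p))"
      by (rule count_measurable2[OF 1 measurable_compose[OF g2 fm]])
    then show ?thesis by (simp add: pred_def)
  qed
  have z: "(\<lambda>w. w 0) \<in> measurable (tmeas N q) N"
    unfolding tmeas_def using q by (intro measurable_component_singleton) auto
  have "AE w in P q. AE g in \<nu>. act g (f (sh (i g) q w)) = f w"
    using PN.AE_commute[of "\<lambda>g w. act g (f (sh (i g) q w)) = f w"] key[OF g1]
      \<open>AE g in \<nu>. AE w in P q. act g (f (sh (i g) q w)) = f w\<close> by simp
  \<comment> \<open>For fixed \<open>w\<close> the substitution of \<open>m (w 0) c\<close> for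
    \<open>g\<close> is a left translation, so it preserves the null set of bad group
    elements.\<close>
  then have "AE w in P q. AE c in \<nu>. act (m (w 0) c) (f (sh (i (m (w 0) c)) q w)) = f w"
    using AE_space
  proof eventually_elim
    case (elim w)
    then have "w 0 \<in> G" using q by (auto intro: tuples_D)
    from AE_nu_left[OF this elim(1)] show ?case .
  qed
  moreover have "{p \<in> space (\<nu> \<Otimes>\<^sub>M P q). act (m (snd p 0) (fst p)) (f (sh (i (m (snd p 0) (fst p))) q (snd p))) = f (snd p)}
      \<in> sets (\<nu> \<Otimes>\<^sub>M P q)"
    by (rule key) (intro m_measurable g1 measurable_compose[OF g2 z])
  ultimately have "AE c in \<nu>. AE w in P q. act (m (w 0) c) (f (sh (i (m (w 0) c)) q w)) = f w"
    using PN.AE_commute[of "\<lambda>c w. act (m (w 0) c) (f (sh (i (m (w 0) c)) q w)) = f w"] by simp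
  from AE_nu_ex[OF this] obtain c where c: "c \<in> G"
    "AE w in P q. act (m (w 0) c) (f (sh (i (m (w 0) c)) q w)) = f w" by blast
  define f' where "f' w = act (m (w 0) c) (f (sh (i (m (w 0) c)) q w))" for w
  have m1: "(\<lambda>w. m (w 0) c) \<in> measurable (tmeas N q) N" using c by (intro m_measurable z) auto
  have f'm: "f' \<in> measurable (tmeas N q) (count_space UNIV)"
    unfolding f'_def
    by (intro act_measurable m1 measurable_compose[OF sh_measurable fm] measurable_compose[OF m1 i_measurable]) simp
  have "f' (sh g q x) = act g (f' x)" if g: "g \<in> G" and x: "x \<in> T q" for g x
  proof -
    have x0: "x 0 \<in> G" using x q by (rule tuples_D)
    have s0: "sh g q x 0 = m g (x 0)" using q by (simp add: gshift_def)
    \<comment> \<open>Translation by \<open>g\<close> multiplies \<open>m (x 0) c\<close> by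
      \<open>g\<close> on the left as well, so the tuple at which \<open>f\<close> is evaluated does
      not change.\<close>
    have "sh (i (m (m g (x 0)) c)) q (sh g q x) = sh (i (m (x 0) c)) q x"
      using g x x0 c(1) by (simp add: sh_sh i_m m_assoc)
    then show ?thesis unfolding f'_def s0 using g x0 c(1) by (simp add: act_m m_assoc)
  qed
  moreover have "AE x in P q. f' x = f x" using c(2) by (simp add: f'_def)
  ultimately show ?thesis using f'm by blast
qed

end

section \<open>The staircase from measurable to tame variables\<close>

context haar_base begin

lemma sat_face:
  assumes "b < a" "c < a"
  shows "sat (face a j x) (b, c, B) = sat x (if b < j then b else Suc b, if c < j then c else Suc c, B)"
  using assms by (simp add: sat_def face_def)

text \<open>A test on a face is a test on the whole tuple with shifted indices. Off the union of
  \<open>a + 1\<close> exceptional sets, one for each face and of measure at most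
  \<open>eps / (a + 1)\<close>, all terms of the coboundary agree.\<close>

lemma tame_cobdry:
  assumes S: "tame a k S" and Sm: "\<And>x. x \<in> T a \<Longrightarrow> S x \<in> measurable (P k) (count_space UNIV)"
  shows "tame (Suc a) k (\<lambda>x y. sg n (cobdry a (\<lambda>x'. S x' y) x))"
  unfolding tame_def
proof (intro ballI allI impI)
  fix x0 and eps :: real assume x0: "x0 \<in> T (Suc a)" and eps: "0 < eps"
  have e': "0 < eps / (real a + 1)" using eps by simp
  have "\<forall>j. \<exists>UF. open (fst UF) \<and> face a j x0 \<in> fst UF \<and> finite (snd UF) \<and> snd UF \<subseteq> tests a \<and>
     (\<forall>x\<in>T a \<inter> fst UF. \<forall>x'\<in>T a \<inter> fst UF. (\<forall>t\<in>snd UF. sat x t = sat x' t) \<longrightarrow>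
        measure (P k) {y \<in> T k. S x y \<noteq> S x' y} \<le> eps / (real a + 1))"
    using S[unfolded tame_def, THEN bspec, OF face_in[OF x0], THEN spec, THEN mp, OF e'] by simp
  from choice[OF this] obtain UF where UF: "\<forall>j. open (fst (UF j)) \<and> face a j x0 \<in> fst (UF j) \<and> finite (snd (UF j)) \<and> snd (UF j) \<subseteq> tests a \<and>
     (\<forall>x\<in>T a \<inter> fst (UF j). \<forall>x'\<in>T a \<inter> fst (UF j). (\<forall>t\<in>snd (UF j). sat x t = sat x' t) \<longrightarrow>
        measure (P k) {y \<in> T k. S x y \<noteq> S x' y} \<le> eps / (real a + 1))" ..
  define U where "U = (\<Inter>j\<in>{..a}. face a j -` fst (UF j))"
  define d where "d j t = (case t of (b, c, B) \<Rightarrow> (if b < j then b else Suc b, if c < j then c else Suc c, B :: 'g set))"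
    for j :: nat and t
  define F where "F = (\<Union>j\<in>{..a}. d j ` snd (UF j))"
  have "open (face a j -` fst (UF j))" for j
    using UF by (intro open_vimage face_continuous) blast
  then have U: "open U" unfolding U_def by (intro open_INT) auto
  have xU: "x0 \<in> U" using UF by (simp add: U_def)
  have F1: "finite F" unfolding F_def using UF by simp
  have F2: "F \<subseteq> tests (Suc a)"
  proof
    fix t assume "t \<in> F"
    then obtain j s where s: "s \<in> snd (UF j)" "t = d j s" by (auto simp: F_def)
    moreover have "snd (UF j) \<subseteq> tests a" using UF by blast
    ultimately have "s \<in> tests a" by blast
    then show "t \<in> tests (Suc a)" unfolding s(2) by (cases s) (auto simp: tests_def d_def)
  qed
  show "\<exists>U F. open U \<and> x0 \<in> U \<and> finite F \<and> F \<subseteq> tests (Suc a) \<and>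
     (\<forall>x\<in>T (Suc a) \<inter> U. \<forall>x'\<in>T (Suc a) \<inter> U. (\<forall>t\<in>F. sat x t = sat x' t) \<longrightarrow>
        measure (P k) {y \<in> T k. sg n (cobdry a (\<lambda>x'. S x' y) x) \<noteq> sg n (cobdry a (\<lambda>x'. S x' y) x')} \<le> eps)"
  proof (rule exI[of _ U], rule exI[of _ F], intro conjI U xU F1 F2 ballI impI)
    fix x x' assume x: "x \<in> T (Suc a) \<inter> U" "x' \<in> T (Suc a) \<inter> U" and agree: "\<forall>t\<in>F. sat x t = sat x' t"
    let ?D = "\<lambda>j. {y \<in> T k. S (face a j x) y \<noteq> S (face a j x') y}"
    have DS: "?D j \<in> sets (P k)" for j using x by (intro neq_sets Sm) auto
    have D: "measure (P k) (?D j) \<le> eps / (real a + 1)" if j: "j \<le> a" for j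
    proof -
      have "sat (face a j x) t = sat (face a j x') t" if t: "t \<in> snd (UF j)" for t
      proof -
        have "snd (UF j) \<subseteq> tests a" using UF by blast
        with t have "t \<in> tests a" by blast
        then obtain b c B where bc: "t = (b, c, B)" "b < a" "c < a" by (auto simp: tests_def)
        have "d j t \<in> F" using t j by (auto simp: F_def)
        then have "sat x (d j t) = sat x' (d j t)" using agree by blast
        then show ?thesis by (simp add: bc sat_face d_def)
      qed
      moreover have "face a j x \<in> T a \<inter> fst (UF j)" "face a j x' \<in> T a \<inter> fst (UF j)"
        using x j by (auto simp: U_def)
      ultimately show ?thesis using UF by blast
    qed
    have "measure (P k) {y \<in> T k. sg n (cobdry a (\<lambda>x'. S x' y) x) \<noteq> sg n (cobdry a (\<lambda>x'. S x' y) x')}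
        \<le> measure (P k) (\<Union>j\<in>{..a}. ?D j)"
    proof (intro P.finite_measure_mono sets.finite_UN)
      show "{y \<in> T k. sg n (cobdry a (\<lambda>x'. S x' y) x) \<noteq> sg n (cobdry a (\<lambda>x'. S x' y) x')} \<subseteq> (\<Union>j\<in>{..a}. ?D j)"
      proof (rule subsetI, rule ccontr)
        fix y assume y: "y \<in> {y \<in> T k. sg n (cobdry a (\<lambda>x'. S x' y) x) \<noteq> sg n (cobdry a (\<lambda>x'. S x' y) x')}"
          and "y \<notin> (\<Union>j\<in>{..a}. ?D j)"
        then have "S (face a j x) y = S (face a j x') y" if "j \<le> a" for j using that by auto
        then have "cobdry a (\<lambda>x'. S x' y) x = cobdry a (\<lambda>x'. S x' y) x'"
          unfolding cobdry_sg by (intro sum.cong) auto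
        with y show False by simp
      qed
    qed (use DS in auto)
    also have "\<dots> \<le> (\<Sum>j\<le>a. measure (P k) (?D j))" using DS by (intro measure_UNION_le) auto
    also have "\<dots> \<le> (\<Sum>j\<le>a. eps / (real a + 1))" by (intro sum_mono D) simp
    also have "\<dots> = eps" by (simp add: field_simps)
    finally show "measure (P k) {y \<in> T k. sg n (cobdry a (\<lambda>x'. S x' y) x) \<noteq> sg n (cobdry a (\<lambda>x'. S x' y) x')} \<le> eps" .
  qed
qed

lemma jmeas_cobdry:
  assumes "jmeas a k S"
  shows "jmeas (Suc a) k (\<lambda>x y. sg n (cobdry a (\<lambda>x'. S x' y) x))"
proof -
  let ?M = "tmeas N (Suc a) \<Otimes>\<^sub>M tmeas N k"
  have 1: "(\<lambda>p. S (face a j (fst p)) (snd p)) \<in> measurable ?M (count_space UNIV)" for j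
    by (rule jmeas_compose[OF assms measurable_compose[OF measurable_fst face_measurable] measurable_snd])
  have "(\<lambda>p. sg (n + (a - j)) (S (face a j (fst p)) (snd p))) \<in> measurable ?M (count_space UNIV)" for j
    by (rule measurable_compose[OF 1]) simp
  then show ?thesis unfolding jmeas_def cobdry_sg sg_sum sg_sg by (intro sum_count_measurable)
qed

lemma equiv2_cobdry:
  assumes "equiv2 a k S"
  shows "equiv2 (Suc a) k (\<lambda>x y. sg n (cobdry a (\<lambda>x'. S x' y) x))"
  unfolding equiv2_def
proof (intro ballI)
  fix g x y assume g: "g \<in> G" and x: "x \<in> T (Suc a)" and y: "y \<in> T k"
  have sga: "sg l (act g v) = act g (sg l v)" for l v using g by (simp add: sg_def act_minus)
  have "S (face a j (sh g (Suc a) x)) (sh g k y) = act g (S (face a j x) y)" for j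
    using assms[unfolded equiv2_def] g x y by (simp add: face_sh)
  then show "sg n (cobdry a (\<lambda>x'. S x' (sh g k y)) (sh g (Suc a) x)) = act g (sg n (cobdry a (\<lambda>x'. S x' y) x))"
    unfolding cobdry_sg sg_sum sg_sg using g by (simp add: act_sum sga)
qed

text \<open>The \<open>a\<close>-th column of a staircase in the double complex, with \<open>a\<close> tame and \<open>k\<close> measurable
  variables.\<close>

definition stage :: "nat \<Rightarrow> nat \<Rightarrow> ((nat \<Rightarrow> 'g) \<Rightarrow> (nat \<Rightarrow> 'g) \<Rightarrow> 'a) \<Rightarrow> bool" where
  "stage a k S \<longleftrightarrow> jmeas a k S \<and> equiv2 a k S \<and> tame a k S \<and>
    (\<forall>x\<in>T (Suc a). AE y in P (Suc k). cobdry a (\<lambda>x'. cobdry k (S x') y) x = 0)"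

text \<open>The last condition of \<open>stage\<close> says that the coboundary of \<open>S\<close>
  in \<open>x\<close> is a cocycle in \<open>y\<close>, so \<open>lifting\<close> yields a primitive
  \<open>S'\<close>. Its coboundary in \<open>y\<close> is up to sign a coboundary in
  \<open>x\<close>, hence killed by the next coboundary in \<open>x\<close>, which is the condition
  for the next column. The sign makes the columns fit together in
  \<open>glue_equation\<close>.\<close>

lemma stage_step:
  assumes S: "stage a (Suc k) S"
  shows "\<exists>S'. stage (Suc a) k S' \<and>
    (\<forall>x\<in>T (Suc a). AE y in P (Suc k). cobdry k (S' x) y = sg k (cobdry a (\<lambda>x'. S x' y) x))"
proof -
  define Z where "Z x y = sg k (cobdry a (\<lambda>x'. S x' y) x)" for x y
  have S': "jmeas a (Suc k) S" "equiv2 a (Suc k) S" "tame a (Suc k) S"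
    "\<And>x. x \<in> T (Suc a) \<Longrightarrow> AE y in P (Suc (Suc k)). cobdry a (\<lambda>x'. cobdry (Suc k) (S x') y) x = 0"
    using S by (auto simp: stage_def)
  have "jmeas (Suc a) (Suc k) Z" unfolding Z_def[abs_def] by (rule jmeas_cobdry[OF S'(1)])
  moreover have "equiv2 (Suc a) (Suc k) Z" unfolding Z_def[abs_def] by (rule equiv2_cobdry[OF S'(2)])
  moreover have "tame (Suc a) (Suc k) Z" unfolding Z_def[abs_def]
    by (rule tame_cobdry[OF S'(3)]) (rule jmeas_slice[OF S'(1)])
  moreover have "AE y in P (Suc (Suc k)). cobdry (Suc k) (Z x) y = 0" if x: "x \<in> T (Suc a)" for x
  proof -
    have "cobdry (Suc k) (Z x) y = sg k (cobdry a (\<lambda>x'. cobdry (Suc k) (S x') y) x)" for y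
      unfolding Z_def[abs_def] cobdry_sg_out by (rule arg_cong[OF cobdry_commute])
    then show ?thesis using S'(4)[OF x] by auto
  qed
  ultimately obtain S1 where S1: "jmeas (Suc a) k S1" "equiv2 (Suc a) k S1" "tame (Suc a) k S1"
    "\<forall>x\<in>T (Suc a). AE y in P (Suc k). cobdry k (S1 x) y = Z x y"
    using lifting[of "Suc a" k Z] by blast
  have "AE y in P (Suc k). cobdry (Suc a) (\<lambda>x'. cobdry k (S1 x') y) x = 0" if x: "x \<in> T (Suc (Suc a))" for x
  proof -
    have "AE y in P (Suc k). \<forall>j\<in>{..Suc a}. cobdry k (S1 (face (Suc a) j x)) y = Z (face (Suc a) j x) y"
      using S1(4) x by (subst AE_finite_all) auto
    then show ?thesis
    proof eventually_elim
      case (elim y)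
      have "cobdry (Suc a) (\<lambda>x'. cobdry k (S1 x') y) x = cobdry (Suc a) (\<lambda>x'. sg k (cobdry a (\<lambda>x''. S x'' y) x')) x"
        by (rule cobdry_cong) (use elim in \<open>simp add: Z_def\<close>)
      also have "\<dots> = 0" unfolding cobdry_sg_out cobdry_cobdry by simp
      finally show ?case .
    qed
  qed
  then have "stage (Suc a) k S1" using S1 by (simp add: stage_def)
  with S1(4) show ?thesis unfolding Z_def by blast
qed

lemma stage_chain:
  fixes f :: "(nat \<Rightarrow> 'g) \<Rightarrow> 'a"
  assumes fm: "f \<in> measurable (tmeas N (Suc p)) (count_space UNIV)"
    and fe: "\<forall>g\<in>G. \<forall>x\<in>T (Suc p). f (sh g (Suc p) x) = act g (f x)"
    and fc: "AE z in P (Suc (Suc p)). cobdry (Suc p) f z = 0"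
  shows "\<exists>S. S 0 = (\<lambda>x. f) \<and> (\<forall>a\<le>Suc p. stage a (Suc p - a) (S a)) \<and>
    (\<forall>a\<le>p. \<forall>x\<in>T (Suc a). AE y in P (Suc (p - a)).
       cobdry (p - a) (S (Suc a) x) y = sg (p - a) (cobdry a (\<lambda>x'. S a x' y) x))"
proof -
  have "stage 0 (Suc p) (\<lambda>x. f)"
    unfolding stage_def
  proof (intro conjI ballI)
    show "jmeas 0 (Suc p) (\<lambda>x. f)" unfolding jmeas_def by (rule measurable_compose[OF measurable_snd fm])
    show "equiv2 0 (Suc p) (\<lambda>x. f)" using fe by (simp add: equiv2_def)
    show "tame 0 (Suc p) (\<lambda>x. f)" unfolding tame_def
      by (intro ballI allI impI, rule exI[of _ UNIV], rule exI[of _ "{}"]) simp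
    \<comment> \<open>In degree 0 the coboundary in \<open>x\<close> is the augmentation, evaluation
      at the empty tuple, so the condition reduces to the cocycle equation of
      \<open>f\<close>.\<close>
    fix x show "AE y in P (Suc (Suc p)). cobdry 0 (\<lambda>x'. cobdry (Suc p) f y) x = 0"
      using fc by eventually_elim (simp add: cobdry_def[of 0])
  qed
  then have base: "\<exists>S. (0 \<le> Suc p \<longrightarrow> stage 0 (Suc p - 0) S) \<and> (0 = (0::nat) \<longrightarrow> S = (\<lambda>x. f))" by auto
  have step: "\<exists>S'. ((Suc n \<le> Suc p \<longrightarrow> stage (Suc n) (Suc p - Suc n) S') \<and> (Suc n = 0 \<longrightarrow> S' = (\<lambda>x. f))) \<and>
      (n \<le> p \<longrightarrow> (\<forall>x\<in>T (Suc n). AE y in P (Suc (p - n)).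
        cobdry (p - n) (S' x) y = sg (p - n) (cobdry n (\<lambda>x'. S x' y) x)))"
    if "(n \<le> Suc p \<longrightarrow> stage n (Suc p - n) S) \<and> (n = 0 \<longrightarrow> S = (\<lambda>x. f))" for n S
  proof (cases "n \<le> p")
    case True
    then have "stage n (Suc (p - n)) S" using that by (simp add: Suc_diff_le)
    from stage_step[OF this] show ?thesis by auto
  qed auto
  from dependent_nat_choice[of "\<lambda>n S. (n \<le> Suc p \<longrightarrow> stage n (Suc p - n) S) \<and> (n = 0 \<longrightarrow> S = (\<lambda>x. f))"
    "\<lambda>n S S'. n \<le> p \<longrightarrow> (\<forall>x\<in>T (Suc n). AE y in P (Suc (p - n)).
        cobdry (p - n) (S' x) y = sg (p - n) (cobdry n (\<lambda>x'. S x' y) x))", OF base step]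
  obtain S where S: "\<forall>n. ((n \<le> Suc p \<longrightarrow> stage n (Suc p - n) (S n)) \<and> (n = 0 \<longrightarrow> S n = (\<lambda>x. f))) \<and>
     (n \<le> p \<longrightarrow> (\<forall>x\<in>T (Suc n). AE y in P (Suc (p - n)).
        cobdry (p - n) (S (Suc n) x) y = sg (p - n) (cobdry n (\<lambda>x'. S n x' y) x)))" by blast
  then show ?thesis by (intro exI[of _ S]) auto
qed

end

section \<open>The prism homotopy\<close>

lemma sg_combine: "sg n a + (- sg n b + (sg n c + sg n d)) = sg n (a + d + (c - b))"
  by (cases "even n") (simp_all add: sg_def algebra_simps)

lemma sg_eq_0 [simp]: "sg n v = 0 \<longleftrightarrow> v = 0"
  by (simp add: sg_def)

text \<open>The prism over \<open>x\<close> and its right translate by \<open>h\<close>, with the first variables of each simplex on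
  the tame side.\<close>

lemma prism_identity:
  fixes D :: "nat \<Rightarrow> (nat \<Rightarrow> 'g) \<Rightarrow> 'a::ab_group_add" and m :: "'g \<Rightarrow> 'g \<Rightarrow> 'g" and h :: 'g and p :: nat
  defines "\<Psi> \<equiv> \<lambda>j z. restrict (\<lambda>k. if k \<le> j then z k else m (z (k - 1)) h) {..<Suc p}"
    and "\<Phi> \<equiv> \<lambda>a x. restrict (\<lambda>k. if k \<le> a then x k else m (x (k - 1)) h) {..<Suc (Suc p)}"
    and "\<Theta> \<equiv> \<lambda>a x. restrict (\<lambda>k. if k < a then x k else m (x k) h) {..<Suc p}"
  assumes E: "\<And>a. a \<le> p \<Longrightarrow>
    (\<Sum>j\<le>Suc p. sg (Suc p - j) (D (if j \<le> a then a else Suc a) (face (Suc p) j (\<Phi> a x)))) = 0"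
  shows "D (Suc p) (\<Theta> (Suc p) x) - D 0 (\<Theta> 0 x) = cobdry p (\<lambda>z. - (\<Sum>j<p. sg (p + j) (D (Suc j) (\<Psi> j z)))) x"
proof -
  \<comment> \<open>Here \<open>\<Phi> a x\<close> is
    \<open>(x_0, ..., x_a, x_a h, ..., x_p h)\<close>, \<open>\<Psi> j z\<close> doubles the vertex
    \<open>z_j\<close> in the same way, and \<open>\<Theta> a x\<close> multiplies by
    \<open>h\<close> from index \<open>a\<close> on. The faces of \<open>\<Phi> a x\<close> other
    than \<open>a\<close> and \<open>Suc a\<close> are prisms over faces of \<open>x\<close>;
    \<open>c j l\<close> is the contribution of face \<open>l\<close> to the \<open>j\<close>-th
    prism.\<close>
  define c where "c j l = sg (l + j) (D (Suc j) (\<Psi> j (face p l x)))" for j l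
  define L where "L a = (\<Sum>l<a. c (a - 1) l)" for a
  define R where "R a = (\<Sum>l\<in>{a<..p}. c a l)" for a
  have f1: "face (Suc p) j (\<Phi> a x) = \<Psi> (a - 1) (face p j x)" if "j < a" "a \<le> p" for a j
    using that unfolding \<Phi>_def \<Psi>_def by (auto simp: face_def fun_eq_iff)
  have f2: "face (Suc p) a (\<Phi> a x) = \<Theta> a x" if "a \<le> p" for a
    using that unfolding \<Phi>_def \<Theta>_def by (auto simp: face_def fun_eq_iff)
  have f3: "face (Suc p) (Suc a) (\<Phi> a x) = \<Theta> (Suc a) x" if "a \<le> p" for a
    using that unfolding \<Phi>_def \<Theta>_def by (auto simp: face_def fun_eq_iff)
  have f4: "face (Suc p) (Suc l) (\<Phi> a x) = \<Psi> a (face p l x)" if "a < l" "l \<le> p" for a l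
    using that unfolding \<Phi>_def \<Psi>_def by (auto simp: face_def fun_eq_iff)
  have step: "D (Suc a) (\<Theta> (Suc a) x) - D a (\<Theta> a x) = - (L a + R a)" if a: "a \<le> p" for a
  proof -
    let ?t = "\<lambda>j. sg (Suc p - j) (D (if j \<le> a then a else Suc a) (face (Suc p) j (\<Phi> a x)))"
    have "{..Suc p} = {..<a} \<union> ({a} \<union> ({Suc a} \<union> Suc ` {a<..p}))"
    proof (intro set_eqI iffI)
      fix j assume "j \<in> {..Suc p}"
      then show "j \<in> {..<a} \<union> ({a} \<union> ({Suc a} \<union> Suc ` {a<..p}))"
        by (cases j) (auto simp: image_iff)
    qed (use a in auto)
    then have "0 = sum ?t ({..<a} \<union> ({a} \<union> ({Suc a} \<union> Suc ` {a<..p})))" using E[OF a] by simp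
    also have "\<dots> = sum ?t {..<a} + (?t a + (?t (Suc a) + sum ?t (Suc ` {a<..p})))"
      by (subst sum.union_disjoint, simp, simp, force)+ simp
    also have "sum ?t {..<a} = sg (p - a) (L a)"
    proof -
      have "?t j = sg (p - a) (c (a - 1) j)" if "j \<in> {..<a}" for j
        using that a f1[of j a] by (auto simp: c_def sg_sg intro!: sg_cong)
      then show ?thesis unfolding L_def sg_sum by (rule sum.cong[OF refl])
    qed
    also have "?t a = - sg (p - a) (D a (\<Theta> a x))"
      using a f2[OF a] by (simp add: Suc_diff_le sg_Suc)
    also have "?t (Suc a) = sg (p - a) (D (Suc a) (\<Theta> (Suc a) x))"
      using a f3[OF a] by simp
    also have "sum ?t (Suc ` {a<..p}) = sg (p - a) (R a)"
    proof -
      have "sum ?t (Suc ` {a<..p}) = (\<Sum>l\<in>{a<..p}. ?t (Suc l))" by (subst sum.reindex) auto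
      also have "\<dots> = (\<Sum>l\<in>{a<..p}. sg (p - a) (c a l))"
      proof (rule sum.cong[OF refl])
        fix l assume "l \<in> {a<..p}"
        then show "?t (Suc l) = sg (p - a) (c a l)"
          using f4[of a l] by (auto simp: c_def sg_sg intro!: sg_cong)
      qed
      finally show ?thesis by (simp add: R_def sg_sum)
    qed
    finally have "sg (p - a) (L a + R a + (D (Suc a) (\<Theta> (Suc a) x) - D a (\<Theta> a x))) = 0"
      unfolding sg_combine by (rule sym)
    then have "L a + R a + (D (Suc a) (\<Theta> (Suc a) x) - D a (\<Theta> a x)) = 0" by simp
    then show ?thesis by (simp only: add_eq_0_iff)
  qed
  have "D (Suc p) (\<Theta> (Suc p) x) - D 0 (\<Theta> 0 x) = (\<Sum>a<Suc p. D (Suc a) (\<Theta> (Suc a) x) - D a (\<Theta> a x))"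
    by (rule sum_lessThan_telescope[symmetric])
  also have "\<dots> = (\<Sum>a<Suc p. - (L a + R a))" by (intro sum.cong step) auto
  also have "\<dots> = - ((\<Sum>a<Suc p. L a) + (\<Sum>a<Suc p. R a))" by (simp only: sum_negf sum.distrib)
  \<comment> \<open>The faces with \<open>l \<le> j\<close> come from
    \<open>\<Phi> (Suc j) x\<close> and those with \<open>l > j\<close> from
    \<open>\<Phi> j x\<close>; together they are all faces of \<open>x\<close>. The end terms
    \<open>L 0\<close> and \<open>R p\<close> are empty sums.\<close>
  also have "(\<Sum>a<Suc p. L a) = (\<Sum>j<p. \<Sum>l\<le>j. c j l)"
    by (subst sum.lessThan_Suc_shift) (simp add: L_def lessThan_Suc_atMost)
  also have "(\<Sum>a<Suc p. R a) = (\<Sum>j<p. \<Sum>l\<in>{j<..p}. c j l)" by (simp add: R_def)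
  also have "(\<Sum>j<p. \<Sum>l\<le>j. c j l) + (\<Sum>j<p. \<Sum>l\<in>{j<..p}. c j l) = (\<Sum>j<p. \<Sum>l\<le>p. c j l)"
  proof -
    have "(\<Sum>l\<le>j. c j l) + (\<Sum>l\<in>{j<..p}. c j l) = (\<Sum>l\<le>p. c j l)" if "j < p" for j
    proof -
      have "{..p} = {..j} \<union> {j<..p}" using that by auto
      then show ?thesis by (simp add: sum.union_disjoint ivl_disj_int)
    qed
    then show ?thesis by (simp add: sum.distrib[symmetric])
  qed
  also have "- (\<Sum>j<p. \<Sum>l\<le>p. c j l) = cobdry p (\<lambda>z. - (\<Sum>j<p. sg (p + j) (D (Suc j) (\<Psi> j z)))) x"
  proof -
    have "sg (p - l) (sg (p + j) v) = sg (l + j) v" if "l \<le> p" for l j and v :: 'a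
      using that by (auto simp: sg_sg intro!: sg_cong)
    then have "(\<Sum>l\<le>p. \<Sum>j<p. sg (p - l) (sg (p + j) (D (Suc j) (\<Psi> j (face p l x))))) = (\<Sum>l\<le>p. \<Sum>j<p. c j l)"
      by (intro sum.cong refl) (simp add: c_def)
    also have "\<dots> = (\<Sum>j<p. \<Sum>l\<le>p. c j l)" by (rule sum.swap)
    finally show ?thesis unfolding cobdry_minus cobdry_sg sg_sum by simp
  qed
  finally show ?thesis .
qed

section \<open>Almost-everywhere identities along a prism\<close>

context haar_prob begin

lemma AE_snoc_conv:
  assumes S: "{z \<in> T (Suc q). R z} \<in> sets (P (Suc q))" and ae: "AE v in \<nu>. AE y in P q. R (y(q := v))"
  shows "AE z in P (Suc q). R z"
proof -
  define E where "E = T (Suc q) - {z \<in> T (Suc q). R z}"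
  have E: "E \<in> sets (P (Suc q))" unfolding E_def using sets.compl_sets[OF S] by simp
  have "emeasure (P (Suc q)) E = (\<integral>\<^sup>+v. emeasure (P q) {y \<in> T q. y(q := v) \<in> E} \<partial>\<nu>)"
    by (rule emeasure_snoc[OF E])
  also have "\<dots> = (\<integral>\<^sup>+v. 0 \<partial>\<nu>)"
  proof (rule nn_integral_cong_AE)
    show "AE v in \<nu>. emeasure (P q) {y \<in> T q. y(q := v) \<in> E} = 0"
      using ae
    proof eventually_elim
      case (elim v)
      then obtain Z where Z: "{y \<in> space (P q). \<not> R (y(q := v))} \<subseteq> Z" "emeasure (P q) Z = 0" "Z \<in> sets (P q)"
        by (rule AE_E)
      have "{y \<in> T q. y(q := v) \<in> E} \<subseteq> Z" using Z(1) by (auto simp: E_def)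
      from emeasure_mono[OF this Z(3)] Z(2) show ?case by simp
    qed
  qed
  finally have "emeasure (P (Suc q)) E = 0" by simp
  then show ?thesis using E by (intro AE_I[of _ _ E]) (auto simp: E_def)
qed

lemma AE_rmul:
  assumes h: "h \<in> G" and ae: "AE x in P q. R x"
  shows "AE x in P q. R (restrict (\<lambda>k. if K k then m (x k) h else x k) {..<q})"
proof -
  let ?\<rho> = "\<lambda>q x. restrict (\<lambda>k. if K k then m (x k) h else x k) {..<q}"
  have hm: "(\<lambda>x. m x h) \<in> measurable N N" using h by (intro m_measurable) auto
  have rm: "?\<rho> q \<in> measurable (P q) (P q)" for q
  proof -
    have "?\<rho> q \<in> measurable (tmeas N q) (tmeas N q)"
      unfolding tmeas_def
    proof (rule measurable_restrict)
      fix k assume k: "k \<in> {..<q}"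
      have co: "(\<lambda>x. x k) \<in> measurable (PiM {..<q} (\<lambda>_. N)) N" by (rule measurable_component_singleton[OF k])
      show "(\<lambda>x. if K k then m (x k) h else x k) \<in> measurable (PiM {..<q} (\<lambda>_. N)) N"
        using co measurable_compose[OF co hm] by (cases "K k") auto
    qed
    then show ?thesis by (simp add: measurable_cong_sets[OF sets_P sets_P])
  qed
  \<comment> \<open>Stated for measurable \<open>E\<close>, since putting the slices back together
    by \<open>AE_snoc_conv\<close> needs a measurable set; the induction multiplies one coordinate
    at a time.\<close>
  have main: "\<forall>E. E \<in> sets (P q) \<longrightarrow> (AE x in P q. x \<notin> E) \<longrightarrow> (AE x in P q. ?\<rho> q x \<notin> E)" for q
  proof (induction q)
    case 0
    have r0: "?\<rho> 0 x = x" if "x \<in> space (P 0)" for x using that by (auto simp: tuples_def)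
    show ?case
    proof (intro allI impI)
      fix E assume "AE x in P 0. x \<notin> E"
      then show "AE x in P 0. ?\<rho> 0 x \<notin> E" using AE_space
        by eventually_elim (simp only: r0 not_False_eq_True)
    qed
  next
    case (Suc q)
    show ?case
    proof (intro allI impI)
      fix E assume E: "E \<in> sets (P (Suc q))" and ae: "AE x in P (Suc q). x \<notin> E"
      have sl: "{y \<in> T q. y(q := v) \<in> E} \<in> sets (P q)" if "v \<in> G" for v
      proof -
        have "(\<lambda>y. (v, y)) \<in> measurable (P q) (\<nu> \<Otimes>\<^sub>M P q)" using that by (intro measurable_Pair1') simp
        from measurable_sets[OF measurable_compose[OF this snoc_distr(1)] E]
        show ?thesis by (simp add: vimage_def Int_def conj_commute)
      qed
      have "AE v in \<nu>. AE y in P q. (?\<rho> q y)(q := v) \<notin> E"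
        using AE_snoc[OF ae] AE_space
      proof eventually_elim
        case (elim v)
        let ?F = "{y \<in> T q. y(q := v) \<in> E}"
        have "?F \<in> sets (P q)" using elim(2) by (intro sl) simp
        moreover have "AE y in P q. y \<notin> ?F" using elim(1) by eventually_elim auto
        ultimately have "AE y in P q. ?\<rho> q y \<notin> ?F" using Suc.IH by blast
        then show ?case using AE_space
          by eventually_elim (use measurable_space[OF rm] in auto)
      qed
      from this AE_nu_right[OF h this]
      have ae2: "AE v in \<nu>. AE y in P q. (?\<rho> q y)(q := (if K q then m v h else v)) \<notin> E"
        by (cases "K q") auto
      show "AE x in P (Suc q). ?\<rho> (Suc q) x \<notin> E"
      proof (rule AE_snoc_conv)
        have "{z \<in> T (Suc q). ?\<rho> (Suc q) z \<notin> E} = T (Suc q) - (?\<rho> (Suc q) -` E \<inter> space (P (Suc q)))" by auto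
        then show "{z \<in> T (Suc q). ?\<rho> (Suc q) z \<notin> E} \<in> sets (P (Suc q))"
          using sets.compl_sets[OF measurable_sets[OF rm E]] by simp
        have "?\<rho> (Suc q) (y(q := v)) = (?\<rho> q y)(q := (if K q then m v h else v))" for y v
          by (auto simp: restrict_def fun_eq_iff)
        then show "AE v in \<nu>. AE y in P q. ?\<rho> (Suc q) (y(q := v)) \<notin> E" using ae2 by simp
      qed
    qed
  qed
  obtain E where E: "{x \<in> space (P q). \<not> R x} \<subseteq> E" "emeasure (P q) E = 0" "E \<in> sets (P q)"
    using AE_E[OF ae] .
  have "AE x in P q. x \<notin> E" by (rule AE_I[of _ _ E]) (use E in auto)
  then have "AE x in P q. ?\<rho> q x \<notin> E" using main E(3) by blast
  then show ?thesis using AE_space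
    by eventually_elim (use E(1) measurable_space[OF rm] in blast)
qed

text \<open>For a given \<open>h\<close> the tuples in question may all lie in a null set, as the
  entries \<open>x_a\<close> and \<open>x_a h\<close> determine each other. With \<open>h\<close> as
  an additional variable the new entry is the left translate of \<open>h\<close> by
  \<open>x_a\<close>, hence generic, and Fubini gives almost every \<open>h\<close>. The later
  entries are then right translates by \<open>h\<close>, covered by \<open>AE_rmul\<close>.\<close>

lemma AE_prism:
  assumes ae: "AE w in P (Suc (Suc p)). R w" and a: "a \<le> p"
  shows "AE h in \<nu>. AE x in P (Suc p).
    R (restrict (\<lambda>k. if k \<le> a then x k else m (x (k - 1)) h) {..<Suc (Suc p)})"
proof -
  interpret PN: pair_prob_space \<nu> "P (Suc p)" by standard
  \<comment> \<open>Positions are permuted so that the new vertex, which belongs at position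
    \<open>Suc a\<close>, is the last coordinate and can be split off by
    \<open>AE_snoc\<close>.\<close>
  define f where "f k = (if k \<le> a then k else if k = Suc a then Suc p else k - 1)" for k
  define re where "re w = restrict (\<lambda>k. w (f k)) {..<Suc (Suc p)}" for w :: "nat \<Rightarrow> 'g"
  have f: "inj_on f {..<Suc (Suc p)}" "\<And>k. k < Suc (Suc p) \<Longrightarrow> f k < Suc (Suc p)"
    using a by (auto simp: f_def inj_on_def split: if_splits)
  have "AE w in P (Suc (Suc p)). R (re w)" unfolding re_def by (rule AE_reindex[OF f ae])
  then obtain E where E: "{x \<in> space (P (Suc (Suc p))). \<not> R (re x)} \<subseteq> E" "emeasure (P (Suc (Suc p))) E = 0"
    "E \<in> sets (P (Suc (Suc p)))" by (rule AE_E)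
  have E0: "AE w in P (Suc (Suc p)). w \<notin> E" by (rule AE_I[of _ _ E]) (use E in auto)
  have z: "(\<lambda>x. x a) \<in> measurable (P (Suc p)) \<nu>"
    unfolding tmeas_def using a by (intro measurable_component_singleton) auto
  have meas: "{q \<in> space (\<nu> \<Otimes>\<^sub>M P (Suc p)). (snd q)(Suc p := t q) \<notin> E} \<in> sets (\<nu> \<Otimes>\<^sub>M P (Suc p))"
    if t: "t \<in> measurable (\<nu> \<Otimes>\<^sub>M P (Suc p)) \<nu>" for t
  proof -
    have "(\<lambda>q. (t q, snd q)) \<in> measurable (\<nu> \<Otimes>\<^sub>M P (Suc p)) (\<nu> \<Otimes>\<^sub>M P (Suc p))"
      using t by (intro measurable_Pair measurable_snd)
    from measurable_sets[OF measurable_compose[OF this snoc_distr(1)] E(3)]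
    have "{q \<in> space (\<nu> \<Otimes>\<^sub>M P (Suc p)). (snd q)(Suc p := t q) \<in> E} \<in> sets (\<nu> \<Otimes>\<^sub>M P (Suc p))"
      by (simp add: vimage_def Int_def conj_commute)
    from sets.compl_sets[OF this]
    show ?thesis by (rule back_subst[of "\<lambda>A. A \<in> _"]) auto
  qed
  have "AE h in \<nu>. AE x in P (Suc p). x(Suc p := h) \<notin> E" by (rule AE_snoc[OF E0])
  then have "AE x in P (Suc p). AE h in \<nu>. x(Suc p := h) \<notin> E"
    using PN.AE_commute[of "\<lambda>h x. x(Suc p := h) \<notin> E"] meas[OF measurable_fst] by simp
  then have "AE x in P (Suc p). AE h in \<nu>. x(Suc p := m (x a) h) \<notin> E"
    using AE_space
  proof eventually_elim
    case (elim x)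
    then have "x a \<in> G" using a by (auto intro: tuples_D)
    from AE_nu_left[OF this elim(1)] show ?case .
  qed
  moreover have "(\<lambda>q. m (snd q a) (fst q)) \<in> measurable (\<nu> \<Otimes>\<^sub>M P (Suc p)) \<nu>"
  proof -
    have "(\<lambda>q. m (snd q a) (fst q)) \<in> measurable (\<nu> \<Otimes>\<^sub>M P (Suc p)) N"
      using measurable_compose[OF measurable_snd z, of \<nu>] measurable_fst[of \<nu> "P (Suc p)"]
      by (intro m_measurable) (simp_all add: measurable_cong_sets[OF refl sets_nu])
    then show ?thesis by (simp add: measurable_cong_sets[OF refl sets_nu])
  qed
  ultimately have "AE h in \<nu>. AE x in P (Suc p). x(Suc p := m (x a) h) \<notin> E"
    using PN.AE_commute[of "\<lambda>h x. x(Suc p := m (x a) h) \<notin> E"] meas by simp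
  then show ?thesis using AE_space
  proof eventually_elim
    case (elim h)
    then have h: "h \<in> G" by simp
    let ?\<rho> = "\<lambda>x. restrict (\<lambda>k. if a < k then m (x k) h else x k) {..<Suc p}"
    from AE_rmul[OF h elim(1), of "\<lambda>k. a < k"]
    have "AE x in P (Suc p). (?\<rho> x)(Suc p := m (?\<rho> x a) h) \<notin> E" .
    then show ?case using AE_space
    proof eventually_elim
      case (elim x)
      then have x: "x \<in> T (Suc p)" by simp
      let ?w = "(?\<rho> x)(Suc p := m (?\<rho> x a) h)"
      have "?\<rho> x \<in> T (Suc p)" using x h by (intro restrict_in_tuples) (auto intro: tuples_D)
      moreover have "m (?\<rho> x a) h \<in> G" using tuples_D[OF x, of a] h a by simp
      ultimately have "?w \<in> space (P (Suc (Suc p)))" unfolding space_P by (rule snoc_in)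
      then have "R (re ?w)" using E(1) elim(1) by blast
      also have "re ?w = restrict (\<lambda>k. if k \<le> a then x k else m (x (k - 1)) h) {..<Suc (Suc p)}"
        using a by (auto simp: re_def f_def fun_eq_iff restrict_def)
      finally show ?case .
    qed
  qed
qed

text \<open>Fubini for the first \<open>a\<close> and the last \<open>b\<close> entries. The second
  block carries the indices from \<open>a\<close> on in the merged tuple, hence the
  reindexing.\<close>

lemma AE_split:
  assumes meas: "{q \<in> space (tmeas N a \<Otimes>\<^sub>M tmeas N b). R (fst q) (snd q)} \<in> sets (tmeas N a \<Otimes>\<^sub>M tmeas N b)"
    and ae: "\<And>x. x \<in> T a \<Longrightarrow> AE y in P b. R x y"
  shows "AE w in P (a + b). R (restrict w {..<a}) (restrict (\<lambda>k. w (a + k)) {..<b})"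
proof -
  define J where "J = {a..<a + b}"
  define PJ where "PJ = PiM J (\<lambda>_. \<nu>)"
  have IJ: "{..<a} \<union> J = {..<a + b}" "{..<a} \<inter> J = {}" unfolding J_def by auto
  interpret J: prob_space PJ unfolding PJ_def by (intro prob_space_PiM prob_nu)
  interpret PN: pair_prob_space "P a" PJ by standard
  define ts where "ts w = (restrict w {..<a}, restrict (\<lambda>k. w (a + k)) {..<b})" for w :: "nat \<Rightarrow> 'g"
  have tsm: "ts \<in> measurable (P (a + b)) (tmeas N a \<Otimes>\<^sub>M tmeas N b)"
  proof -
    have "ts \<in> measurable (tmeas N (a + b)) (tmeas N a \<Otimes>\<^sub>M tmeas N b)"
      unfolding ts_def tmeas_def
      by (intro measurable_Pair measurable_restrict measurable_component_singleton) auto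
    then show ?thesis by (simp add: measurable_cong_sets[OF sets_P refl])
  qed
  have good: "{w \<in> space (P (a + b)). R (fst (ts w)) (snd (ts w))} \<in> sets (P (a + b))"
  proof -
    from measurable_sets[OF tsm meas]
    have "ts -` {q \<in> space (tmeas N a \<Otimes>\<^sub>M tmeas N b). R (fst q) (snd q)} \<inter> space (P (a + b)) \<in> sets (P (a + b))" .
    also have "ts -` {q \<in> space (tmeas N a \<Otimes>\<^sub>M tmeas N b). R (fst q) (snd q)} \<inter> space (P (a + b))
      = {w \<in> space (P (a + b)). R (fst (ts w)) (snd (ts w))}"
      using measurable_space[OF tsm] by auto
    finally show ?thesis .
  qed
  have dm: "distr (P a \<Otimes>\<^sub>M PJ) (P (a + b)) (merge {..<a} J) = P (a + b)"
    unfolding PJ_def tmeas_def using PP.distr_merge[of "{..<a}" J] IJ by (simp add: J_def)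
  have mm: "merge {..<a} J \<in> measurable (P a \<Otimes>\<^sub>M PJ) (P (a + b))"
    unfolding PJ_def tmeas_def IJ(1)[symmetric] by (rule measurable_merge)
  have S: "{q \<in> space (P a \<Otimes>\<^sub>M PJ). R (fst (ts (merge {..<a} J q))) (snd (ts (merge {..<a} J q)))} \<in> sets (P a \<Otimes>\<^sub>M PJ)"
  proof -
    from measurable_sets[OF mm good]
    show ?thesis by (rule back_subst[of "\<lambda>A. A \<in> _"]) (use measurable_space[OF mm] in auto)
  qed
  have tsmerge: "ts (merge {..<a} J (x, y)) = (x, restrict (\<lambda>k. y (a + k)) {..<b})" if "x \<in> T a" for x y
    using that by (auto simp: ts_def merge_def J_def fun_eq_iff tuples_def PiE_def extensional_def restrict_def)
  have "AE x in P a. AE y in PJ. R (fst (ts (merge {..<a} J (x, y)))) (snd (ts (merge {..<a} J (x, y))))"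
    using AE_space
  proof eventually_elim
    case (elim x)
    then have x: "x \<in> T a" by simp
    have m: "(\<lambda>y. restrict (\<lambda>k. y (a + k)) {..<b}) \<in> measurable PJ (P b)"
      unfolding PJ_def tmeas_def by (intro measurable_restrict measurable_component_singleton) (auto simp: J_def)
    have "distr PJ (P b) (\<lambda>y. restrict (\<lambda>k. y (a + k)) {..<b}) = P b"
      unfolding PJ_def tmeas_def
      by (rule distr_PiM_reindex[of J "\<lambda>_. \<nu>" "\<lambda>k. a + k" "{..<b}"]) (auto simp: J_def prob_nu)
    then have "AE y in distr PJ (P b) (\<lambda>y. restrict (\<lambda>k. y (a + k)) {..<b}). R x y"
      by (rule ssubst) (rule ae[OF x])
    from AE_distrD[OF m this] show ?case by (simp add: tsmerge[OF x])
  qed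
  from PN.AE_pair_measure[OF S this]
  have "AE q in P a \<Otimes>\<^sub>M PJ. R (fst (ts (merge {..<a} J q))) (snd (ts (merge {..<a} J q)))" .
  then have "AE w in distr (P a \<Otimes>\<^sub>M PJ) (P (a + b)) (merge {..<a} J). R (fst (ts w)) (snd (ts w))"
    using AE_distr_iff[OF mm good] by simp
  then show ?thesis unfolding dm by (simp add: ts_def)
qed

end

section \<open>Gluing the columns and comparing the cocycles\<close>

context haar_base begin

lemma strict_eq_cochain:
  assumes s: "s \<in> measurable (tmeas N q) (count_space UNIV)"
    and eq: "\<And>g x. g \<in> G \<Longrightarrow> x \<in> T q \<Longrightarrow> s (sh g q x) = act g (s x)"
  shows "eq_cochain m i G act \<mu> q s"
  unfolding eq_cochain_def
proof (intro conjI ballI AE_I2)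
  show "s \<in> measurable (tmeas \<mu> q) (count_space UNIV)" using s by (simp add: measurable_cong_sets[OF sets_tmu refl])
  fix g x assume "g \<in> G" "x \<in> space (tmeas \<mu> q)"
  then show "act g (s (gshift m (i g) q x)) = s x" by (simp add: eq)
qed

lemma jmeas_cobdry_right:
  assumes "jmeas a k S"
  shows "jmeas a (Suc k) (\<lambda>x y. cobdry k (S x) y)"
proof -
  let ?M = "tmeas N a \<Otimes>\<^sub>M tmeas N (Suc k)"
  have 1: "(\<lambda>p. S (fst p) (face k j (snd p))) \<in> measurable ?M (count_space UNIV)" for j
    by (rule jmeas_compose[OF assms measurable_fst measurable_compose[OF measurable_snd face_measurable]])
  have "(\<lambda>p. sg (k - j) (S (fst p) (face k j (snd p)))) \<in> measurable ?M (count_space UNIV)" for j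
    by (rule measurable_compose[OF 1]) simp
  then show ?thesis unfolding jmeas_def cobdry_sg by (intro sum_count_measurable)
qed

lemma AE_faces:
  assumes "AE x in P q. R x"
  shows "AE z in P (Suc q). \<forall>j\<in>{..q}. R (face q j z)"
  using AE_face[OF assms] by (subst AE_finite_all) auto

text \<open>Reads every column of the staircase as a cochain on the same \<open>q\<close>-tuples, so
  that columns can be subtracted. In the extreme cases \<open>a = 0\<close> and \<open>a = q\<close>
  these are the given cocycle and the tame one.\<close>

definition glue :: "nat \<Rightarrow> ((nat \<Rightarrow> 'g) \<Rightarrow> (nat \<Rightarrow> 'g) \<Rightarrow> 'a) \<Rightarrow> nat \<Rightarrow> (nat \<Rightarrow> 'g) \<Rightarrow> 'a" where
  "glue q S a w = S (restrict w {..<a}) (restrict (\<lambda>k. w (a + k)) {..<q - a})"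

lemma glue_measurable:
  assumes S: "jmeas a (q - a) S" and a: "a \<le> q"
  shows "glue q S a \<in> measurable (tmeas N q) (count_space UNIV)"
  unfolding glue_def
proof (rule jmeas_compose[OF S])
  show "(\<lambda>w. restrict w {..<a}) \<in> measurable (tmeas N q) (tmeas N a)"
    "(\<lambda>w. restrict (\<lambda>k. w (a + k)) {..<q - a}) \<in> measurable (tmeas N q) (tmeas N (q - a))"
    unfolding tmeas_def using a by (auto intro!: measurable_restrict measurable_component_singleton)
qed

lemma glue_sh:
  assumes S: "equiv2 a (q - a) S" and a: "a \<le> q" and g: "g \<in> G" and w: "w \<in> T q"
  shows "glue q S a (sh g q w) = act g (glue q S a w)"
proof -
  have 1: "restrict (sh g q w) {..<a} = sh g a (restrict w {..<a})"
    using a by (auto simp: gshift_def fun_eq_iff)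
  have 2: "restrict (\<lambda>k. sh g q w (a + k)) {..<q - a} = sh g (q - a) (restrict (\<lambda>k. w (a + k)) {..<q - a})"
    using a by (auto simp: gshift_def fun_eq_iff)
  have 3: "restrict w {..<a} \<in> T a" "restrict (\<lambda>k. w (a + k)) {..<q - a} \<in> T (q - a)"
    using w a by (auto intro!: restrict_in_tuples tuples_D)
  show ?thesis unfolding glue_def 1 2 using S g 3 by (simp add: equiv2_def)
qed

text \<open>A face with \<open>j \<le> a\<close> omits one of the first \<open>Suc a\<close>
  entries, so that column \<open>a\<close> applies to what is left; any other face omits a later
  entry and leaves the argument of column \<open>Suc a\<close>. The sum is thus the coboundary of
  \<open>S'\<close> in \<open>y\<close> minus, with sign, the coboundary of \<open>S\<close> in
  \<open>x\<close>.\<close>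

lemma glue_equation:
  assumes a: "a \<le> p"
    and R: "cobdry (p - a) (S' (restrict w {..<Suc a})) (restrict (\<lambda>k. w (Suc a + k)) {..<Suc (p - a)})
      = sg (p - a) (cobdry a (\<lambda>x'. S x' (restrict (\<lambda>k. w (Suc a + k)) {..<Suc (p - a)})) (restrict w {..<Suc a}))"
  shows "(\<Sum>j\<le>Suc p. sg (Suc p - j) (if j \<le> a then glue (Suc p) S a (face (Suc p) j w)
      else glue (Suc p) S' (Suc a) (face (Suc p) j w))) = 0"
proof -
  let ?x = "restrict w {..<Suc a}" and ?y = "restrict (\<lambda>k. w (Suc a + k)) {..<Suc (p - a)}"
  let ?t = "\<lambda>j. sg (Suc p - j) (if j \<le> a then glue (Suc p) S a (face (Suc p) j w)
      else glue (Suc p) S' (Suc a) (face (Suc p) j w))"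
  have 1: "glue (Suc p) S a (face (Suc p) j w) = S (face a j ?x) ?y" if "j \<le> a" for j
  proof -
    have "restrict (face (Suc p) j w) {..<a} = face a j ?x"
      using that a by (auto simp: face_def fun_eq_iff)
    moreover have "restrict (\<lambda>k. face (Suc p) j w (a + k)) {..<Suc p - a} = ?y"
      using that a by (auto simp: face_def fun_eq_iff Suc_diff_le)
    ultimately show ?thesis by (simp add: glue_def)
  qed
  have 2: "glue (Suc p) S' (Suc a) (face (Suc p) (Suc a + j) w) = S' ?x (face (p - a) j ?y)" if "j \<le> p - a" for j
  proof -
    have "restrict (face (Suc p) (Suc a + j) w) {..<Suc a} = ?x"
      using that a by (auto simp: face_def fun_eq_iff)
    moreover have "restrict (\<lambda>k. face (Suc p) (Suc a + j) w (Suc a + k)) {..<Suc p - Suc a} = face (p - a) j ?y"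
      using that a by (auto simp: face_def fun_eq_iff)
    ultimately show ?thesis by (simp add: glue_def)
  qed
  have set: "{..Suc p} = {..a} \<union> (\<lambda>j. Suc a + j) ` {..p - a}"
  proof (intro set_eqI iffI)
    fix j assume "j \<in> {..Suc p}"
    then show "j \<in> {..a} \<union> (\<lambda>j. Suc a + j) ` {..p - a}"
      by (cases "j \<le> a") (auto intro!: image_eqI[of _ _ "j - Suc a"])
  qed (use a in auto)
  have "sum ?t {..Suc p} = sum ?t {..a} + sum ?t ((\<lambda>j. Suc a + j) ` {..p - a})"
    unfolding set by (rule sum.union_disjoint) auto
  also have "sum ?t {..a} = (\<Sum>j\<le>a. - sg (p - a) (sg (a - j) (S (face a j ?x) ?y)))"
  proof (rule sum.cong[OF refl])
    fix j assume j: "j \<in> {..a}"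
    then have "Suc p - j = Suc (p - a + (a - j))" using a by simp
    then show "?t j = - sg (p - a) (sg (a - j) (S (face a j ?x) ?y))"
      using j by (simp add: 1 sg_sg sg_Suc)
  qed
  also have "\<dots> = - sg (p - a) (cobdry a (\<lambda>x'. S x' ?y) ?x)"
    by (simp add: cobdry_sg sg_sum sum_negf)
  also have "sum ?t ((\<lambda>j. Suc a + j) ` {..p - a}) = (\<Sum>j\<le>p - a. sg (p - a - j) (S' ?x (face (p - a) j ?y)))"
    by (subst sum.reindex) (auto simp: inj_on_def 2[simplified] intro!: sum.cong)
  also have "\<dots> = cobdry (p - a) (S' ?x) ?y" by (simp add: cobdry_sg)
  finally show ?thesis by (simp only: R left_minus)
qed

text \<open>The columns \<open>J a\<close> interpolate between \<open>J 0\<close>, which is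
  \<open>f'\<close>, and \<open>J (Suc p)\<close>, and adjacent ones satisfy a mixed cocycle
  identity. The prism built from their differences with \<open>f'\<close> is a cochain whose
  coboundary is \<open>\<sigma> - f'\<close>.\<close>

theorem tame_representative:
  assumes f: "mcocycle m i G act \<mu> p f"
  shows "\<exists>\<sigma>. mcocycle m i G act \<mu> p \<sigma> \<and> cohomologous m i G act \<mu> p \<sigma> f \<and>
    (\<forall>x0\<in>T (Suc p). \<exists>U F. open U \<and> x0 \<in> U \<and> finite F \<and> F \<subseteq> tests (Suc p) \<and>
      (\<forall>x\<in>T (Suc p) \<inter> U. \<forall>x'\<in>T (Suc p) \<inter> U. (\<forall>t\<in>F. sat x t = sat x' t) \<longrightarrow> \<sigma> x = \<sigma> x'))"
proof -
  have fc: "eq_cochain m i G act \<mu> (Suc p) f" "AE z in P (Suc (Suc p)). cobdry (Suc p) f z = 0"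
    using f by (auto simp: mcocycle_def AE_P_iff)
  obtain f' where f': "f' \<in> measurable (tmeas N (Suc p)) (count_space UNIV)"
    "\<forall>g\<in>G. \<forall>x\<in>T (Suc p). f' (sh g (Suc p) x) = act g (f' x)" "AE x in P (Suc p). f' x = f x"
    using strictify[OF _ fc(1)] by auto
  have f'c: "AE z in P (Suc (Suc p)). cobdry (Suc p) f' z = 0"
    using AE_faces[OF f'(3)] fc(2)
  proof eventually_elim
    case (elim z)
    then have "cobdry (Suc p) f' z = cobdry (Suc p) f z" by (intro cobdry_cong) auto
    with elim show ?case by simp
  qed
  obtain S where S0: "S 0 = (\<lambda>x. f')" and Sg: "\<forall>a\<le>Suc p. stage a (Suc p - a) (S a)"
    and Sd: "\<forall>a\<le>p. \<forall>x\<in>T (Suc a). AE y in P (Suc (p - a)).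
       cobdry (p - a) (S (Suc a) x) y = sg (p - a) (cobdry a (\<lambda>x'. S a x' y) x)"
    using stage_chain[OF f'(1,2) f'c] by blast
  have Sj: "jmeas a (Suc p - a) (S a)" and Se: "equiv2 a (Suc p - a) (S a)" and St: "tame a (Suc p - a) (S a)"
    if "a \<le> Suc p" for a using Sg that by (auto simp: stage_def)
  define J where "J a = glue (Suc p) (S a) a" for a
  have Jm: "J a \<in> measurable (tmeas N (Suc p)) (count_space UNIV)" if "a \<le> Suc p" for a
    unfolding J_def by (rule glue_measurable[OF Sj[OF that] that])
  have Jsh: "J a (sh g (Suc p) w) = act g (J a w)" if "a \<le> Suc p" "g \<in> G" "w \<in> T (Suc p)" for a g w
    unfolding J_def by (rule glue_sh[OF Se[OF that(1)] that])
  \<comment> \<open>Subtracting \<open>f'\<close>, itself a cocycle, keeps the mixed identity and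
    makes \<open>D 0\<close> vanish. Otherwise the prism would compare \<open>\<sigma>\<close> at
    \<open>x\<close> with \<open>f'\<close> at the right translate of \<open>x\<close>.\<close>
  define D where "D a w = J a w - f' w" for a w
  have E: "AE w in P (Suc (Suc p)).
      (\<Sum>j\<le>Suc p. sg (Suc p - j) (D (if j \<le> a then a else Suc a) (face (Suc p) j w))) = 0" if a: "a \<le> p" for a
  proof -
    have sz: "Suc a + Suc (p - a) = Suc (Suc p)" using a by simp
    let ?R = "\<lambda>x y. cobdry (p - a) (S (Suc a) x) y = sg (p - a) (cobdry a (\<lambda>x'. S a x' y) x)"
    have j1: "jmeas (Suc a) (Suc (p - a)) (\<lambda>x y. cobdry (p - a) (S (Suc a) x) y)"
      using jmeas_cobdry_right[of "Suc a" "p - a" "S (Suc a)"] Sj[of "Suc a"] a by simp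
    have j2: "jmeas (Suc a) (Suc (p - a)) (\<lambda>x y. sg (p - a) (cobdry a (\<lambda>x'. S a x' y) x))"
      using jmeas_cobdry[of a "Suc (p - a)" "S a"] Sj[of a] a by (simp add: Suc_diff_le)
    have "AE w in P (Suc a + Suc (p - a)). ?R (restrict w {..<Suc a}) (restrict (\<lambda>k. w (Suc a + k)) {..<Suc (p - a)})"
    proof (rule AE_split[of "Suc a" "Suc (p - a)" ?R])
      have "Measurable.pred (tmeas N (Suc a) \<Otimes>\<^sub>M tmeas N (Suc (p - a))) (\<lambda>q. ?R (fst q) (snd q))"
        by (rule count_measurable2[OF j1[unfolded jmeas_def] j2[unfolded jmeas_def]])
      then show "{q \<in> space (tmeas N (Suc a) \<Otimes>\<^sub>M tmeas N (Suc (p - a))). ?R (fst q) (snd q)}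
        \<in> sets (tmeas N (Suc a) \<Otimes>\<^sub>M tmeas N (Suc (p - a)))" by (simp only: pred_def)
    qed (use Sd a in blast)
    then have "AE w in P (Suc (Suc p)). ?R (restrict w {..<Suc a}) (restrict (\<lambda>k. w (Suc a + k)) {..<Suc (p - a)})"
      by (simp only: sz)
    then show ?thesis using f'c
    proof eventually_elim
      case (elim w)
      have "(\<Sum>j\<le>Suc p. sg (Suc p - j) (D (if j \<le> a then a else Suc a) (face (Suc p) j w)))
        = (\<Sum>j\<le>Suc p. sg (Suc p - j) (if j \<le> a then glue (Suc p) (S a) a (face (Suc p) j w)
             else glue (Suc p) (S (Suc a)) (Suc a) (face (Suc p) j w)) - sg (Suc p - j) (f' (face (Suc p) j w)))"
        by (intro sum.cong) (auto simp: D_def J_def sg_diff)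
      also have "\<dots> = (\<Sum>j\<le>Suc p. sg (Suc p - j) (if j \<le> a then glue (Suc p) (S a) a (face (Suc p) j w)
             else glue (Suc p) (S (Suc a)) (Suc a) (face (Suc p) j w))) - cobdry (Suc p) f' w"
        by (simp only: sum_subtractf cobdry_sg)
      also have "\<dots> = 0" using glue_equation[where S = "S a" and S' = "S (Suc a)" and w = w, OF a elim(1)] elim(2) by simp
      finally show ?case .
    qed
  qed
  define \<Phi> where "\<Phi> a h x = restrict (\<lambda>k. if k \<le> a then x k else m (x (k - 1)) h) {..<Suc (Suc p)}" for a h x
  have "AE h in \<nu>. \<forall>a\<in>{..p}. AE x in P (Suc p).
      (\<Sum>j\<le>Suc p. sg (Suc p - j) (D (if j \<le> a then a else Suc a) (face (Suc p) j (\<Phi> a h x)))) = 0"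
    unfolding \<Phi>_def using AE_prism[OF E] by (subst AE_finite_all) auto
  from AE_nu_ex[OF this] obtain h where h: "h \<in> G" "\<forall>a\<in>{..p}. AE x in P (Suc p).
      (\<Sum>j\<le>Suc p. sg (Suc p - j) (D (if j \<le> a then a else Suc a) (face (Suc p) j (\<Phi> a h x)))) = 0" by blast
  have Eh: "AE x in P (Suc p). \<forall>a\<in>{..p}.
      (\<Sum>j\<le>Suc p. sg (Suc p - j) (D (if j \<le> a then a else Suc a) (face (Suc p) j (\<Phi> a h x)))) = 0"
    using h(2) by (subst AE_finite_all) auto
  define \<Psi> where "\<Psi> j z = restrict (\<lambda>k. if k \<le> j then z k else m (z (k - 1)) h) {..<Suc p}" for j z
  define \<tau> where "\<tau> z = - (\<Sum>j<p. sg (p + j) (D (Suc j) (\<Psi> j z)))" for z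
  define \<sigma> where "\<sigma> = J (Suc p)"
  have coh: "AE x in P (Suc p). \<sigma> x - f' x = cobdry p \<tau> x"
    using Eh AE_space
  proof eventually_elim
    case (elim x)
    then have x: "x \<in> T (Suc p)" by simp
    let ?\<Theta> = "\<lambda>a. restrict (\<lambda>k. if k < a then x k else m (x k) h) {..<Suc p}"
    have id: "D (Suc p) (?\<Theta> (Suc p)) - D 0 (?\<Theta> 0) = cobdry p \<tau> x"
      unfolding \<tau>_def[abs_def] \<Psi>_def
      by (rule prism_identity) (use elim(1) in \<open>simp add: \<Phi>_def\<close>)
    have "?\<Theta> (Suc p) = restrict x {..<Suc p}" by (rule restrict_ext) simp
    also have "\<dots> = x" using x unfolding tuples_def PiE_def by (intro extensional_restrict) blast
    finally have "?\<Theta> (Suc p) = x" .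
    moreover have "D 0 (?\<Theta> 0) = 0" 
      unfolding D_def J_def glue_def S0 by (simp add: restrict_def if_distrib cong: if_cong)
    ultimately show ?case using id by (simp add: D_def \<sigma>_def)
  qed
  have \<Psi>m: "\<Psi> j \<in> measurable (tmeas N p) (tmeas N (Suc p))" if j: "j < p" for j
    unfolding \<Psi>_def tmeas_def
  proof (rule measurable_restrict)
    fix k assume k: "k \<in> {..<Suc p}"
    show "(\<lambda>z. if k \<le> j then z k else m (z (k - 1)) h) \<in> measurable (PiM {..<p} (\<lambda>_. N)) N"
    proof (cases "k \<le> j")
      case True
      then show ?thesis using j by (simp add: measurable_component_singleton)
    next
      case False
      have "(\<lambda>z. z (k - 1)) \<in> measurable (PiM {..<p} (\<lambda>_. N)) N"
        using False k by (intro measurable_component_singleton) auto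
      then have "(\<lambda>z. m (z (k - 1)) h) \<in> measurable (PiM {..<p} (\<lambda>_. N)) N"
        using h(1) by (intro m_measurable) auto
      with False show ?thesis by simp
    qed
  qed
  have \<Psi>T: "\<Psi> j z \<in> T (Suc p)" if "z \<in> T p" "j < p" for j z
    unfolding \<Psi>_def using that h(1) by (intro restrict_in_tuples) (auto intro!: tuples_D[of z p])
  \<comment> \<open>Right multiplication by \<open>h\<close> commutes with the diagonal left action;
    this makes \<open>\<tau>\<close> strictly equivariant.\<close>
  have \<Psi>sh: "\<Psi> j (sh g p z) = sh g (Suc p) (\<Psi> j z)" if "z \<in> T p" "j < p" "g \<in> G" for j z g
  proof (rule tuples_eqI)
    show "\<Psi> j (sh g p z) \<in> T (Suc p)" "sh g (Suc p) (\<Psi> j z) \<in> T (Suc p)"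
      using that \<Psi>T by auto
    fix k assume k: "k < Suc p"
    have z: "l < p \<Longrightarrow> z l \<in> G" for l using that(1) by (rule tuples_D)
    show "\<Psi> j (sh g p z) k = sh g (Suc p) (\<Psi> j z) k"
      using k that(2,3) h(1) z[of k] z[of "k - 1"] by (auto simp: \<Psi>_def gshift_def m_assoc)
  qed
  have Dm: "D a \<in> measurable (tmeas N (Suc p)) (count_space UNIV)" if "a \<le> Suc p" for a
    unfolding D_def[abs_def] by (rule count_measurable2[OF Jm[OF that] f'(1)])
  have Dsh: "D a (sh g (Suc p) w) = act g (D a w)" if "a \<le> Suc p" "g \<in> G" "w \<in> T (Suc p)" for a g w
    unfolding D_def using that f'(2) by (simp add: Jsh act_diff)
  have \<tau>: "eq_cochain m i G act \<mu> p \<tau>"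
  proof (rule strict_eq_cochain)
    have "(\<lambda>z. \<Sum>j<p. - sg (p + j) (D (Suc j) (\<Psi> j z))) \<in> measurable (tmeas N p) (count_space UNIV)"
    proof (rule sum_count_measurable)
      fix j assume "j \<in> {..<p}"
      then have "(\<lambda>z. D (Suc j) (\<Psi> j z)) \<in> measurable (tmeas N p) (count_space UNIV)"
        by (intro measurable_compose[OF \<Psi>m Dm]) auto
      from measurable_compose[OF this, of "\<lambda>v. - sg (p + j) v" "count_space UNIV"]
      show "(\<lambda>z. - sg (p + j) (D (Suc j) (\<Psi> j z))) \<in> measurable (tmeas N p) (count_space UNIV)" by simp
    qed
    then show "\<tau> \<in> measurable (tmeas N p) (count_space UNIV)" by (simp only: \<tau>_def[abs_def] sum_negf)
    fix g z assume g: "g \<in> G" and z: "z \<in> T p"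
    have sga: "sg l (act g v) = act g (sg l v)" for l v using g by (simp add: sg_def act_minus)
    have "D (Suc j) (\<Psi> j (sh g p z)) = act g (D (Suc j) (\<Psi> j z))" if "j < p" for j
      using \<Psi>sh[OF z that g] Dsh[OF _ g \<Psi>T[OF z that]] that by simp
    then show "\<tau> (sh g p z) = act g (\<tau> z)"
      unfolding \<tau>_def using g by (simp add: act_minus act_sum sga)
  qed
  have \<sigma>: "eq_cochain m i G act \<mu> (Suc p) \<sigma>"
    unfolding \<sigma>_def by (rule strict_eq_cochain) (auto intro: Jm Jsh)
  have "AE w in P (Suc (Suc p)). cobdry (Suc p) \<sigma> w = 0"
    using AE_faces[OF coh] f'c
  proof eventually_elim
    case (elim w)
    have "cobdry (Suc p) (\<lambda>x. \<sigma> x - f' x) w = cobdry (Suc p) (cobdry p \<tau>) w"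
      using elim(1) by (intro cobdry_cong) auto
    with elim(2) show ?case by (simp add: cobdry_diff cobdry_cobdry)
  qed
  with \<sigma> have c1: "mcocycle m i G act \<mu> p \<sigma>" by (simp add: mcocycle_def AE_P_iff)
  have cf: "AE x in P (Suc p). \<sigma> x - f x = cobdry p \<tau> x"
    using coh f'(3) by eventually_elim simp
  have c2: "cohomologous m i G act \<mu> p \<sigma> f"
  proof (cases "p = 0")
    case True
    \<comment> \<open>For \<open>p = 0\<close> there is no prism: \<open>\<tau>\<close> is an empty
      sum, and the two functions agree almost everywhere, as required in degree 0.\<close>
    have "cobdry p \<tau> x = 0" for x using True by (simp add: \<tau>_def[abs_def] cobdry_def)
    with cf have "AE x in P (Suc p). \<sigma> x = f x" by simp
    then have "AE x in tmeas \<mu> 1. \<sigma> x = f x" unfolding AE_P_iff True One_nat_def .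
    with True show ?thesis by (simp only: cohomologous_def if_True refl)
  next
    case False
    with \<tau> cf show ?thesis unfolding cohomologous_def AE_P_iff by auto
  qed
  have "\<exists>U F. open U \<and> x0 \<in> U \<and> finite F \<and> F \<subseteq> tests (Suc p) \<and>
      (\<forall>x\<in>T (Suc p) \<inter> U. \<forall>x'\<in>T (Suc p) \<inter> U. (\<forall>t\<in>F. sat x t = sat x' t) \<longrightarrow> \<sigma> x = \<sigma> x')"
    if x0: "x0 \<in> T (Suc p)" for x0
  proof -
    \<comment> \<open>Any tolerance below 1 would do: the empty tuple has measure 1, so a set of
      measure at most \<open>1/2\<close> is empty.\<close>
    have h2: "(0::real) < 1/2" by simp
    have t0: "tame (Suc p) 0 (S (Suc p))" using St[of "Suc p"] by simp
    obtain U F where UF: "open U" "x0 \<in> U" "finite F" "F \<subseteq> tests (Suc p)"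
      "\<forall>x\<in>T (Suc p) \<inter> U. \<forall>x'\<in>T (Suc p) \<inter> U. (\<forall>t\<in>F. sat x t = sat x' t) \<longrightarrow>
        measure (P 0) {y \<in> T 0. S (Suc p) x y \<noteq> S (Suc p) x' y} \<le> 1/2"
      using tameE[OF t0 x0 h2] .
    have T0: "T 0 = {\<lambda>_. undefined}" by (auto simp: tuples_def)
    have \<sigma>x: "\<sigma> x = S (Suc p) x (\<lambda>_. undefined)" if "x \<in> T (Suc p)" for x
    proof -
      have "restrict x {..<Suc p} = x" using that by (auto simp: tuples_def PiE_def extensional_restrict)
      then show ?thesis by (simp add: \<sigma>_def J_def glue_def restrict_def)
    qed
    have "\<sigma> x = \<sigma> x'" if x: "x \<in> T (Suc p) \<inter> U" "x' \<in> T (Suc p) \<inter> U" and ag: "\<forall>t\<in>F. sat x t = sat x' t" for x x'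
    proof (rule ccontr)
      assume "\<sigma> x \<noteq> \<sigma> x'"
      then have "{y \<in> T 0. S (Suc p) x y \<noteq> S (Suc p) x' y} = space (P 0)"
        using \<sigma>x x by (auto simp: T0)
      then have "measure (P 0) {y \<in> T 0. S (Suc p) x y \<noteq> S (Suc p) x' y} = 1"
        using P.prob_space[of 0] by simp
      moreover have "measure (P 0) {y \<in> T 0. S (Suc p) x y \<noteq> S (Suc p) x' y} \<le> 1/2" using UF(5) x ag by blast
      ultimately show False by simp
    qed
    then have "\<forall>x\<in>T (Suc p) \<inter> U. \<forall>x'\<in>T (Suc p) \<inter> U. (\<forall>t\<in>F. sat x t = sat x' t) \<longrightarrow> \<sigma> x = \<sigma> x'"
      by (intro ballI impI)
    then show ?thesis by (intro exI[of _ U] exI[of _ F] conjI UF(1-4))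
  qed
  with c1 c2 show ?thesis by blast
qed

end

section \<open>Locally compact groups\<close>

context haar_module begin

text \<open>Says that \<open>x\<close> is not on the boundary of \<open>B\<close> relative to
  \<open>G\<close>, in the form in which it is used.\<close>

definition loc_const_at :: "'g set \<Rightarrow> 'g \<Rightarrow> bool" where
  "loc_const_at B x \<longleftrightarrow> (\<exists>V. openin (top_of_set G) V \<and> x \<in> V \<and> (\<forall>y\<in>V. (y \<in> B) = (x \<in> B)))"

text \<open>For each member \<open>D\<close> of a countable basis of the type, Lindelof gives
  countably many members of \<open>F\<close> with the same union as all members of \<open>F\<close>
  inside \<open>D\<close>; together these still form a base.\<close>

lemma countable_subbase:
  assumes op: "\<And>B. B \<in> F \<Longrightarrow> openin (top_of_set G) B"
    and base: "\<And>U x. openin (top_of_set G) U \<Longrightarrow> x \<in> U \<Longrightarrow> \<exists>B\<in>F. x \<in> B \<and> B \<subseteq> U"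
  obtains BB where "BB \<subseteq> F" "countable BB"
    "\<forall>U x. openin (top_of_set G) U \<longrightarrow> x \<in> U \<longrightarrow> (\<exists>B\<in>BB. x \<in> B \<and> B \<subseteq> U)"
proof -
  obtain \<C> :: "'g set set" where C: "countable \<C>" "topological_basis \<C>"
    using ex_countable_basis by blast
  have "\<forall>D. \<exists>H. H \<subseteq> {B \<in> F. B \<subseteq> G \<inter> D} \<and> countable H \<and> \<Union>H = \<Union>{B \<in> F. B \<subseteq> G \<inter> D}"
  proof
    fix D
    obtain H where "H \<subseteq> {B \<in> F. B \<subseteq> G \<inter> D}" "countable H" "\<Union>H = \<Union>{B \<in> F. B \<subseteq> G \<inter> D}"
      using Lindelof_openin[of "{B \<in> F. B \<subseteq> G \<inter> D}" G] op by blast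
    then show "\<exists>H. H \<subseteq> {B \<in> F. B \<subseteq> G \<inter> D} \<and> countable H \<and> \<Union>H = \<Union>{B \<in> F. B \<subseteq> G \<inter> D}" by blast
  qed
  from choice[OF this] obtain H where H: "\<forall>D. H D \<subseteq> {B \<in> F. B \<subseteq> G \<inter> D} \<and> countable (H D) \<and>
    \<Union>(H D) = \<Union>{B \<in> F. B \<subseteq> G \<inter> D}" ..
  show thesis
  proof (rule that[of "\<Union>(H ` \<C>)"])
    show "\<Union>(H ` \<C>) \<subseteq> F" using H by blast
    show "countable (\<Union>(H ` \<C>))" using H C(1) by (intro countable_UN) auto
  next
    show "\<forall>U x. openin (top_of_set G) U \<longrightarrow> x \<in> U \<longrightarrow> (\<exists>B\<in>\<Union>(H ` \<C>). x \<in> B \<and> B \<subseteq> U)"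
    proof (intro allI impI)
      fix U x assume U: "openin (top_of_set G) U" "x \<in> U"
      obtain U' where U': "open U'" "U = G \<inter> U'" using U(1) by (auto simp: openin_open)
      obtain D where D: "D \<in> \<C>" "x \<in> D" "D \<subseteq> U'"
        using topological_basisE[OF C(2) U'(1), of x] U(2) U'(2) by blast
      have "openin (top_of_set G) (G \<inter> D)" using topological_basis_open[OF C(2) D(1)] by (simp add: openin_open_Int)
      moreover have "x \<in> G \<inter> D" using U U' D by blast
      ultimately obtain B where B: "B \<in> F" "x \<in> B" "B \<subseteq> G \<inter> D" using base by blast
      then have "x \<in> \<Union>(H D)" using H by blast
      then obtain B' where "B' \<in> H D" "x \<in> B'" by blast
      moreover then have "B' \<subseteq> U" using H D(3) U'(2) by blast
      ultimately show "\<exists>B\<in>\<Union>(H ` \<C>). x \<in> B \<and> B \<subseteq> U" using D(1) by blast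
    qed
  qed
qed

end

section \<open>Basic open sets with null boundary\<close>

context haar_prob begin

text \<open>For a fixed second entry the quotient is a right translate of an inverse, and both
  operations preserve null sets; Fubini gives the pair and \<open>AE_reindex\<close> the remaining
  coordinates. For \<open>b = c\<close> the quotient would be constantly \<open>e\<close>.\<close>

lemma AE_quotient:
  assumes bc: "b \<noteq> c" "b < q" "c < q" and ae: "AE v in \<nu>. R v"
  shows "AE x in P q. R (m (i (x b)) (x c))"
proof -
  obtain E where E: "{x \<in> space \<nu>. \<not> R x} \<subseteq> E" "emeasure \<nu> E = 0" "E \<in> sets \<nu>"
    using AE_E[OF ae] .
  have E0: "AE x in \<nu>. x \<notin> E" by (rule AE_I[of _ _ E]) (use E in auto)
  have "AE v in \<nu>. AE y in P (Suc 0). m (i (y 0)) v \<notin> E"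
    using AE_space
  proof eventually_elim
    case (elim v)
    have "AE u in \<nu>. m (i u) v \<notin> E" using elim by (intro AE_nu_inv[OF AE_nu_right[OF _ E0]]) simp
    then show ?case unfolding tmeas_def
      by (intro AE_PiM_component[of "{..<Suc 0}" "\<lambda>_. \<nu>" 0 "\<lambda>u. m (i u) v \<notin> E"]) (auto intro: prob_nu)
  qed
  then have ae2: "AE v in \<nu>. AE y in P (Suc 0). m (i ((y(Suc 0 := v)) 0)) ((y(Suc 0 := v)) (Suc 0)) \<notin> E" by simp
  have qm: "(\<lambda>z. m (i (z b)) (z c)) \<in> measurable (P q) \<nu>" if "b < q" "c < q" for b c q
  proof -
    have co: "(\<lambda>x. x k) \<in> measurable (tmeas N q) N" if "k < q" for k
      unfolding tmeas_def using that by (intro measurable_component_singleton) auto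
    have "(\<lambda>x. m (i (x b)) (x c)) \<in> measurable (tmeas N q) N"
      by (intro m_measurable measurable_compose[OF co i_measurable] co that)
    then show ?thesis by (simp add: measurable_cong_sets[OF sets_P sets_nu])
  qed
  have "AE z in P (Suc (Suc 0)). m (i (z 0)) (z (Suc 0)) \<notin> E"
  proof (rule AE_snoc_conv[OF _ ae2])
    have "(\<lambda>z. m (i (z 0)) (z (Suc 0))) -` E \<inter> space (P (Suc (Suc 0))) \<in> sets (P (Suc (Suc 0)))"
      by (rule measurable_sets[OF qm E(3)]) auto
    from sets.compl_sets[OF this]
    show "{z \<in> T (Suc (Suc 0)). m (i (z 0)) (z (Suc 0)) \<notin> E} \<in> sets (P (Suc (Suc 0)))"
      by (rule back_subst[of "\<lambda>A. A \<in> _"]) auto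
  qed
  then have "AE x in P q. m (i (restrict (\<lambda>k. x (if k = 0 then b else c)) {..<Suc (Suc 0)} 0))
      (restrict (\<lambda>k. x (if k = 0 then b else c)) {..<Suc (Suc 0)} (Suc 0)) \<notin> E"
    by (rule AE_reindex[rotated 2]) (use bc in \<open>auto simp: inj_on_def\<close>)
  then have "AE x in P q. m (i (x b)) (x c) \<notin> E" by simp
  then show ?thesis using AE_space
  proof eventually_elim
    case (elim x)
    then have "m (i (x b)) (x c) \<in> space \<nu>" using bc by (auto intro: tuples_D)
    with elim(1) E(1) show ?case by blast
  qed
qed

lemma nu_open_pos:
  assumes V: "openin (top_of_set G) V" "V \<noteq> {}"
  shows "0 < emeasure \<nu> V"
proof (rule ccontr)
  have VS: "V \<in> sets N" by (rule open_N[OF V(1)])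
  assume "\<not> 0 < emeasure \<nu> V"
  then have "emeasure \<nu> V = 0" by simp
  then have "AE x in \<nu>. x \<notin> V" using VS by (intro AE_I[of _ _ V]) (auto simp: sets_nu)
  then have "AE x in \<mu>. 0 < \<phi> x \<longrightarrow> x \<notin> V"
    unfolding \<nu>_def by (subst (asm) AE_density) (auto simp: measurable_cong_sets[OF sets_mu refl])
  then have "AE x in \<mu>. x \<notin> V" using AE_space by eventually_elim (use phi_pos in auto)
  moreover have "{x \<in> space \<mu>. \<not> x \<notin> V} = V" using openin_imp_subset[OF V(1)] by auto
  ultimately have "emeasure \<mu> V = 0" using AE_iff_measurable[of V \<mu> "\<lambda>x. x \<notin> V"] VS by (simp add: sets_mu)
  with mu_open[OF V] show False by simp
qed

text \<open>A basic open box around a point of \<open>T q\<close> has positive probability, being a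
  finite product of positive numbers, so it cannot miss a set of full measure.\<close>

lemma AE_dense:
  assumes ae: "AE y in P q. R y" and U: "open U" "x \<in> T q" "x \<in> U"
  shows "\<exists>y\<in>T q \<inter> U. R y"
proof (rule ccontr)
  assume no: "\<not> ?thesis"
  have "openin (product_topology (\<lambda>i. euclidean) UNIV) U"
    by (subst euclidean_product_topology) (rule open_openin[THEN iffD1, OF U(1)])
  from product_topology_open_contains_basis[OF this U(3)]
  obtain X where X: "x \<in> PiE UNIV X" "\<And>i. open (X i)" "PiE UNIV X \<subseteq> U" by auto
  define V where "V k = G \<inter> X k" for k
  have V: "openin (top_of_set G) (V k)" for k unfolding V_def using X(2) by (simp add: openin_open_Int)
  have Vne: "V k \<noteq> {}" if "k < q" for k using tuples_D[OF U(2) that] X(1) by (auto simp: V_def)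
  have VS: "V k \<in> sets \<nu>" for k using open_N[OF V] by (simp add: sets_nu)
  have sub: "y \<in> T q \<inter> U" if y: "y \<in> PiE {..<q} V" for y
  proof -
    have yT: "y \<in> T q" using y by (auto simp: tuples_def V_def PiE_iff)
    have "y k \<in> X k" for k
    proof (cases "k < q")
      case True then show ?thesis using y by (auto simp: V_def PiE_iff)
    next
      case False
      then have "y k = x k" using yT U(2) by (auto simp: tuples_def PiE_def extensional_def)
      then show ?thesis using X(1) by auto
    qed
    then show ?thesis using yT X(3) by auto
  qed
  have "emeasure (P q) (PiE {..<q} V) = (\<Prod>k<q. emeasure \<nu> (V k))"
    unfolding tmeas_def using VS by (intro PP.emeasure_PiM) auto
  moreover have "\<dots> \<noteq> 0" using nu_open_pos[OF V Vne] by (auto simp: less_le)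
  moreover have "emeasure (P q) (PiE {..<q} V) = 0"
  proof -
    have "AE y in P q. y \<notin> PiE {..<q} V" using ae by eventually_elim (use no sub in blast)
    moreover have "{y \<in> space (P q). \<not> y \<notin> PiE {..<q} V} = PiE {..<q} V" using sub by auto
    moreover have "PiE {..<q} V \<in> sets (P q)" unfolding tmeas_def using VS by (intro sets_PiM_I_finite) auto
    ultimately show ?thesis using AE_iff_measurable[of "PiE {..<q} V" "P q" "\<lambda>y. y \<notin> PiE {..<q} V"] by simp
  qed
  ultimately show False by simp
qed

text \<open>Complete regularity provides a continuous function vanishing at \<open>x\<close> and
  equal to 1 off \<open>U\<close>. Its sublevel sets for \<open>t\<close> between 0 and 1 have
  boundaries in the disjoint level sets, of which only countably many have positive measure, so a
  suitable \<open>t\<close> exists.\<close>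

lemma null_boundary_base:
  obtains BB where "countable BB" "\<And>B. B \<in> BB \<Longrightarrow> openin (top_of_set G) B"
    "\<And>B. B \<in> BB \<Longrightarrow> AE x in \<nu>. loc_const_at B x"
    "\<forall>U x. openin (top_of_set G) U \<longrightarrow> x \<in> U \<longrightarrow> (\<exists>B\<in>BB. x \<in> B \<and> B \<subseteq> U)"
proof -
  define F where "F = {B. openin (top_of_set G) B \<and> (AE x in \<nu>. loc_const_at B x)}"
  have "Hausdorff_space (euclidean :: 'g topology)"
    
    unfolding Hausdorff_space_def
  proof (intro allI impI)
    fix x y :: 'g assume "x \<in> topspace euclidean \<and> y \<in> topspace euclidean \<and> x \<noteq> y"
    then obtain U V where "open U" "open V" "x \<in> U" "y \<in> V" "U \<inter> V = {}" using hausdorff[of x y] by blast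
    then show "\<exists>U V. openin euclidean U \<and> openin euclidean V \<and> x \<in> U \<and> y \<in> V \<and> disjnt U V"
      by (intro exI[of _ U] exI[of _ V]) (simp add: disjnt_def open_openin[symmetric])
  qed
  then have "completely_regular_space (top_of_set G)"
    by (intro locally_compact_regular_imp_completely_regular_space[OF loc_compact] disjI1 Hausdorff_space_subtopology)
  note cr = this[unfolded completely_regular_space_def, rule_format]
  have base: "\<exists>B\<in>F. x \<in> B \<and> B \<subseteq> U" if U: "openin (top_of_set G) U" "x \<in> U" for U x
  proof -
    have xG: "x \<in> G" using U openin_imp_subset by blast
    have "closedin (top_of_set G) (G - U)" using U(1) by (simp add: closedin_def openin_subset Diff_Diff_Int openin_imp_subset Int_absorb1)
    then obtain f :: "'g \<Rightarrow> real" where f: "continuous_map (top_of_set G) (top_of_set {0..1}) f" "f x = 0" "f ` (G - U) \<subseteq> {1}"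
      using cr[of "G - U" x] U(2) xG by auto
    have fc: "continuous_on G f" using f(1) by (simp add: continuous_map_in_subtopology)
    have fm: "f \<in> borel_measurable \<nu>"
      using borel_measurable_continuous_on_restrict[OF fc] by (simp add: measurable_cong_sets[OF sets_nu refl])
    interpret D: prob_space "distr \<nu> borel f" by (rule nu.prob_space_distr[OF fm])
    have "uncountable ({0<..<1::real} - {t. measure (distr \<nu> borel f) {t} \<noteq> 0})"
      by (rule uncountable_minus_countable[OF _ D.countable_support]) (simp add: uncountable_open_interval)
    then have "{0<..<1::real} - {t. measure (distr \<nu> borel f) {t} \<noteq> 0} \<noteq> {}" by (metis countable_empty)
    then obtain t where t: "0 < t" "t < 1" "measure (distr \<nu> borel f) {t} = 0" by auto
    have op: "openin (top_of_set G) (G \<inter> f -` {..<t})" "openin (top_of_set G) (G \<inter> f -` {t<..})"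
      by (auto intro: continuous_openin_preimage_gen[OF fc])
    have "emeasure \<nu> (f -` {t} \<inter> space \<nu>) = 0"
      using t(3) fm by (simp add: measure_distr nu.emeasure_eq_measure)
    moreover have "f -` {t} \<inter> space \<nu> \<in> sets \<nu>" using fm by (rule measurable_sets) simp
    ultimately have "AE y in \<nu>. f y \<noteq> t" by (intro AE_I[of _ _ "f -` {t} \<inter> space \<nu>"]) auto
    then have "AE y in \<nu>. loc_const_at (G \<inter> f -` {..<t}) y" using AE_space
    proof eventually_elim
      case (elim y)
      then have y: "y \<in> G" "f y < t \<or> t < f y" by auto
      show ?case unfolding loc_const_at_def
      proof (cases "f y < t")
        case True
        then show "\<exists>V. openin (top_of_set G) V \<and> y \<in> V \<and> (\<forall>z\<in>V. (z \<in> G \<inter> f -` {..<t}) = (y \<in> G \<inter> f -` {..<t}))"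
          using op(1) y by (intro exI[of _ "G \<inter> f -` {..<t}"]) auto
      next
        case False
        then show "\<exists>V. openin (top_of_set G) V \<and> y \<in> V \<and> (\<forall>z\<in>V. (z \<in> G \<inter> f -` {..<t}) = (y \<in> G \<inter> f -` {..<t}))"
          using op(2) y by (intro exI[of _ "G \<inter> f -` {t<..}"]) auto
      qed
    qed
    then have "G \<inter> f -` {..<t} \<in> F" using op(1) by (simp add: F_def)
    moreover have "G \<inter> f -` {..<t} \<subseteq> U" using f(3) t by auto
    ultimately show ?thesis using xG f(2) t(1) by (intro bexI[of _ "G \<inter> f -` {..<t}"]) auto
  qed
  have op: "openin (top_of_set G) B" if "B \<in> F" for B using that by (simp add: F_def)
  obtain BB where "BB \<subseteq> F" "countable BB"
    "\<forall>U x. openin (top_of_set G) U \<longrightarrow> x \<in> U \<longrightarrow> (\<exists>B\<in>BB. x \<in> B \<and> B \<subseteq> U)"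
    using countable_subbase[of F, OF op base] .
  then show thesis by (intro that[of BB]) (auto simp: F_def)
qed

end

section \<open>Functions locally determined by finitely many tests\<close>

context haar_base begin

definition locally_tested :: "nat \<Rightarrow> ((nat \<Rightarrow> 'g) \<Rightarrow> 'a) \<Rightarrow> bool" where
  "locally_tested q \<sigma> \<longleftrightarrow> (\<forall>x0\<in>T q. \<exists>U F. open U \<and> x0 \<in> U \<and> finite F \<and> F \<subseteq> tests q \<and>
      (\<forall>x\<in>T q \<inter> U. \<forall>x'\<in>T q \<inter> U. (\<forall>t\<in>F. sat x t = sat x' t) \<longrightarrow> \<sigma> x = \<sigma> x'))"

lemma locally_testedE:
  assumes "locally_tested q \<sigma>" "x0 \<in> T q"
  obtains U F where "open U" "x0 \<in> U" "finite F" "F \<subseteq> tests q"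
    "\<forall>x\<in>T q \<inter> U. \<forall>x'\<in>T q \<inter> U. (\<forall>t\<in>F. sat x t = sat x' t) \<longrightarrow> \<sigma> x = \<sigma> x'"
  using assms(1)[unfolded locally_tested_def, THEN bspec, OF assms(2)]
  by (elim exE conjE) (rule that)

lemma locally_tested_finite:
  assumes "locally_tested q \<sigma>"
  shows "loc_finite_valued (T q) \<sigma>"
  unfolding loc_finite_valued_def
proof
  fix x0 assume x0: "x0 \<in> T q"
  obtain U F where U: "open U" "x0 \<in> U" "finite F" "F \<subseteq> tests q"
    "\<forall>x\<in>T q \<inter> U. \<forall>x'\<in>T q \<inter> U. (\<forall>t\<in>F. sat x t = sat x' t) \<longrightarrow> \<sigma> x = \<sigma> x'"
    using locally_testedE[OF assms x0] .
  have "finite (\<sigma> ` (T q \<inter> U))" by (rule finite_image_patterns[where R = sat, OF U(3)]) (use U(5) in blast)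
  then have "finite (\<sigma> ` (U \<inter> T q))" by (simp only: Int_commute)
  with U(1,2) show "\<exists>U. open U \<and> x0 \<in> U \<and> finite (\<sigma> ` (U \<inter> T q))" by blast
qed

text \<open>For \<open>b = c\<close> the quotient is \<open>e\<close> at every tuple, so the outcome
  never changes, even if \<open>e\<close> is on the boundary of \<open>B\<close>; otherwise
  continuity of the quotient gives the neighbourhood.\<close>

lemma sat_locally_constant:
  assumes t: "(b, c, B) \<in> tests a" and x0: "x0 \<in> T a"
    and lc: "b = c \<or> loc_const_at B (m (i (x0 b)) (x0 c))"
  shows "\<exists>U. open U \<and> x0 \<in> U \<and> (\<forall>x\<in>T a \<inter> U. sat x (b, c, B) = sat x0 (b, c, B))"
proof (cases "b = c")
  case True
  have "b < a" using t by (auto simp: tests_def)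
  then have "sat x (b, c, B) = (e \<in> B)" if "x \<in> T a" for x
    using tuples_D[OF that] True by (simp add: sat_def)
  then show ?thesis using x0 by (intro exI[of _ UNIV]) auto
next
  case False
  have bc: "b < a" "c < a" using t by (auto simp: tests_def)
  obtain V where V: "openin (top_of_set G) V" "m (i (x0 b)) (x0 c) \<in> V"
    "\<forall>y\<in>V. (y \<in> B) = (m (i (x0 b)) (x0 c) \<in> B)" using lc False by (auto simp: loc_const_at_def)
  obtain V' where V': "open V'" "V = G \<inter> V'" using V(1) by (auto simp: openin_open)
  have "openin (top_of_set (T a)) (T a \<inter> (\<lambda>x. m (i (x b)) (x c)) -` V')"
    using continuous_quotient[OF bc] V'(1) by (rule continuous_openin_preimage_gen)
  then obtain U where U: "open U" "T a \<inter> (\<lambda>x. m (i (x b)) (x c)) -` V' = T a \<inter> U"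
    by (auto simp: openin_open)
  have "x0 \<in> U" using U(2) x0 V(2) V'(2) by auto
  moreover have "sat x (b, c, B) = sat x0 (b, c, B)" if x: "x \<in> T a \<inter> U" for x
  proof -
    have "m (i (x b)) (x c) \<in> V'" using x U(2) by auto
    moreover have "m (i (x b)) (x c) \<in> G" using x bc by (auto intro: tuples_D)
    ultimately have "m (i (x b)) (x c) \<in> V" using V'(2) by blast
    with V(3) show ?thesis by (simp add: sat_def)
  qed
  ultimately show ?thesis using U(1) by blast
qed

lemma locally_tested_constant:
  assumes \<sigma>: "locally_tested q \<sigma>" and x0: "x0 \<in> T q"
    and lc: "\<And>b c B. (b, c, B) \<in> tests q \<Longrightarrow> b = c \<or> loc_const_at B (m (i (x0 b)) (x0 c))"
  shows "\<exists>U. open U \<and> x0 \<in> U \<and> (\<forall>x\<in>T q \<inter> U. \<sigma> x = \<sigma> x0)"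
proof -
  obtain U F where U: "open U" "x0 \<in> U" "finite F" "F \<subseteq> tests q"
    "\<forall>x\<in>T q \<inter> U. \<forall>x'\<in>T q \<inter> U. (\<forall>t\<in>F. sat x t = sat x' t) \<longrightarrow> \<sigma> x = \<sigma> x'"
    using locally_testedE[OF \<sigma> x0] .
  have "\<forall>t. \<exists>V. t \<in> F \<longrightarrow> open V \<and> x0 \<in> V \<and> (\<forall>x\<in>T q \<inter> V. sat x t = sat x0 t)"
  proof
    fix t :: "nat \<times> nat \<times> 'g set"
    obtain b c B where t: "t = (b, c, B)" by (cases t)
    show "\<exists>V. t \<in> F \<longrightarrow> open V \<and> x0 \<in> V \<and> (\<forall>x\<in>T q \<inter> V. sat x t = sat x0 t)"
    proof (cases "t \<in> F")
      case True
      then have bc: "(b, c, B) \<in> tests q" using U(4) t by blast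
      from sat_locally_constant[OF bc x0 lc[OF bc]] obtain V
        where "open V \<and> x0 \<in> V \<and> (\<forall>x\<in>T q \<inter> V. sat x (b, c, B) = sat x0 (b, c, B))" ..
      then show ?thesis unfolding t by (intro exI[of _ V] impI)
    qed simp
  qed
  from choice[OF this] obtain V where V: "\<forall>t. t \<in> F \<longrightarrow> open (V t) \<and> x0 \<in> V t \<and> (\<forall>x\<in>T q \<inter> V t. sat x t = sat x0 t)" ..
  define W where "W = U \<inter> (\<Inter>t\<in>F. V t)"
  have "open W" unfolding W_def using U V by (intro open_Int open_INT) auto
  moreover have "x0 \<in> W" unfolding W_def using U V by auto
  moreover have "\<sigma> x = \<sigma> x0" if x: "x \<in> T q \<inter> W" for x
  proof -
    have "\<forall>t\<in>F. sat x t = sat x0 t" using V x by (auto simp: W_def)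
    moreover have "x \<in> T q \<inter> U" "x0 \<in> T q \<inter> U" using x x0 U by (auto simp: W_def)
    ultimately show ?thesis using U(5) by blast
  qed
  ultimately show ?thesis by blast
qed

end

theorem (in haar_module) nice_representative:
  assumes f: "mcocycle m i G act \<mu> p f"
  shows "\<exists>\<sigma>. mcocycle m i G act \<mu> p \<sigma> \<and> cohomologous m i G act \<mu> p \<sigma> f
            \<and> loc_finite_valued (tuples G (Suc p)) \<sigma>
            \<and> (\<exists>W. openin (top_of_set (tuples G (Suc p))) W
                   \<and> tuples G (Suc p) \<subseteq> closure W
                   \<and> (AE x in tmeas \<mu> (Suc p). x \<in> W)
                   \<and> loc_const_on W \<sigma>)"
proof -
  obtain \<phi> C where w: "\<phi> \<in> borel_measurable N" "integral\<^sup>N \<mu> \<phi> = 1" "C < \<infinity>" "\<And>x. \<phi> x \<le> C"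
    "\<And>K. compact K \<Longrightarrow> K \<subseteq> G \<Longrightarrow> \<exists>c>0. \<forall>x\<in>K. c \<le> \<phi> x"
    by (rule prob_weight_exists) blast
  interpret hp: haar_prob G m i e \<mu> act \<phi> C by unfold_locales (fact w)+
  obtain BB where BB: "countable BB" "\<And>B. B \<in> BB \<Longrightarrow> openin (top_of_set G) B"
    "\<And>B. B \<in> BB \<Longrightarrow> AE x in hp.\<nu>. loc_const_at B x"
    "\<forall>U x. openin (top_of_set G) U \<longrightarrow> x \<in> U \<longrightarrow> (\<exists>B\<in>BB. x \<in> B \<and> B \<subseteq> U)"
    by (rule hp.null_boundary_base) blast
  interpret hb: haar_base G m i e \<mu> act \<phi> C BB
    by unfold_locales (rule BB(1), rule BB(2), assumption, rule BB(4)[rule_format])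
  obtain \<sigma> where \<sigma>: "mcocycle m i G act \<mu> p \<sigma>" "cohomologous m i G act \<mu> p \<sigma> f" "hb.locally_tested (Suc p) \<sigma>"
    using hb.tame_representative[OF f] unfolding hb.locally_tested_def by blast
  \<comment> \<open>All points near which \<open>\<sigma>\<close> is constant, so that openness and
    local constancy are immediate; density will follow from full measure.\<close>
  define W where "W = {x \<in> T (Suc p). \<exists>U. open U \<and> x \<in> U \<and> (\<forall>y\<in>T (Suc p) \<inter> U. \<sigma> y = \<sigma> x)}"
  have Wopen: "openin (top_of_set (T (Suc p))) W"
  proof (subst openin_subopen, intro ballI)
    fix x assume "x \<in> W"
    then obtain U where U: "x \<in> T (Suc p)" "open U" "x \<in> U" "\<forall>y\<in>T (Suc p) \<inter> U. \<sigma> y = \<sigma> x" by (auto simp: W_def)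
    show "\<exists>V. openin (top_of_set (T (Suc p))) V \<and> x \<in> V \<and> V \<subseteq> W"
    proof (intro exI[of _ "T (Suc p) \<inter> U"] conjI subsetI)
      show "openin (top_of_set (T (Suc p))) (T (Suc p) \<inter> U)" using U(2) by (rule openin_open_Int)
      show "x \<in> T (Suc p) \<inter> U" using U(1,3) by blast
      fix z assume z: "z \<in> T (Suc p) \<inter> U"
      then have "\<forall>y\<in>T (Suc p) \<inter> U. \<sigma> y = \<sigma> z" using U(4) by simp
      with z U(2) show "z \<in> W" unfolding W_def by blast
    qed
  qed
  \<comment> \<open>There are only countably many tests, and for each of them almost every quotient
    avoids the null boundary of its basic set.\<close>
  have "AE x in hp.P (Suc p). \<forall>t\<in>hb.tests (Suc p). fst t \<noteq> fst (snd t) \<longrightarrow>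
      loc_const_at (snd (snd t)) (m (i (x (fst t))) (x (fst (snd t))))"
  proof (subst AE_ball_countable[OF hb.countable_tests], intro ballI)
    fix t assume "t \<in> hb.tests (Suc p)"
    then obtain b c B where t: "t = (b, c, B)" "b < Suc p" "c < Suc p" "B \<in> BB"
      by (auto simp: hb.tests_def)
    show "AE x in hp.P (Suc p). fst t \<noteq> fst (snd t) \<longrightarrow>
      loc_const_at (snd (snd t)) (m (i (x (fst t))) (x (fst (snd t))))"
      using hp.AE_quotient[OF _ t(2,3) BB(3)[OF t(4)]] unfolding t(1) by (cases "b = c") auto
  qed
  then have WP: "AE x in hp.P (Suc p). x \<in> W" using AE_space
  proof eventually_elim
    case (elim x)
    then have x: "x \<in> T (Suc p)" by simp
    have "b = c \<or> loc_const_at B (m (i (x b)) (x c))" if "(b, c, B) \<in> hb.tests (Suc p)" for b c B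
      using elim(1) that by fastforce
    from hb.locally_tested_constant[OF \<sigma>(3) x this] show ?case using x by (simp add: W_def)
  qed
  have dense: "T (Suc p) \<subseteq> closure W"
  proof
    fix x assume x: "x \<in> T (Suc p)"
    show "x \<in> closure W" unfolding closure_iff_nhds_not_empty
    proof (intro allI impI)
      fix A V assume "V \<subseteq> A" "open V" "x \<in> V"
      then show "W \<inter> A \<noteq> {}" using hp.AE_dense[OF WP _ x] by blast
    qed
  qed
  have "loc_const_on W \<sigma>" unfolding loc_const_on_def W_def by blast
  with \<sigma> hb.locally_tested_finite[OF \<sigma>(3)] Wopen dense WP show ?thesis
    unfolding hp.AE_P_iff by blast
qed

section \<open>Algebraic groups\<close>

lemma polyfuns_sum:
  assumes "\<And>j. j \<in> J \<Longrightarrow> (\<lambda>x. f j x) \<in> polyfuns C"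
  shows "(\<lambda>x. \<Sum>j\<in>J. f j x) \<in> polyfuns C"
  using assms by (induction J rule: infinite_finite_induct) (auto intro: polyfuns.intros)

lemma polyfuns_prod:
  assumes "\<And>j. j \<in> J \<Longrightarrow> (\<lambda>x. f j x) \<in> polyfuns C"
  shows "(\<lambda>x. \<Prod>j\<in>J. f j x) \<in> polyfuns C"
  using assms by (induction J rule: infinite_finite_induct) (auto intro: polyfuns.intros)

lemma polyfuns_diff:
  assumes "f \<in> polyfuns C" "g \<in> polyfuns C"
  shows "(\<lambda>x. f x - g x) \<in> polyfuns C"
  using padd[OF assms(1) pmult[OF pconst[of "-1"] assms(2)]] by simp

lemma polyfuns_det:
  fixes M :: "'x \<Rightarrow> real^'n^'n"
  assumes "\<And>r s. (\<lambda>x. M x $ r $ s) \<in> polyfuns C"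
  shows "(\<lambda>x. det (M x)) \<in> polyfuns C"
  unfolding det_def by (intro polyfuns_sum pmult pconst polyfuns_prod assms)

lemma semialg_empty: "{} \<in> semialg C"
  using sbasic[OF pconst[of 0]] by simp

lemma semialg_UN:
  assumes "finite J" "\<And>j. j \<in> J \<Longrightarrow> S j \<in> semialg C"
  shows "(\<Union>j\<in>J. S j) \<in> semialg C"
  using assms by (induction J rule: finite_induct) (auto intro: semialg_empty sunion)

lemma semialg_INT:
  assumes "finite J" "\<And>j. j \<in> J \<Longrightarrow> S j \<in> semialg C"
  shows "(\<Inter>j\<in>J. S j) \<in> semialg C"
proof -
  have "- (\<Union>j\<in>J. - S j) \<in> semialg C" using assms by (intro scompl semialg_UN) auto
  then show ?thesis by simp
qed

text \<open>The entry \<open>(r, s)\<close> of the adjugate of \<open>A\<close>.\<close>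

definition cofac :: "real^'n^'n \<Rightarrow> 'n \<Rightarrow> 'n \<Rightarrow> real" where
  "cofac A r s = det (\<chi> k l. if l = r then (if k = s then 1 else 0) else A $ k $ l)"

lemma matrix_inv_props:
  fixes A :: "real^'n^'n"
  assumes "invertible A"
  shows "A ** matrix_inv A = mat 1" "matrix_inv A ** A = mat 1"
  using someI_ex[OF assms[unfolded invertible_def]] by (simp_all add: matrix_inv_def)

text \<open>Cramer's rule for the linear system whose solution is the column \<open>s\<close> of the
  inverse.\<close>

lemma matrix_inv_cofac:
  fixes A :: "real^'n^'n"
  assumes "invertible A"
  shows "matrix_inv A $ r $ s = cofac A r s / det A"
proof -
  have d: "det A \<noteq> 0" using assms by (simp add: invertible_det_nz)
  have "A *v column s (matrix_inv A) = (\<chi> k. if k = s then 1 else 0)"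
  proof -
    have "(A *v column s (matrix_inv A)) $ k = (A ** matrix_inv A) $ k $ s" for k
      by (simp add: matrix_vector_mult_def matrix_matrix_mult_def column_def)
    then show ?thesis by (simp add: vec_eq_iff matrix_inv_props[OF assms] mat_def)
  qed
  then have "column s (matrix_inv A) $ r = cofac A r s / det A"
    unfolding cramer[OF d] by (simp add: cofac_def cong: if_cong)
  then show ?thesis by (simp add: column_def)
qed

lemma polyfuns_cofac:
  assumes "\<And>r s. (\<lambda>x. M x $ r $ s) \<in> polyfuns C"
  shows "(\<lambda>x. cofac (M x) r s) \<in> polyfuns C"
  unfolding cofac_def
proof (rule polyfuns_det)
  fix k l
  show "(\<lambda>x. (\<chi> k l. if l = r then if k = s then 1 else 0 else M x $ k $ l) $ k $ l) \<in> polyfuns C"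
    by (cases "l = r") (simp_all add: assms pconst)
qed

lemma polyfuns_continuous:
  assumes "f \<in> polyfuns C" "\<And>c. c \<in> C \<Longrightarrow> continuous_on A c"
  shows "continuous_on A f"
  using assms by induction (auto intro!: continuous_intros)

lemma mat_coords_continuous: "c \<in> mat_coords \<Longrightarrow> continuous_on A c"
  by (auto simp: mat_coords_def intro!: continuous_intros)

lemma mat_entry_poly: "(\<lambda>A. A $ r $ s) \<in> polyfuns mat_coords"
  by (rule pcoord) (auto simp: mat_coords_def)

lemma continuous_on_det: "continuous_on S (det :: real^'n^'n \<Rightarrow> real)"
  using polyfuns_continuous[OF polyfuns_det[OF mat_entry_poly] mat_coords_continuous] by simp

lemma continuous_on_matrix_inv: "continuous_on {A. invertible A} (matrix_inv :: real^'n^'n \<Rightarrow> real^'n^'n)"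
proof -
  have "continuous_on {A. invertible A} (\<lambda>A :: real^'n^'n. \<chi> r s. cofac A r s / det A)"
    by (intro continuous_on_vec_lambda continuous_on_divide continuous_on_det
        polyfuns_continuous[OF polyfuns_cofac[OF mat_entry_poly] mat_coords_continuous])
       (auto simp: invertible_det_nz)
  then show ?thesis
    by (rule continuous_on_eq) (simp add: vec_eq_iff matrix_inv_cofac)
qed

lemma open_invertible: "open {A :: real^'n^'n. invertible A}"
proof -
  have "open (det -` (- {0::real}) :: (real^'n^'n) set)"
    using continuous_on_det by (intro open_vimage) auto
  also have "det -` (- {0::real}) = {A :: real^'n^'n. invertible A}" by (auto simp: invertible_det_nz)
  finally show ?thesis .
qed

text \<open>A closed subset of the open set of invertible matrices is locally compact; inversion is
  continuous because its entries are quotients of polynomials.\<close>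

lemma closed_algebraic_lcsc:
  fixes G :: "(real^'n^'n) set"
  assumes G: "closed_algebraic_subgroup G"
  shows "lcsc_group G (**) matrix_inv (mat 1)"
proof -
  let ?L = "{A :: real^'n^'n. invertible A}"
  have GL: "G \<subseteq> ?L" using G by (auto simp: closed_algebraic_subgroup_def)
  have "locally_compact_space (top_of_set ?L)"
    using open_invertible by (intro locally_compact_space_open_subset locally_compact_space_euclidean) auto
  then have "locally_compact_space (subtopology (top_of_set ?L) G)"
    by (rule locally_compact_space_closed_subset) (use G in \<open>simp add: closed_algebraic_subgroup_def\<close>)
  then have lc: "locally_compact_space (top_of_set G)"
    using GL by (simp add: subtopology_subtopology Int_absorb1)
  have cm: "continuous_on (G \<times> G) (\<lambda>z. fst z ** snd z)"
    unfolding matrix_matrix_mult_def by (intro continuous_intros)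
  have ci: "continuous_on G matrix_inv" using continuous_on_matrix_inv GL by (rule continuous_on_subset)
  have inv: "A ** matrix_inv A = mat 1" "matrix_inv A ** A = mat 1" if "A \<in> G" for A
    using matrix_inv_props[of A] GL that by auto
  have "mat 1 \<in> G" "\<forall>A\<in>G. \<forall>B\<in>G. A ** B \<in> G" "\<forall>A\<in>G. matrix_inv A \<in> G"
    using G unfolding closed_algebraic_subgroup_def by blast+
  with lc cm ci inv show ?thesis unfolding lcsc_group_def by (simp add: matrix_mul_assoc)
qed

lemma sq_dist_poly:
  fixes M :: "'x \<Rightarrow> real^'n^'n"
  assumes "\<And>r s. (\<lambda>x. M x $ r $ s) \<in> polyfuns C"
  shows "(\<lambda>x. M x \<bullet> M x) \<in> polyfuns C"
  unfolding inner_vec_def inner_real_def by (intro polyfuns_sum pmult assms)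

text \<open>Multiplying by the determinant clears the denominator of the inverse.\<close>

lemma quotient_ball_semialg:
  fixes Q :: "real^'n^'n"
  assumes "b < q" "c < q"
  shows "\<exists>S\<in>semialg (tuple_coords q). \<forall>x. invertible (x b) \<longrightarrow>
    (x \<in> S \<longleftrightarrow> (matrix_inv (x b) ** x c - Q) \<bullet> (matrix_inv (x b) ** x c - Q) < \<rho>)"
proof -
  define M where "M x = (\<chi> r s. (\<Sum>k\<in>UNIV. cofac (x b) r k * x c $ k $ s) - det (x b) * Q $ r $ s)"
    for x :: "nat \<Rightarrow> real^'n^'n"
  have co: "(\<lambda>x. x k $ r $ s) \<in> polyfuns (tuple_coords q)" if "k < q" for k r s
    by (rule pcoord) (use that in \<open>auto simp: tuple_coords_def\<close>)
  have Mp: "(\<lambda>x. M x $ r $ s) \<in> polyfuns (tuple_coords q)" for r s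
    unfolding M_def vec_lambda_beta
    by (intro polyfuns_diff polyfuns_sum pmult polyfuns_cofac polyfuns_det pconst co assms)
  have d: "(\<lambda>x. det (x b)) \<in> polyfuns (tuple_coords q)" by (intro polyfuns_det co assms)
  let ?f = "\<lambda>x. \<rho> * (det (x b) * det (x b)) - M x \<bullet> M x"
  have "{x. 0 < ?f x} \<in> semialg (tuple_coords q)"
    by (intro sbasic polyfuns_diff pmult pconst d sq_dist_poly Mp)
  moreover have "x \<in> {x. 0 < ?f x} \<longleftrightarrow> (matrix_inv (x b) ** x c - Q) \<bullet> (matrix_inv (x b) ** x c - Q) < \<rho>"
    if inv: "invertible (x b)" for x
  proof -
    let ?D = "matrix_inv (x b) ** x c - Q"
    have d0: "det (x b) \<noteq> 0" using inv by (simp add: invertible_det_nz)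
    have "M x = det (x b) *\<^sub>R ?D"
      using d0 by (simp add: vec_eq_iff M_def matrix_matrix_mult_def matrix_inv_cofac[OF inv]
          right_diff_distrib sum_distrib_left)
    then have "M x \<bullet> M x = (det (x b) * det (x b)) * (?D \<bullet> ?D)"
      by (simp only: inner_scaleR_left inner_scaleR_right mult.assoc)
    then have "?f x = (det (x b) * det (x b)) * (\<rho> - ?D \<bullet> ?D)"
      by (simp only: right_diff_distrib mult.commute[of \<rho>])
    moreover have "0 < det (x b) * det (x b)" using d0 by (auto simp: zero_less_mult_iff neq_iff)
    moreover have "0 < c * k \<longleftrightarrow> 0 < k" if "0 < c" for c k :: real
      using that by (simp add: zero_less_mult_iff)
    ultimately have "0 < ?f x \<longleftrightarrow> 0 < \<rho> - ?D \<bullet> ?D" by (simp only:)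
    then show ?thesis by (simp only: mem_Collect_eq diff_gt_0_iff_gt)
  qed
  ultimately show ?thesis by blast
qed

text \<open>With balls as basic sets each test is semialgebraic on \<open>T (Suc p)\<close>, and
  near a given tuple a level set is a finite union of cells, each given by the outcomes of finitely
  many tests.\<close>

theorem semialgebraic_representative:
  fixes G :: "(real^'n^'n) set" and act :: "real^'n^'n \<Rightarrow> 'a::{ab_group_add,countable} \<Rightarrow> 'a"
  assumes G: "closed_algebraic_subgroup G" and mu: "haar_measure G (**) \<mu>"
    and dm: "discrete_module G (**) (mat 1) act" and f: "mcocycle (**) matrix_inv G act \<mu> p f"
  shows "\<exists>\<sigma>. mcocycle (**) matrix_inv G act \<mu> p \<sigma>
            \<and> cohomologous (**) matrix_inv G act \<mu> p \<sigma> f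
            \<and> loc_finite_valued (tuples G (Suc p)) \<sigma>
            \<and> (\<forall>x\<in>tuples G (Suc p). \<exists>U. open U \<and> x \<in> U \<and>
                 (\<forall>a. \<exists>S\<in>semialg (tuple_coords (Suc p)).
                        {y\<in>tuples G (Suc p). \<sigma> y = a} \<inter> U = S \<inter> tuples G (Suc p) \<inter> U))
            \<and> (\<exists>N. open N \<and> restrict (\<lambda>_. mat 1) {..<Suc p} \<in> N
                   \<and> loc_const_on (N \<inter> tuples G (Suc p)) \<sigma>)"
proof -
  interpret haar_module G "(**)" matrix_inv "mat 1" \<mu> act
    by unfold_locales (fact closed_algebraic_lcsc[OF G] mu dm)+
  have GL: "A \<in> G \<Longrightarrow> invertible A" for A using G by (auto simp: closed_algebraic_subgroup_def)
  obtain \<phi> C where w: "\<phi> \<in> borel_measurable N" "integral\<^sup>N \<mu> \<phi> = 1" "C < \<infinity>" "\<And>x. \<phi> x \<le> C"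
    "\<And>K. compact K \<Longrightarrow> K \<subseteq> G \<Longrightarrow> \<exists>c>0. \<forall>x\<in>K. c \<le> \<phi> x"
    by (rule prob_weight_exists) blast
  interpret hp: haar_prob G "(**)" matrix_inv "mat 1" \<mu> act \<phi> C by unfold_locales (fact w)+
  \<comment> \<open>Balls whose boundary avoids the identity: this makes the representative constant near \<open>(e, ..., e)\<close>.\<close>
  define BL where "BL Q \<rho> = {A \<in> G. (A - Q) \<bullet> (A - Q) < \<rho>}" for Q :: "real^'n^'n" and \<rho> :: real
  define FF where "FF = {BL Q \<rho> | Q \<rho>. (mat 1 - Q) \<bullet> (mat 1 - Q) \<noteq> \<rho>}"
  have opn: "open {A. (A - Q) \<bullet> (A - Q) < \<rho>}" "open {A. \<rho> < (A - Q) \<bullet> (A - Q)}" for Q :: "real^'n^'n" and \<rho>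
    by (intro open_Collect_less continuous_intros)+
  have BLo: "openin (top_of_set G) (BL Q \<rho>)" for Q \<rho>
    using openin_open_Int[OF opn(1)[of Q \<rho>], of G] by (simp add: BL_def Collect_conj_eq)
  have FFo: "openin (top_of_set G) B" if "B \<in> FF" for B using that BLo by (auto simp: FF_def)
  have base: "\<exists>B\<in>FF. x \<in> B \<and> B \<subseteq> U" if U: "openin (top_of_set G) U" "x \<in> U" for U x
  proof -
    have xG: "x \<in> G" using U openin_imp_subset by blast
    obtain \<epsilon> where eps: "0 < \<epsilon>" "ball x \<epsilon> \<inter> G \<subseteq> U" using U by (auto simp: openin_contains_ball)
    \<comment> \<open>Only one squared radius puts the identity on the sphere around
      \<open>x\<close>, so an admissible one remains below \<open>\<epsilon>^2\<close>.\<close>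
    have "infinite ({0<..<\<epsilon>^2} - {(mat 1 - x) \<bullet> (mat 1 - x)})" using eps(1) by (simp add: infinite_Ioo)
    from infinite_imp_nonempty[OF this] obtain \<rho> where "\<rho> \<in> {0<..<\<epsilon>^2} - {(mat 1 - x) \<bullet> (mat 1 - x)}" by blast
    then have r: "0 < \<rho>" "\<rho> < \<epsilon>^2" "(mat 1 - x) \<bullet> (mat 1 - x) \<noteq> \<rho>" by auto
    have "BL x \<rho> \<subseteq> U"
    proof
      fix A assume A: "A \<in> BL x \<rho>"
      then have "(norm (A - x))^2 < \<epsilon>^2" using r by (simp add: BL_def power2_norm_eq_inner)
      then have "dist x A < \<epsilon>" using eps(1) by (simp add: dist_norm norm_minus_commute power_less_imp_less_base)
      then show "A \<in> U" using A eps(2) by (auto simp: BL_def)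
    qed
    moreover have "x \<in> BL x \<rho>" using xG r by (simp add: BL_def)
    ultimately show ?thesis using r(3) unfolding FF_def by blast
  qed
  obtain BB where BB: "BB \<subseteq> FF" "countable BB"
    "\<forall>U x. openin (top_of_set G) U \<longrightarrow> x \<in> U \<longrightarrow> (\<exists>B\<in>BB. x \<in> B \<and> B \<subseteq> U)"
    using countable_subbase[of FF, OF FFo base] .
  interpret hb: haar_base G "(**)" matrix_inv "mat 1" \<mu> act \<phi> C BB
    by unfold_locales (rule BB(2), rule FFo[OF subsetD[OF BB(1)]], assumption, rule BB(3)[rule_format])
  obtain \<sigma> where \<sigma>: "mcocycle (**) matrix_inv G act \<mu> p \<sigma>" "cohomologous (**) matrix_inv G act \<mu> p \<sigma> f"
    "hb.locally_tested (Suc p) \<sigma>"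
    using hb.tame_representative[OF f] unfolding hb.locally_tested_def by blast
  \<comment> \<open>The squared distance from \<open>Q\<close> to the identity differs from
    \<open>\<rho>\<close>, so one of two strict inequalities persists nearby.\<close>
  have lc1: "loc_const_at B (mat 1)" if B: "B \<in> BB" for B
  proof -
    obtain Q \<rho> where Q: "B = BL Q \<rho>" "(mat 1 - Q) \<bullet> (mat 1 - Q) \<noteq> \<rho>" using B BB(1) by (auto simp: FF_def)
    show ?thesis unfolding loc_const_at_def
    proof (cases "(mat 1 - Q) \<bullet> (mat 1 - Q) < \<rho>")
      case True
      then show "\<exists>V. openin (top_of_set G) V \<and> mat 1 \<in> V \<and> (\<forall>y\<in>V. (y \<in> B) = (mat 1 \<in> B))"
        using BLo[of Q \<rho>] e_in by (intro exI[of _ B]) (auto simp: Q(1) BL_def)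
    next
      case False
      then show "\<exists>V. openin (top_of_set G) V \<and> mat 1 \<in> V \<and> (\<forall>y\<in>V. (y \<in> B) = (mat 1 \<in> B))"
        using Q(2) openin_open_Int[OF opn(2)[of \<rho> Q], of G] e_in
        by (intro exI[of _ "G \<inter> {A. \<rho> < (A - Q) \<bullet> (A - Q)}"]) (auto simp: Q(1) BL_def)
    qed
  qed
  have "\<forall>t. \<exists>S. t \<in> hb.tests (Suc p) \<longrightarrow>
     S \<in> semialg (tuple_coords (Suc p)) \<and> (\<forall>x\<in>T (Suc p). x \<in> S \<longleftrightarrow> hb.sat x t)"
  proof
    fix t :: "nat \<times> nat \<times> (real^'n^'n) set"
    show "\<exists>S. t \<in> hb.tests (Suc p) \<longrightarrow>
     S \<in> semialg (tuple_coords (Suc p)) \<and> (\<forall>x\<in>T (Suc p). x \<in> S \<longleftrightarrow> hb.sat x t)"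
    proof (cases "t \<in> hb.tests (Suc p)")
      case True
      then obtain b c B where t: "t = (b, c, B)" "b < Suc p" "c < Suc p" "B \<in> BB" by (auto simp: hb.tests_def)
      obtain Q \<rho> where Q: "B = BL Q \<rho>" using t(4) BB(1) by (auto simp: FF_def)
      obtain S where S: "S \<in> semialg (tuple_coords (Suc p))" "\<forall>x. invertible (x b) \<longrightarrow>
        (x \<in> S \<longleftrightarrow> (matrix_inv (x b) ** x c - Q) \<bullet> (matrix_inv (x b) ** x c - Q) < \<rho>)"
        using quotient_ball_semialg[OF t(2,3), of Q \<rho>] by blast
      have "x \<in> S \<longleftrightarrow> hb.sat x t" if x: "x \<in> T (Suc p)" for x
      proof -
        have xb: "x b \<in> G" and xc: "x c \<in> G" using x t(2,3) by (auto intro: tuples_D)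
        have "matrix_inv (x b) ** x c \<in> G" using m_in[OF i_in[OF xb] xc] .
        then show ?thesis using S(2) GL[OF xb] by (simp add: hb.sat_def t(1) Q BL_def)
      qed
      with S(1) show ?thesis by blast
    qed simp
  qed
  from choice[OF this] obtain SS where SS: "\<forall>t. t \<in> hb.tests (Suc p) \<longrightarrow>
     SS t \<in> semialg (tuple_coords (Suc p)) \<and> (\<forall>x\<in>T (Suc p). x \<in> SS t \<longleftrightarrow> hb.sat x t)" ..
  have level: "\<exists>U. open U \<and> x0 \<in> U \<and> (\<forall>a. \<exists>S\<in>semialg (tuple_coords (Suc p)).
      {y\<in>T (Suc p). \<sigma> y = a} \<inter> U = S \<inter> T (Suc p) \<inter> U)" if x0: "x0 \<in> T (Suc p)" for x0
  proof -
    obtain U F where U: "open U" "x0 \<in> U" "finite F" "F \<subseteq> hb.tests (Suc p)"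
      "\<forall>x\<in>T (Suc p) \<inter> U. \<forall>x'\<in>T (Suc p) \<inter> U. (\<forall>t\<in>F. hb.sat x t = hb.sat x' t) \<longrightarrow> \<sigma> x = \<sigma> x'"
      using hb.locally_testedE[OF \<sigma>(3) x0] .
    have SSF: "SS t \<in> semialg (tuple_coords (Suc p))" "\<And>x. x \<in> T (Suc p) \<Longrightarrow> x \<in> SS t \<longleftrightarrow> hb.sat x t"
      if "t \<in> F" for t using SS U(4) that by blast+
    define cell where "cell D = (\<Inter>t\<in>F. if t \<in> D then SS t else - SS t)" for D
    have cellS: "cell D \<in> semialg (tuple_coords (Suc p))" for D
      unfolding cell_def using SSF(1) by (intro semialg_INT U(3)) (auto intro: scompl)
    have cell: "x \<in> cell D \<longleftrightarrow> {t \<in> F. hb.sat x t} = D" if "x \<in> T (Suc p)" "D \<subseteq> F" for x D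
    proof -
      have "x \<in> cell D \<longleftrightarrow> (\<forall>t\<in>F. x \<in> (if t \<in> D then SS t else - SS t))"
        by (simp only: cell_def INT_iff)
      also have "\<dots> \<longleftrightarrow> (\<forall>t\<in>F. hb.sat x t \<longleftrightarrow> t \<in> D)"
      proof (rule ball_cong[OF refl])
        fix t assume "t \<in> F"
        from SSF(2)[OF this that(1)]
        show "x \<in> (if t \<in> D then SS t else - SS t) \<longleftrightarrow> (hb.sat x t \<longleftrightarrow> t \<in> D)" by simp
      qed
      finally show ?thesis using that(2) by blast
    qed
    have "\<exists>S\<in>semialg (tuple_coords (Suc p)). {y\<in>T (Suc p). \<sigma> y = a} \<inter> U = S \<inter> T (Suc p) \<inter> U" for a
    proof
      \<comment> \<open>The patterns that occur in \<open>U\<close> with value \<open>a\<close>; as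
        the pattern determines \<open>\<sigma>\<close> on \<open>U\<close>, the level set is there
        exactly the union of their cells.\<close>
      define DD where "DD = {{t \<in> F. hb.sat y t} | y. y \<in> T (Suc p) \<inter> U \<and> \<sigma> y = a}"
      have DDF: "DD \<subseteq> Pow F" by (auto simp: DD_def)
      then have "finite DD" using U(3) by (meson finite_Pow_iff finite_subset)
      then show "(\<Union>D\<in>DD. cell D) \<in> semialg (tuple_coords (Suc p))" using cellS by (intro semialg_UN) auto
      show "{y\<in>T (Suc p). \<sigma> y = a} \<inter> U = (\<Union>D\<in>DD. cell D) \<inter> T (Suc p) \<inter> U"
      proof (intro set_eqI iffI)
        fix y assume y: "y \<in> {y\<in>T (Suc p). \<sigma> y = a} \<inter> U"
        then have "{t \<in> F. hb.sat y t} \<in> DD" by (auto simp: DD_def)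
        moreover have "y \<in> cell {t \<in> F. hb.sat y t}" using y by (subst cell) auto
        ultimately show "y \<in> (\<Union>D\<in>DD. cell D) \<inter> T (Suc p) \<inter> U" using y by blast
      next
        fix y assume y: "y \<in> (\<Union>D\<in>DD. cell D) \<inter> T (Suc p) \<inter> U"
        then obtain D where D: "D \<in> DD" "y \<in> cell D" by blast
        then obtain z where z: "z \<in> T (Suc p) \<inter> U" "\<sigma> z = a" "D = {t \<in> F. hb.sat z t}" by (auto simp: DD_def)
        have "{t \<in> F. hb.sat y t} = D" using cell[of y D] D y DDF by blast
        then have "\<forall>t\<in>F. hb.sat y t = hb.sat z t" using z(3) by blast
        then have "\<sigma> y = \<sigma> z" using U(5) y z(1) by blast
        then show "y \<in> {y\<in>T (Suc p). \<sigma> y = a} \<inter> U" using y z(2) by blast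
      qed
    qed
    with U(1,2) show ?thesis by blast
  qed
  let ?e = "restrict (\<lambda>_. mat 1 :: real^'n^'n) {..<Suc p}"
  have eT: "?e \<in> T (Suc p)" by (rule restrict_in_tuples) (rule e_in)
  \<comment> \<open>At the identity tuple all quotients are the identity, which lies on the boundary
    of no basic ball.\<close>
  have "b = c \<or> loc_const_at B (matrix_inv (?e b) ** ?e c)" if "(b, c, B) \<in> hb.tests (Suc p)" for b c B
  proof -
    have bc: "b < Suc p" "c < Suc p" "B \<in> BB" using that by (auto simp: hb.tests_def)
    then have "matrix_inv (?e b) ** ?e c = mat 1" using m_inv(1)[OF e_in] by simp
    then show ?thesis using lc1[OF bc(3)] by simp
  qed
  from hb.locally_tested_constant[OF \<sigma>(3) eT this]
  obtain N where N: "open N" "?e \<in> N" "\<forall>x\<in>T (Suc p) \<inter> N. \<sigma> x = \<sigma> ?e" by blast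
  have "loc_const_on (N \<inter> T (Suc p)) \<sigma>"
    unfolding loc_const_on_def using N by (intro ballI exI[of _ N]) auto
  with N(1,2) have "\<exists>N. open N \<and> ?e \<in> N \<and> loc_const_on (N \<inter> T (Suc p)) \<sigma>" by blast
  with \<sigma>(1,2) hb.locally_tested_finite[OF \<sigma>(3)] level show ?thesis by (intro exI[of _ \<sigma>] conjI ballI)
qed

theorem theoremC:
  shows
  "(\<forall>(G::'g::{t2_space,second_countable_topology} set) m i e \<mu> (act::'g \<Rightarrow> 'a::{ab_group_add,countable} \<Rightarrow> 'a) p f.
      lcsc_group G m i e \<and> haar_measure G m \<mu> \<and> discrete_module G m e act
      \<and> mcocycle m i G act \<mu> p f
    \<longrightarrow> (\<exists>\<sigma>. mcocycle m i G act \<mu> p \<sigma> \<and> cohomologous m i G act \<mu> p \<sigma> f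
            \<and> loc_finite_valued (tuples G (Suc p)) \<sigma>
            \<and> (\<exists>W. openin (top_of_set (tuples G (Suc p))) W
                   \<and> tuples G (Suc p) \<subseteq> closure W
                   \<and> (AE x in tmeas \<mu> (Suc p). x \<in> W)
                   \<and> loc_const_on W \<sigma>)))
   \<and>
   (\<forall>(G::(real^'n^'n) set) \<mu> (act::real^'n^'n \<Rightarrow> 'a::{ab_group_add,countable} \<Rightarrow> 'a) p f.
      closed_algebraic_subgroup G \<and> haar_measure G (**) \<mu>
      \<and> discrete_module G (**) (mat 1) act
      \<and> mcocycle (**) matrix_inv G act \<mu> p f
    \<longrightarrow> (\<exists>\<sigma>. mcocycle (**) matrix_inv G act \<mu> p \<sigma>
            \<and> cohomologous (**) matrix_inv G act \<mu> p \<sigma> f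
            \<and> loc_finite_valued (tuples G (Suc p)) \<sigma>
            \<and> (\<forall>x\<in>tuples G (Suc p). \<exists>U. open U \<and> x \<in> U \<and>
                 (\<forall>a. \<exists>S\<in>semialg (tuple_coords (Suc p)).
                        {y\<in>tuples G (Suc p). \<sigma> y = a} \<inter> U = S \<inter> tuples G (Suc p) \<inter> U))
            \<and> (\<exists>N. open N \<and> restrict (\<lambda>_. mat 1) {..<Suc p} \<in> N
                   \<and> loc_const_on (N \<inter> tuples G (Suc p)) \<sigma>)))"
proof (rule conjI; intro allI impI; elim conjE)
  fix G :: "'g set" and m i e \<mu> and act :: "'g \<Rightarrow> 'a \<Rightarrow> 'a" and p f
  assume a: "lcsc_group G m i e" "haar_measure G m \<mu>" "discrete_module G m e act"
    and f: "mcocycle m i G act \<mu> p f"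
  interpret haar_module G m i e \<mu> act by unfold_locales (fact a)+
  show "\<exists>\<sigma>. mcocycle m i G act \<mu> p \<sigma> \<and> cohomologous m i G act \<mu> p \<sigma> f
            \<and> loc_finite_valued (tuples G (Suc p)) \<sigma>
            \<and> (\<exists>W. openin (top_of_set (tuples G (Suc p))) W
                   \<and> tuples G (Suc p) \<subseteq> closure W
                   \<and> (AE x in tmeas \<mu> (Suc p). x \<in> W)
                   \<and> loc_const_on W \<sigma>)"
    by (rule nice_representative[OF f])
qed (rule semialgebraic_representative)

end
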